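(* Let $H>0$ and let $f:\mathbb{R}\to\mathbb{R}$ be a convex function. Let $\Omega=\mathbb{R}\times\left(-\frac{1}{2H},\frac{1}{2H}\right)$, and let $u$ and $v$ be two solutions on $\Omega$ of the constant mean curvature equation $$\operatorname{div}\left(\frac{\nabla u}{\sqrt{1+|\nabla u|^2}}\right)=2H$$ both with boundary value $\phi_f$, where $\phi_f\left(x,\pm\frac{1}{2H}\right)=f(x)$ for $x\in\mathbb{R}$. Then $u=v$.
   Context: A solution of the equation on $\Omega$ with boundary value $\phi_f$ is a function that is continuous on $\overline{\Omega}$, smooth (classical solution, $C^2$) in $\Omega$, satisfies the equation in $\Omega$, and equals $\phi_f$ on $\partial\Omega$. No growth or boundedness condition at infinity is imposed. *)

theory Defs
  imports "HOL-Analysis.Analysis"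
begin

definition gradient :: "('a::euclidean_space \<Rightarrow> real) \<Rightarrow> 'a \<Rightarrow> 'a" where
  "gradient u p = (\<Sum>b\<in>Basis. frechet_derivative u (at p) b *\<^sub>R b)"

lemma gderiv_gradient:
  assumes "u differentiable (at p)"
  shows "GDERIV u p :> gradient u p"
proof -
  have D: "(u has_derivative frechet_derivative u (at p)) (at p)"
    using assms by (simp add: frechet_derivative_works)
  then interpret linear "frechet_derivative u (at p)"
    by (rule has_derivative_linear)
  have "frechet_derivative u (at p) h = h \<bullet> gradient u p" for h
  proof -
    have "frechet_derivative u (at p) h
        = frechet_derivative u (at p) (\<Sum>b\<in>Basis. (h \<bullet> b) *\<^sub>R b)"
      by (simp only: euclidean_representation)
    also have "\<dots> = (\<Sum>b\<in>Basis. (h \<bullet> b) * frechet_derivative u (at p) b)"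
      by (simp only: sum scale real_scaleR_def)
    also have "\<dots> = h \<bullet> gradient u p"
      by (simp add: gradient_def inner_sum_right mult.commute)
    finally show ?thesis .
  qed
  then have "frechet_derivative u (at p) = (\<lambda>h. h \<bullet> gradient u p)"
    by (rule ext)
  then show ?thesis using D by (simp only: gderiv_def)
qed

definition divergence :: "('a::euclidean_space \<Rightarrow> 'a) \<Rightarrow> 'a \<Rightarrow> real" where
  "divergence F p = (\<Sum>b\<in>Basis. frechet_derivative F (at p) b \<bullet> b)"

text \<open>Intended for open \<open>S\<close>. The components of the derivative of the gradient
  are the second partial derivatives.\<close>

definition C2_on :: "'a::euclidean_space set \<Rightarrow> ('a \<Rightarrow> real) \<Rightarrow> bool" where
  "C2_on S u \<longleftrightarrow>
     (\<forall>p\<in>S. u differentiable (at p)) \<and>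
     (\<forall>p\<in>S. gradient u differentiable (at p)) \<and>
     (\<forall>b\<in>Basis. continuous_on S (\<lambda>p. frechet_derivative (gradient u) (at p) b))"

definition cmc_solution ::
  "real \<Rightarrow> 'a::euclidean_space set \<Rightarrow> ('a \<Rightarrow> real) \<Rightarrow> ('a \<Rightarrow> real) \<Rightarrow> bool" where
  "cmc_solution H \<Omega> \<phi> u \<longleftrightarrow>
     continuous_on (closure \<Omega>) u \<and>
     C2_on \<Omega> u \<and>
     (\<forall>p\<in>\<Omega>. divergence (\<lambda>q. gradient u q /\<^sub>R sqrt (1 + (norm (gradient u q))\<^sup>2)) p = 2 * H) \<and>
     (\<forall>p\<in>frontier \<Omega>. u p = \<phi> p)"

definition strip :: "real \<Rightarrow> (real \<times> real) set" where
  "strip H = UNIV \<times> {- 1 / (2 * H) <..< 1 / (2 * H)}"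

lemma closure_strip:
  assumes "H > 0"
  shows "closure (strip H) = UNIV \<times> {- 1 / (2 * H) .. 1 / (2 * H)}"
proof -
  have "1 / (2 * H) > 0" using assms by simp
  then have "- 1 / (2 * H) < 1 / (2 * H)" by linarith
  then show ?thesis
    by (simp only: strip_def closure_Times closure_UNIV closure_greaterThanLessThan)
qed

lemma frontier_strip:
  assumes "H > 0"
  shows "frontier (strip H) = UNIV \<times> {- 1 / (2 * H), 1 / (2 * H)}"
proof -
  have *: "(UNIV :: real set) \<times> {a..b} - UNIV \<times> {a<..<b} = UNIV \<times> {a, b}"
    if "a < b" for a b :: real
    using that by auto
  have "1 / (2 * H) > 0" using assms by simp
  then have "- 1 / (2 * H) < 1 / (2 * H)" by linarith
  moreover have "interior (strip H) = strip H"
    unfolding strip_def by (intro interior_open open_Times open_UNIV open_greaterThanLessThan)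
  ultimately show ?thesis
    unfolding frontier_def closure_strip[OF assms] by (simp only: strip_def *)
qed

text \<open>Boundary data are represented by functions on the whole plane, of which
  \<open>cmc_solution\<close> only uses the values on the frontier of the domain.\<close>

definition strip_data :: "(real \<Rightarrow> real) \<Rightarrow> real \<times> real \<Rightarrow> real" where
  "strip_data f = (\<lambda>(x, y). f x)"

end

theory Submission imports Defs
begin

text \<open>Put \<open>R = 1 / (2 H)\<close>, \<open>T u = \<nabla>u / sqrt (1 + \<bar>\<nabla>u\<bar>\<^sup>2)\<close> and \<open>w = u - v\<close>. As \<open>T u - T v\<close> is free of
  divergence and \<open>\<nabla>w \<bullet> (T u - T v) \<ge> \<bar>T u - T v\<bar>\<^sup>2\<close>, the flux \<open>A x\<close> of \<open>\<phi>(w) (T u - T v)\<close> through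
  the cross-section at \<open>x\<close> is nondecreasing for every nondecreasing cut-off \<open>\<phi>\<close> that vanishes
  near \<open>w \<le> 0\<close>, and it is bounded. If \<open>A\<close> has limit \<open>\<le> 0\<close> at \<open>\<infinity>\<close> and, by reflection, limit
  \<open>\<ge> 0\<close> at \<open>-\<infinity>\<close>, then it vanishes and \<open>w \<le> 0\<close>. The limit is \<open>\<le> 0\<close> as soon as \<open>w\<close> is bounded
  above near \<open>\<infinity>\<close>, since then \<open>A\<^sup>2 \<le> C A'\<close>.

  The strip is exactly as wide as a cylinder of radius \<open>R\<close>, so every affine function is the
  boundary value of a tilted half cylinder. Barriers by spheres give one-sided bounds for a
  solution: an upper bound by nearby boundary values, and a point on every long chord where the
  solution is not far below the boundary values. With the monotone flux, the latter shows that
  a cylinder whose boundary value is affine and below \<open>f\<close> lies below every solution.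

  If \<open>f\<close> has bounded slope at \<open>\<infinity>\<close>, these bounds make \<open>w\<close> bounded there. Otherwise there are
  cylinders of arbitrarily large slope below both solutions. Comparing fluxes with them shows
  that the flux of \<open>T u\<close> and of \<open>T v\<close> through a cross-section tends to its largest possible value
  \<open>\<pi> R / 2\<close>; hence \<open>T u\<close> and \<open>T v\<close> approach the same unit field \<open>X\<close> and \<open>A\<close> tends to \<open>0\<close>.\<close>

subsection \<open>The flux of the gradient\<close>

definition band :: "real \<Rightarrow> (real \<times> real) set" where
  "band R = UNIV \<times> {-R<..<R}"

text \<open>For the slope \<open>(a, b)\<close> the components of \<open>T u\<close> are
  \<open>flux a b\<close> and \<open>flux b a\<close>, so one function serves for both.\<close>

definition flux :: "real \<Rightarrow> real \<Rightarrow> real" where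
  "flux a b = a / sqrt (1 + a\<^sup>2 + b\<^sup>2)"

text \<open>The product \<open>\<nabla>w \<bullet> (T u - T v)\<close> for the slopes
  \<open>(p, q)\<close> of \<open>u\<close> and \<open>(a, b)\<close> of \<open>v\<close>.\<close>

definition slope_mono :: "real \<Rightarrow> real \<Rightarrow> real \<Rightarrow> real \<Rightarrow> real" where
  "slope_mono p q a b =
    (p - a) * (flux p q - flux a b) + (q - b) * (flux q p - flux b a)"

text \<open>\<open>R\<close> stands for \<open>1 / (2 H)\<close> and \<open>(p, q)\<close> for the gradient of \<open>u\<close>; the last
  equation is the mean curvature equation in non-divergence form.\<close>

definition cmc_graph ::
  "real \<Rightarrow> (real \<times> real \<Rightarrow> real) \<Rightarrow> (real \<times> real \<Rightarrow> real) \<Rightarrow> (real \<times> real \<Rightarrow> real) \<Rightarrow> bool" where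
  "cmc_graph R u p q \<longleftrightarrow>
    continuous_on (UNIV \<times> {-R..R}) u \<and>
    (\<forall>z\<in>band R. (u has_derivative (\<lambda>h. fst h * p z + snd h * q z)) (at z)) \<and>
    (\<exists>px py qx qy.
      continuous_on (band R) px \<and> continuous_on (band R) py \<and>
      continuous_on (band R) qx \<and> continuous_on (band R) qy \<and>
      (\<forall>z\<in>band R. (p has_derivative (\<lambda>h. fst h * px z + snd h * py z)) (at z) \<and>
        (q has_derivative (\<lambda>h. fst h * qx z + snd h * qy z)) (at z) \<and>
        (1 + (q z)\<^sup>2) * px z - p z * q z * (py z + qx z) + (1 + (p z)\<^sup>2) * qy z
          = (sqrt (1 + (p z)\<^sup>2 + (q z)\<^sup>2)) ^ 3 / R))"

section \<open>Algebra of slopes, fluxes and unit normals\<close>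

lemma slope_pos: "0 < 1 + a\<^sup>2 + (b::real)\<^sup>2"
  by (simp add: add_pos_nonneg)

text \<open>\<open>T u\<close> is the horizontal part of the unit normal, whose vertical part has
  length \<open>1 / W\<close>.\<close>

lemma flux_norm: "(flux a b)\<^sup>2 + (flux b a)\<^sup>2 = 1 - 1 / (1 + a\<^sup>2 + b\<^sup>2)"
  using slope_pos[of a b]
  by (simp add: flux_def power_divide add.commute add.left_commute divide_simps)

lemma flux_norm_le: "(flux a b)\<^sup>2 + (flux b a)\<^sup>2 \<le> 1"
  using slope_pos[of a b] by (simp add: flux_norm)

lemma flux_abs_le: "\<bar>flux a b\<bar> \<le> 1"
proof -
  have "(flux a b)\<^sup>2 \<le> 1" using flux_norm_le[of a b] zero_le_power2[of "flux b a"] by linarith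
  then show ?thesis by (simp add: abs_square_le_1)
qed

lemma flux_diff_abs_le: "\<bar>flux a b - flux c d\<bar> \<le> 2"
  using flux_abs_le[of a b] flux_abs_le[of c d] by linarith

text \<open>Here \<open>1 - T \<bullet> T' - 1 / (W W')\<close> is half the squared distance of the unit normals.\<close>

lemma slope_mono_eq:
  defines "W \<equiv> \<lambda>a b::real. sqrt (1 + a\<^sup>2 + b\<^sup>2)"
  shows "slope_mono p q a b = (W p q + W a b) *
    (1 - (flux p q * flux a b + flux q p * flux b a) - 1 / (W p q * W a b))"
proof -
  have W: "W p q > 0" "W a b > 0" "W q p = W p q" "W b a = W a b"
    using slope_pos[of p q] slope_pos[of a b] by (auto simp: W_def add_ac)
  have sq: "(W p q)\<^sup>2 = 1 + p\<^sup>2 + q\<^sup>2" "(W a b)\<^sup>2 = 1 + a\<^sup>2 + b\<^sup>2"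
    by (simp_all add: W_def)
  have f: "flux p q = p / W p q" "flux q p = q / W p q" "flux a b = a / W a b" "flux b a = b / W a b"
    using W by (simp_all add: flux_def W_def add_ac)
  define X where "X = W p q"
  define Y where "Y = W a b"
  have "X > 0" "Y > 0" "p\<^sup>2 = X\<^sup>2 - 1 - q\<^sup>2" "a\<^sup>2 = Y\<^sup>2 - 1 - b\<^sup>2"
    using W sq by (auto simp: X_def Y_def)
  then have "(p - a) * (p / X - a / Y) + (q - b) * (q / X - b / Y)
    = (X + Y) * (1 - (p / X * (a / Y) + q / X * (b / Y)) - 1 / (X * Y))"
    by (simp add: field_simps power2_eq_square) algebra
  then show ?thesis unfolding slope_mono_def f X_def Y_def .
qed

text \<open>The right side is \<open>(X + Y) * K\<close>, where \<open>2 * K\<close> is the squared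
  distance of the unit normals. Their horizontal parts, the fluxes, are no farther apart, and
  \<open>X + Y \<ge> 2\<close>.\<close>

lemma slope_mono_ge_flux_diff:
  "(flux p q - flux a b)\<^sup>2 + (flux q p - flux b a)\<^sup>2 \<le> slope_mono p q a b"
proof -
  define X where "X = sqrt (1 + p\<^sup>2 + q\<^sup>2)"
  define Y where "Y = sqrt (1 + a\<^sup>2 + b\<^sup>2)"
  have X: "X \<ge> 1" "Y \<ge> 1" by (simp_all add: X_def Y_def)
  define K where "K = 1 - (flux p q * flux a b + flux q p * flux b a) - 1 / (X * Y)"
  have e: "slope_mono p q a b = (X + Y) * K"
    unfolding K_def X_def Y_def by (rule slope_mono_eq)
  have n: "(flux p q)\<^sup>2 + (flux q p)\<^sup>2 = 1 - (1 / X)\<^sup>2" "(flux a b)\<^sup>2 + (flux b a)\<^sup>2 = 1 - (1 / Y)\<^sup>2"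
    by (simp_all add: flux_norm X_def Y_def power_divide)
  \<comment> \<open>The subtracted square comes from the vertical components \<open>1 / X\<close>
    and \<open>1 / Y\<close> of the normals.\<close>
  have "(flux p q - flux a b)\<^sup>2 + (flux q p - flux b a)\<^sup>2 = 2 * K - (1 / X - 1 / Y)\<^sup>2"
    unfolding K_def using n X by (simp add: power2_diff algebra_simps)
  moreover from this have "0 \<le> K"
    by (smt (verit) zero_le_power2)
  moreover have "2 * K \<le> (X + Y) * K" using X \<open>0 \<le> K\<close> by (intro mult_right_mono) auto
  ultimately show ?thesis unfolding e by (smt (verit) zero_le_power2)
qed

lemma slope_mono_nonneg: "0 \<le> slope_mono p q a b"
  by (rule order_trans[OF _ slope_mono_ge_flux_diff]) simp

lemma slope_mono_ge_flux_diff1: "(flux p q - flux a b)\<^sup>2 \<le> slope_mono p q a b"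
  by (rule order_trans[OF _ slope_mono_ge_flux_diff]) simp

text \<open>Equal fluxes determine \<open>W\<close> through \<open>flux_norm\<close>, and then the
  slopes.\<close>

lemma slope_mono_eq_0D:
  assumes "slope_mono p q a b = 0"
  shows "p = a" "q = b"
proof -
  have s: "(flux p q - flux a b)\<^sup>2 + (flux q p - flux b a)\<^sup>2 \<le> 0"
    using slope_mono_ge_flux_diff[of p q a b] assms by simp
  then have f: "flux p q = flux a b" "flux q p = flux b a"
    by (smt (verit) zero_le_power2 power2_eq_square mult_eq_0_iff)+
  then have "1 - 1 / (1 + p\<^sup>2 + q\<^sup>2) = 1 - 1 / (1 + a\<^sup>2 + b\<^sup>2)"
    using flux_norm[of p q] flux_norm[of a b] by simp
  then have W: "1 + p\<^sup>2 + q\<^sup>2 = 1 + a\<^sup>2 + b\<^sup>2" by simp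
  then have W': "1 + q\<^sup>2 + p\<^sup>2 = 1 + b\<^sup>2 + a\<^sup>2" by simp
  show "p = a" using f(1) slope_pos[of a b] unfolding flux_def W by simp
  show "q = b" using f(2) slope_pos[of b a] unfolding flux_def W' by simp
qed

text \<open>Only \<open>(a, b)\<close> is bounded; \<open>(p, q)\<close> may be arbitrarily steep.
  The bound is linear in \<open>slope_mono\<close> up to a small \<open>\<tau>\<close>, so that
  \<open>flux_vanishes_if_chords\<close> can integrate it and compare with the derivative of the
  flux.\<close>

lemma slope_diff_le:
  assumes G: "sqrt (1 + a\<^sup>2 + b\<^sup>2) \<le> G" and \<tau>: "\<tau> > 0"
  shows "\<bar>p - a\<bar> \<le> \<tau> + (4 * G ^ 3 / \<tau> + 4 * G\<^sup>2) * slope_mono p q a b"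
proof -
  define X where "X = sqrt (1 + p\<^sup>2 + q\<^sup>2)"
  define Y where "Y = sqrt (1 + a\<^sup>2 + b\<^sup>2)"
  have X: "X \<ge> 1" "Y \<ge> 1" by (simp_all add: X_def Y_def)
  define K where "K = 1 - (flux p q * flux a b + flux q p * flux b a) - 1 / (X * Y)"
  define Q where "Q = slope_mono p q a b"
  define \<Delta> where "\<Delta> = sqrt ((p - a)\<^sup>2 + (q - b)\<^sup>2)"
  have e: "Q = (X + Y) * K"
    unfolding Q_def K_def X_def Y_def by (rule slope_mono_eq)
  have Q0: "Q \<ge> 0" unfolding Q_def by (rule slope_mono_nonneg)
  have K0: "K \<ge> 0" using Q0 e X by (smt (verit) zero_le_mult_iff)
  have n: "(flux p q)\<^sup>2 + (flux q p)\<^sup>2 = 1 - (1 / X)\<^sup>2" "(flux a b)\<^sup>2 + (flux b a)\<^sup>2 = 1 - (1 / Y)\<^sup>2"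
    by (simp_all add: flux_norm X_def Y_def power_divide)
  have "(flux p q - flux a b)\<^sup>2 + (flux q p - flux b a)\<^sup>2 = 2 * K - (1 / X - 1 / Y)\<^sup>2"
    unfolding K_def using n X by (simp add: power2_diff algebra_simps)
  then have k: "(1 / X - 1 / Y)\<^sup>2 \<le> 2 * K" by (smt (verit) zero_le_power2)
  have "(X - Y)\<^sup>2 = (1 / X - 1 / Y)\<^sup>2 * (X * Y)\<^sup>2"
    using X by (simp add: field_simps power2_eq_square)
  also have "\<dots> \<le> 2 * K * (X * Y)\<^sup>2" using k by (rule mult_right_mono) simp
  finally have d1: "(X - Y)\<^sup>2 \<le> 2 * K * (X * Y)\<^sup>2" .
  have sq: "X\<^sup>2 = 1 + p\<^sup>2 + q\<^sup>2" "Y\<^sup>2 = 1 + a\<^sup>2 + b\<^sup>2" by (simp_all add: X_def Y_def)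
  have f: "flux p q = p / X" "flux q p = q / X" "flux a b = a / Y" "flux b a = b / Y"
    by (simp_all add: flux_def X_def Y_def add_ac)
  have "2 * X * Y * K = 2 * X * Y - 2 * (p * a + q * b) - 2"
    unfolding K_def f using X by (simp add: field_simps)
  \<comment> \<open>Both sides equal
    \<open>X\<^sup>2 + Y\<^sup>2 - 2 - 2 * (p * a + q * b)\<close>.\<close>
  then have "(p - a)\<^sup>2 + (q - b)\<^sup>2 = (X - Y)\<^sup>2 + 2 * X * Y * K"
    using sq by (simp add: power2_diff)
  also have "\<dots> \<le> 2 * K * (X * Y)\<^sup>2 + 2 * (X * Y) * K" using d1 by simp
  also have "\<dots> \<le> 4 * K * (X * Y)\<^sup>2"
  proof -
    have "1 \<le> X * Y" using mult_mono[of 1 X 1 Y] X by simp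
    then have "X * Y \<le> (X * Y)\<^sup>2" by (intro self_le_power) auto
    then have "2 * K * (X * Y) \<le> 2 * K * (X * Y)\<^sup>2" using K0 by (intro mult_left_mono) auto
    then show ?thesis by (simp add: algebra_simps)
  qed
  finally have d2: "\<Delta>\<^sup>2 \<le> 4 * K * (X * Y)\<^sup>2" unfolding \<Delta>_def by simp
  have "K * X \<le> Q" unfolding e using K0 X by (simp add: algebra_simps)
  then have "4 * K * (X * Y)\<^sup>2 \<le> 4 * Q * X * Y\<^sup>2"
    using X by (simp add: power2_eq_square mult_right_mono mult_ac mult_left_mono)
  with d2 have d3: "\<Delta>\<^sup>2 \<le> 4 * Q * X * Y\<^sup>2" by linarith
  \<comment> \<open>\<open>X\<close> and \<open>Y\<close> are the lengths of
    \<open>(1, p, q)\<close> and \<open>(1, a, b)\<close>, whose difference has length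
    \<open>\<Delta>\<close>.\<close>
  have XY: "X \<le> Y + \<Delta>"
  proof -
    have "norm (1::real, (p, q)) \<le> norm (1::real, (a, b)) + norm ((0::real), (p - a, q - b))"
      using norm_triangle_ineq[of "(1::real, (a, b))" "((0::real), (p - a, q - b))"] by simp
    then show ?thesis by (simp add: norm_Pair X_def Y_def \<Delta>_def add_ac)
  qed
  have YG: "Y \<le> G" using G by (simp add: Y_def)
  have D0: "\<Delta> \<ge> 0" by (simp add: \<Delta>_def)
  have "\<Delta> \<le> \<tau> + (4 * G ^ 3 / \<tau> + 4 * G\<^sup>2) * Q"
  proof (cases "\<Delta> \<le> \<tau>")
    case True
    have "0 \<le> (4 * G ^ 3 / \<tau> + 4 * G\<^sup>2) * Q" using \<tau> Q0 YG X by (intro mult_nonneg_nonneg add_nonneg_nonneg divide_nonneg_pos) auto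
    then show ?thesis using True by simp
  next
    case False
    have "Y\<^sup>2 \<le> G\<^sup>2" using YG X by (intro power_mono) auto
    then have "X * Y\<^sup>2 \<le> (G + \<Delta>) * G\<^sup>2" using XY YG X by (intro mult_mono) auto
    then have "4 * Q * X * Y\<^sup>2 \<le> 4 * Q * ((G + \<Delta>) * G\<^sup>2)" using Q0
      by (metis (no_types, opaque_lifting) mult.assoc mult_left_mono mult_nonneg_nonneg zero_le_numeral)
    then have "\<Delta>\<^sup>2 \<le> 4 * Q * G^3 * 1 + 4 * Q * G\<^sup>2 * \<Delta>" using d3
      by (simp add: algebra_simps power3_eq_cube power2_eq_square)
    \<comment> \<open>Here \<open>1 \<le> \<Delta> / \<tau>\<close>. Now both terms contain
      \<open>\<Delta>\<close>, which cancels against \<open>\<Delta>\<^sup>2\<close>.\<close>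
    also have "\<dots> \<le> 4 * Q * G^3 * (\<Delta> / \<tau>) + 4 * Q * G\<^sup>2 * \<Delta>"
      using False \<tau> Q0 YG X by (intro add_right_mono mult_left_mono) auto
    finally have "\<Delta> * \<Delta> \<le> \<Delta> * ((4 * G ^ 3 / \<tau> + 4 * G\<^sup>2) * Q)"
      by (simp add: algebra_simps power2_eq_square)
    then have "\<Delta> \<le> (4 * G ^ 3 / \<tau> + 4 * G\<^sup>2) * Q" using False \<tau>
      by (subst (asm) mult_le_cancel_left_pos) auto
    then show ?thesis using \<tau> by simp
  qed
  moreover have "\<bar>p - a\<bar> \<le> \<Delta>" unfolding \<Delta>_def by (rule real_le_rsqrt) simp
  ultimately show ?thesis unfolding Q_def by linarith
qed

section \<open>Divergence identities on cross-sections\<close>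

lemma div_strip:
  fixes G1 G2 G1x G2y :: "real \<Rightarrow> real \<Rightarrow> real"
  assumes t: "0 \<le> t"
    and d1: "\<And>x y. \<bar>y\<bar> \<le> t \<Longrightarrow> ((\<lambda>x. G1 x y) has_real_derivative G1x x y) (at x)"
    and d2: "\<And>x y. \<bar>y\<bar> \<le> t \<Longrightarrow> ((\<lambda>y. G2 x y) has_real_derivative G2y x y) (at y)"
    and c0: "\<And>x. continuous_on {-t..t} (G1 x)"
    and c1: "continuous_on (UNIV \<times> {-t..t}) (\<lambda>(x, y). G1x x y)"
    and c2: "continuous_on (UNIV \<times> {-t..t}) (\<lambda>(x, y). G2y x y)"
  shows "((\<lambda>x. integral {-t..t} (G1 x)) has_real_derivative
    integral {-t..t} (\<lambda>y. G1x x y + G2y x y) - (G2 x t - G2 x (-t))) (at x)"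
proof -
  have abs: "\<bar>y\<bar> \<le> t" if "y \<in> {-t..t}" for y using that by auto
  \<comment> \<open>Differentiation under the integral gives the \<open>G1x\<close> term. The
    integral of \<open>G2y\<close>, which is added and subtracted, is the flux through the two
    sides.\<close>
  have L: "((\<lambda>x. integral (cbox (-t) t) (G1 x)) has_real_derivative
      integral (cbox (-t) t) (G1x x)) (at x within UNIV)"
  proof (rule leibniz_rule_field_derivative)
    show "continuous_on (UNIV \<times> cbox (- t) t) (\<lambda>(x, t). G1x x t)" using c1 by simp
    show "G1 x integrable_on cbox (- t) t" for x
      using c0 by (intro integrable_continuous) simp
  qed (use d1 abs in auto)
  have i1: "G1x x integrable_on {-t..t}"
    using continuous_on_compose2[OF c1, of "{-t..t}" "\<lambda>y. (x, y)"]
    by (intro integrable_continuous_real) (simp add: continuous_on_Pair image_subset_iff)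
  have "(G2y x has_integral (G2 x t - G2 x (-t))) {-t..t}"
    using t d2[OF abs, of _ x] by (intro fundamental_theorem_of_calculus)
      (auto simp: has_real_derivative_iff_has_vector_derivative[symmetric] intro: DERIV_subset)
  then have "integral {-t..t} (\<lambda>y. G1x x y + G2y x y) = integral {-t..t} (G1x x) + (G2 x t - G2 x (-t))"
    using i1 by (subst integral_add) (auto simp: integral_unique)
  then show ?thesis using L by simp
qed

lemma open_band: "open (band R)"
  unfolding band_def by (intro open_Times) auto

lemma mem_band: "(x, y) \<in> band R \<longleftrightarrow> \<bar>y\<bar> < R"
  by (auto simp: band_def)

lemma cont_seg_band:
  assumes "continuous_on (band R) g" "t < R"
  shows "continuous_on {-t..t} (\<lambda>y. g (x, y))"
  using assms(2) by (intro continuous_on_compose2[OF assms(1)])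
    (auto intro!: continuous_intros simp: band_def)

lemma DERIV_flux:
  assumes "(f has_real_derivative f') (at x)" "(g has_real_derivative g') (at x)"
  shows "((\<lambda>x. flux (f x) (g x)) has_real_derivative
    ((1 + (g x)\<^sup>2) * f' - f x * g x * g') / (sqrt (1 + (f x)\<^sup>2 + (g x)\<^sup>2)) ^ 3) (at x)"
proof -
  define W where "W = sqrt (1 + (f x)\<^sup>2 + (g x)\<^sup>2)"
  have p: "1 + (f x)\<^sup>2 + (g x)\<^sup>2 > 0" by (rule slope_pos)
  then have W: "W > 0" "W\<^sup>2 = 1 + (f x)\<^sup>2 + (g x)\<^sup>2" by (simp_all add: W_def)
  have dW: "((\<lambda>x. sqrt (1 + (f x)\<^sup>2 + (g x)\<^sup>2)) has_real_derivative (f x * f' + g x * g') / W) (at x)"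
    unfolding W_def using p assms
    by (auto intro!: derivative_eq_intros simp: field_simps)
  have "((\<lambda>x. flux (f x) (g x)) has_real_derivative
      (f' * W - f x * ((f x * f' + g x * g') / W)) / (W * W)) (at x)"
    unfolding flux_def using DERIV_divide[OF assms(1) dW] W by (simp add: W_def)
  also have "f' * W - f x * ((f x * f' + g x * g') / W)
      = (W\<^sup>2 * f' - f x * (f x * f' + g x * g')) / W"
    using W(1) by (simp add: field_simps power2_eq_square)
  also have "W\<^sup>2 * f' - f x * (f x * f' + g x * g') = (1 + (g x)\<^sup>2) * f' - f x * g x * g'"
    unfolding W by (simp add: algebra_simps power2_eq_square)
  finally show ?thesis using W by (simp add: W_def power3_eq_cube mult_ac)
qed

lemma DERIV_partial:
  fixes g :: "real \<times> real \<Rightarrow> real"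
  assumes "(g has_derivative (\<lambda>h. fst h * r + snd h * s)) (at (x, y))"
  shows "((\<lambda>x. g (x, y)) has_real_derivative r) (at x)"
    and "((\<lambda>y. g (x, y)) has_real_derivative s) (at y)"
proof -
  have "((g \<circ> (\<lambda>x. (x, y))) has_derivative ((\<lambda>h. fst h * r + snd h * s) \<circ> (\<lambda>h. (h, 0)))) (at x)"
    by (rule diff_chain_at) (auto intro!: derivative_eq_intros assms)
  then show "((\<lambda>x. g (x, y)) has_real_derivative r) (at x)"
    by (simp add: o_def has_field_derivative_def mult.commute[of _ r])
  have "((g \<circ> (\<lambda>y. (x, y))) has_derivative ((\<lambda>h. fst h * r + snd h * s) \<circ> (\<lambda>h. (0, h)))) (at y)"
    by (rule diff_chain_at) (auto intro!: derivative_eq_intros assms)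
  then show "((\<lambda>y. g (x, y)) has_real_derivative s) (at y)"
    by (simp add: o_def has_field_derivative_def mult.commute[of _ s])
qed

lemma cmc_graph_DERIV:
  assumes "cmc_graph R u p q" "\<bar>y\<bar> < R"
  shows "((\<lambda>x. u (x, y)) has_real_derivative p (x, y)) (at x)"
    and "((\<lambda>y. u (x, y)) has_real_derivative q (x, y)) (at y)"
  using assms DERIV_partial[of u "p (x, y)" "q (x, y)" x y]
  by (auto simp: cmc_graph_def mem_band)

lemma cmc_graph_continuous:
  assumes "cmc_graph R u p q"
  shows "continuous_on (UNIV \<times> {-R..R}) u" "continuous_on (band R) u"
    "continuous_on (band R) p" "continuous_on (band R) q"
proof -
  show "continuous_on (UNIV \<times> {-R..R}) u" using assms by (simp add: cmc_graph_def)
  then show "continuous_on (band R) u"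
    by (rule continuous_on_subset) (auto simp: band_def)
  show "continuous_on (band R) p" "continuous_on (band R) q"
    using assms unfolding cmc_graph_def
    by (auto intro!: continuous_at_imp_continuous_on intro: has_derivative_continuous)
qed

lemma continuous_on_flux [continuous_intros]:
  assumes "continuous_on S f" "continuous_on S g"
  shows "continuous_on S (\<lambda>x. flux (f x) (g x))"
  unfolding flux_def using slope_pos assms
  by (intro continuous_intros) (auto simp: less_imp_neq[symmetric])

lemma continuous_on_slope_mono [continuous_intros]:
  assumes "continuous_on S f" "continuous_on S g" "continuous_on S h" "continuous_on S k"
  shows "continuous_on S (\<lambda>x. slope_mono (f x) (g x) (h x) (k x))"
  unfolding slope_mono_def using assms by (intro continuous_intros)

text \<open>Dividing the equation by \<open>W^3\<close> turns it into
  \<open>div (T u) = 1 / R\<close>. Of the derivatives of \<open>T u\<close>, only the two in the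
  divergence are handed on.\<close>

lemma cmc_graph_flux:
  assumes g: "cmc_graph R u p q"
  obtains Fx Gy where "continuous_on (band R) Fx" "continuous_on (band R) Gy"
    "\<And>x y. \<bar>y\<bar> < R \<Longrightarrow> ((\<lambda>x. flux (p (x, y)) (q (x, y))) has_real_derivative Fx (x, y)) (at x)"
    "\<And>x y. \<bar>y\<bar> < R \<Longrightarrow> ((\<lambda>y. flux (q (x, y)) (p (x, y))) has_real_derivative Gy (x, y)) (at y)"
    "\<And>z. z \<in> band R \<Longrightarrow> Fx z + Gy z = 1 / R"
proof -
  from g obtain px py qx qy where c: "continuous_on (band R) px" "continuous_on (band R) py"
      "continuous_on (band R) qx" "continuous_on (band R) qy"
    and d: "\<And>z. z \<in> band R \<Longrightarrow> (p has_derivative (\<lambda>h. fst h * px z + snd h * py z)) (at z)"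
      "\<And>z. z \<in> band R \<Longrightarrow> (q has_derivative (\<lambda>h. fst h * qx z + snd h * qy z)) (at z)"
    and e: "\<And>z. z \<in> band R \<Longrightarrow> (1 + (q z)\<^sup>2) * px z - p z * q z * (py z + qx z) + (1 + (p z)\<^sup>2) * qy z
          = (sqrt (1 + (p z)\<^sup>2 + (q z)\<^sup>2)) ^ 3 / R"
    unfolding cmc_graph_def by blast
  define W where "W z = (sqrt (1 + (p z)\<^sup>2 + (q z)\<^sup>2)) ^ 3" for z
  have W: "W z \<noteq> 0" for z using slope_pos[of "p z" "q z"] by (simp add: W_def)
  note pq = cmc_graph_continuous(3,4)[OF g]
  have cW: "continuous_on (band R) W" unfolding W_def by (intro continuous_intros pq)
  define Fx where "Fx z = ((1 + (q z)\<^sup>2) * px z - p z * q z * qx z) / W z" for z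
  define Gy where "Gy z = ((1 + (p z)\<^sup>2) * qy z - q z * p z * py z) / W z" for z
  show ?thesis
  proof
    show "continuous_on (band R) Fx" "continuous_on (band R) Gy"
      unfolding Fx_def Gy_def using W by (auto intro!: continuous_intros pq c cW)
    show "((\<lambda>x. flux (p (x, y)) (q (x, y))) has_real_derivative Fx (x, y)) (at x)" if "\<bar>y\<bar> < R" for x y
      using DERIV_flux[OF DERIV_partial(1)[OF d(1)] DERIV_partial(1)[OF d(2)]] that
      by (simp add: mem_band Fx_def W_def)
    show "((\<lambda>y. flux (q (x, y)) (p (x, y))) has_real_derivative Gy (x, y)) (at y)" if "\<bar>y\<bar> < R" for x y
      using DERIV_flux[OF DERIV_partial(2)[OF d(2)] DERIV_partial(2)[OF d(1)]] that
      by (simp add: mem_band Gy_def W_def add_ac)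
    show "Fx z + Gy z = 1 / R" if "z \<in> band R" for z
    proof -
      have "Fx z + Gy z = ((1 + (q z)\<^sup>2) * px z - p z * q z * (py z + qx z) + (1 + (p z)\<^sup>2) * qy z) / W z"
        unfolding Fx_def Gy_def by (simp add: add_divide_distrib[symmetric] algebra_simps)
      also have "\<dots> = 1 / R" unfolding e[OF that] using W[of z] by (simp add: W_def)
      finally show ?thesis .
    qed
  qed
qed

text \<open>The divergence of \<open>\<phi>(w) (T u - T v)\<close> is \<open>\<phi>'(w)\<close>
  times \<open>slope_mono\<close>, because \<open>T u\<close> and \<open>T v\<close> have equal
  divergence. The cut-off is differentiated only at values of \<open>w\<close>, since the later
  choice \<open>s / (l + s)\<close> has a pole; for that choice the side terms matter too.\<close>

lemma cmc_graph_pair_flux: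
  fixes \<phi> \<phi>' :: "real \<Rightarrow> real"
  assumes gu: "cmc_graph R u p q" and gv: "cmc_graph R v a b"
    and t: "0 \<le> t" "t < R"
    and \<phi>: "\<And>z. z \<in> band R \<Longrightarrow> (\<phi> has_real_derivative \<phi>' (u z - v z)) (at (u z - v z))"
    and c\<phi>: "continuous_on (band R) (\<lambda>z. \<phi>' (u z - v z))"
  defines "D1 \<equiv> \<lambda>z. flux (p z) (q z) - flux (a z) (b z)"
    and "D2 \<equiv> \<lambda>z. flux (q z) (p z) - flux (b z) (a z)"
  shows "((\<lambda>x. integral {-t..t} (\<lambda>y. \<phi> (u (x, y) - v (x, y)) * D1 (x, y))) has_real_derivative
    integral {-t..t} (\<lambda>y. \<phi>' (u (x, y) - v (x, y)) * slope_mono (p (x, y)) (q (x, y)) (a (x, y)) (b (x, y)))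
    - (\<phi> (u (x, t) - v (x, t)) * D2 (x, t) - \<phi> (u (x, -t) - v (x, -t)) * D2 (x, -t))) (at x)"
proof -
  obtain Fx Gy where F: "continuous_on (band R) Fx" "continuous_on (band R) Gy"
    "\<And>x y. \<bar>y\<bar> < R \<Longrightarrow> ((\<lambda>x. flux (p (x, y)) (q (x, y))) has_real_derivative Fx (x, y)) (at x)"
    "\<And>x y. \<bar>y\<bar> < R \<Longrightarrow> ((\<lambda>y. flux (q (x, y)) (p (x, y))) has_real_derivative Gy (x, y)) (at y)"
    "\<And>z. z \<in> band R \<Longrightarrow> Fx z + Gy z = 1 / R"
    using cmc_graph_flux[OF gu] by blast
  obtain Fx' Gy' where F': "continuous_on (band R) Fx'" "continuous_on (band R) Gy'"
    "\<And>x y. \<bar>y\<bar> < R \<Longrightarrow> ((\<lambda>x. flux (a (x, y)) (b (x, y))) has_real_derivative Fx' (x, y)) (at x)"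
    "\<And>x y. \<bar>y\<bar> < R \<Longrightarrow> ((\<lambda>y. flux (b (x, y)) (a (x, y))) has_real_derivative Gy' (x, y)) (at y)"
    "\<And>z. z \<in> band R \<Longrightarrow> Fx' z + Gy' z = 1 / R"
    using cmc_graph_flux[OF gv] by blast
  note cont = cmc_graph_continuous(2-4)[OF gu] cmc_graph_continuous(2-4)[OF gv]
  define w where "w z = u z - v z" for z
  have c\<phi>0: "continuous_on (band R) (\<lambda>z. \<phi> (w z))"
  proof -
    have "continuous_on (band R) w" unfolding w_def by (intro continuous_intros cont)
    moreover have "isCont \<phi> (w z)" if "z \<in> band R" for z
      using DERIV_isCont[OF \<phi>[OF that]] by (simp add: w_def)
    ultimately show ?thesis
      unfolding continuous_on_eq_continuous_at[OF open_band]
      using continuous_at_compose[of _ w \<phi>] by (auto simp: o_def)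
  qed
  have sub: "UNIV \<times> {-t..t} \<subseteq> band R" using t by (auto simp: band_def)
  define G1x where "G1x z = \<phi>' (w z) * (p z - a z) * D1 z + \<phi> (w z) * (Fx z - Fx' z)" for z
  define G2y where "G2y z = \<phi>' (w z) * (q z - b z) * D2 z + \<phi> (w z) * (Gy z - Gy' z)" for z
  have cG: "continuous_on (band R) G1x" "continuous_on (band R) G2y"
    unfolding G1x_def G2y_def D1_def D2_def
    by (intro continuous_intros cont c\<phi>0 F F' c\<phi>[folded w_def])+
  have w\<phi>: "(\<phi> has_real_derivative \<phi>' (w (x, y))) (at (w (x, y)))" if "\<bar>y\<bar> < R" for x y
    using \<phi>[of "(x, y)"] that by (simp add: w_def mem_band)
  have dwx: "((\<lambda>x. w (x, y)) has_real_derivative p (x, y) - a (x, y)) (at x)" if "\<bar>y\<bar> < R" for x y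
    unfolding w_def by (intro DERIV_diff cmc_graph_DERIV[OF gu] cmc_graph_DERIV[OF gv] that)
  have dwy: "((\<lambda>y. w (x, y)) has_real_derivative q (x, y) - b (x, y)) (at y)" if "\<bar>y\<bar> < R" for x y
    unfolding w_def by (intro DERIV_diff cmc_graph_DERIV[OF gu] cmc_graph_DERIV[OF gv] that)
  have "((\<lambda>x. integral {-t..t} (\<lambda>y. \<phi> (w (x, y)) * D1 (x, y))) has_real_derivative
      integral {-t..t} (\<lambda>y. G1x (x, y) + G2y (x, y)) - (\<phi> (w (x, t)) * D2 (x, t) - \<phi> (w (x, -t)) * D2 (x, -t))) (at x)"
  proof (rule div_strip[OF t(1)])
    fix x y assume "\<bar>y\<bar> \<le> t"
    then have y: "\<bar>y\<bar> < R" using t by simp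
    show "((\<lambda>x. \<phi> (w (x, y)) * D1 (x, y)) has_real_derivative G1x (x, y)) (at x)"
      unfolding G1x_def D1_def
      by (rule derivative_eq_intros DERIV_chain2[OF w\<phi>[OF y] dwx[OF y]] F(3)[OF y] F'(3)[OF y] refl)+
         (simp add: algebra_simps)
    show "((\<lambda>y. \<phi> (w (x, y)) * D2 (x, y)) has_real_derivative G2y (x, y)) (at y)"
      unfolding G2y_def D2_def
      by (rule derivative_eq_intros DERIV_chain2[OF w\<phi>[OF y] dwy[OF y]] F(4)[OF y] F'(4)[OF y] refl)+
         (simp add: algebra_simps)
  next
    show "continuous_on {-t..t} (\<lambda>y. \<phi> (w (x, y)) * D1 (x, y))" for x
    proof -
      have "continuous_on (band R) (\<lambda>z. \<phi> (w z) * D1 z)"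
        unfolding D1_def by (intro continuous_intros cont c\<phi>0)
      then show ?thesis
        by (rule continuous_on_compose2) (use sub in \<open>auto intro!: continuous_intros\<close>)
    qed
    show "continuous_on (UNIV \<times> {- t..t}) (\<lambda>(x, y). G1x (x, y))"
      "continuous_on (UNIV \<times> {- t..t}) (\<lambda>(x, y). G2y (x, y))"
      using cG[THEN continuous_on_subset[OF _ sub]] by (simp_all add: case_prod_unfold)
  qed
  also have "integral {-t..t} (\<lambda>y. G1x (x, y) + G2y (x, y)) =
    integral {-t..t} (\<lambda>y. \<phi>' (w (x, y)) * slope_mono (p (x, y)) (q (x, y)) (a (x, y)) (b (x, y)))"
  proof (rule integral_cong)
    fix y assume "y \<in> {-t..t}"
    then have z: "(x, y) \<in> band R" using sub by auto
    \<comment> \<open>Both divergences are \<open>1 / R\<close>, so the terms containing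
      \<open>\<phi>\<close> itself cancel.\<close>
    have G: "Gy (x, y) = 1 / R - Fx (x, y)" "Gy' (x, y) = 1 / R - Fx' (x, y)"
      using F(5)[OF z] F'(5)[OF z] by linarith+
    show "G1x (x, y) + G2y (x, y) =
      \<phi>' (w (x, y)) * slope_mono (p (x, y)) (q (x, y)) (a (x, y)) (b (x, y))"
      unfolding G1x_def G2y_def slope_mono_def D1_def D2_def G by (simp add: algebra_simps)
  qed
  finally show ?thesis unfolding w_def .
qed

subsection \<open>Monotone fluxes through cross-sections\<close>

text \<open>This cut-off is continuously differentiable, bounded, and satisfies \<open>(sat e)\<^sup>2 \<le> C * dsat e\<close> on
  sets that are bounded above.\<close>

definition sat :: "real \<Rightarrow> real \<Rightarrow> real" where
  "sat e w = (max 0 (w - e))\<^sup>2 / (1 + (max 0 (w - e))\<^sup>2)"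

definition dsat :: "real \<Rightarrow> real \<Rightarrow> real" where
  "dsat e w = 2 * max 0 (w - e) / (1 + (max 0 (w - e))\<^sup>2)\<^sup>2"

lemma sat_eq_0: "w \<le> e \<Longrightarrow> sat e w = 0"
  by (simp add: sat_def)

lemma dsat_eq_0: "w \<le> e \<Longrightarrow> dsat e w = 0"
  by (simp add: dsat_def)

lemma sat_eq_0_iff: "sat e w = 0 \<longleftrightarrow> w \<le> e"
proof -
  have "1 + (max 0 (w - e))\<^sup>2 \<noteq> 0" by (smt (verit) zero_le_power2)
  then show ?thesis by (auto simp: sat_def max_def)
qed

lemma sat_bounds: "0 \<le> sat e w" "sat e w \<le> 1"
proof -
  have "1 + (max 0 (w - e))\<^sup>2 > 0" by (smt (verit) zero_le_power2)
  then show "0 \<le> sat e w" "sat e w \<le> 1" by (auto simp: sat_def)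
qed

lemma dsat_nonneg: "0 \<le> dsat e w"
  by (simp add: dsat_def)

lemma dsat_le1: "dsat e w \<le> 1"
proof -
  define z where "z = max 0 (w - e)"
  have "2 * z \<le> 1 + z\<^sup>2" using zero_le_power2[of "z - 1"] by (simp add: power2_diff)
  also have "\<dots> \<le> (1 + z\<^sup>2)\<^sup>2" by (intro self_le_power) auto
  finally show ?thesis unfolding dsat_def z_def[symmetric]
    by (subst divide_le_eq_1_pos) (auto simp: z_def add_pos_nonneg)
qed

lemma DERIV_sat: "(sat e has_real_derivative dsat e w) (at w)"
proof -
  define m where "m w = max 0 (w - e)" for w
  \<comment> \<open>\<open>m\<close> has a kink at \<open>e\<close>, but the difference quotient of
    its square stays within \<open>\<bar>z - w\<bar>\<close> of \<open>2 * m w\<close> on both sides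
    of the kink. Caratheodory's form of differentiability turns this into a continuity
    statement.\<close>
  have D: "((\<lambda>w. (m w)\<^sup>2) has_real_derivative 2 * m w) (at w)"
  proof (subst CARAT_DERIV, intro exI conjI allI)
    let ?g = "\<lambda>z. if z = w then 2 * m w else ((m z)\<^sup>2 - (m w)\<^sup>2) / (z - w)"
    show "(m z)\<^sup>2 - (m w)\<^sup>2 = ?g z * (z - w)" for z by simp
    show "?g w = 2 * m w" by simp
    have b: "\<bar>?g z - 2 * m w\<bar> \<le> \<bar>z - w\<bar>" for z
    proof (cases "z = w")
      case False
      then have s: "?g z - 2 * m w = ((m z)\<^sup>2 - (m w)\<^sup>2 - 2 * m w * (z - w)) / (z - w)"
        by (simp add: field_simps)
      have "\<bar>(m z)\<^sup>2 - (m w)\<^sup>2 - 2 * m w * (z - w)\<bar> \<le> (z - w)\<^sup>2"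
      proof -
        consider "z \<le> e" "w \<le> e" | "z \<ge> e" "w \<ge> e" | "z < e" "w > e" | "z > e" "w < e" by linarith
        then show ?thesis
        proof cases
          case 2
          then have "(m z)\<^sup>2 - (m w)\<^sup>2 - 2 * m w * (z - w) = (z - w)\<^sup>2"
            by (simp add: m_def power2_eq_square algebra_simps)
          then show ?thesis by simp
        next
          case 3
          have "(w - e) * (e - z) \<ge> 0" using 3 by simp
          moreover have "(e - z)\<^sup>2 \<ge> 0" "(w - e)\<^sup>2 \<ge> 0" by simp_all
          ultimately show ?thesis using 3
            by (simp add: m_def power2_eq_square algebra_simps)
        next
          case 4
          have "(z - e)\<^sup>2 \<le> (z - w)\<^sup>2" using 4 by (intro power_mono) auto
          then show ?thesis using 4 by (simp add: m_def)
        qed (simp add: m_def)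
      qed
      also have "(z - w)\<^sup>2 = \<bar>z - w\<bar> * \<bar>z - w\<bar>" by (simp add: power2_eq_square)
      finally show ?thesis unfolding s abs_divide using False
        by (subst pos_divide_le_eq) auto
    qed auto
    have "(?g \<longlongrightarrow> 2 * m w) (at w)"
    proof (rule LIM_I)
      fix r :: real assume "r > 0"
      moreover have "norm (?g x - 2 * m w) < r" if "norm (x - w) < r" for x
        using le_less_trans[OF b that[unfolded real_norm_def]] by (simp only: real_norm_def)
      ultimately show "\<exists>s>0. \<forall>x. x \<noteq> w \<and> norm (x - w) < s \<longrightarrow> norm (?g x - 2 * m w) < r"
        by blast
    qed
    then show "isCont ?g w" by (simp add: isCont_def)
  qed
  have pos: "1 + (m w)\<^sup>2 > 0" by (smt (verit) zero_le_power2)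
  have "((\<lambda>w. (m w)\<^sup>2 / (1 + (m w)\<^sup>2)) has_real_derivative
      (2 * m w * (1 + (m w)\<^sup>2) - (m w)\<^sup>2 * (2 * m w)) / ((1 + (m w)\<^sup>2) * (1 + (m w)\<^sup>2))) (at w)"
    using DERIV_divide[OF D DERIV_add[OF DERIV_const D]] pos by simp
  moreover have "(2 * m w * (1 + (m w)\<^sup>2) - (m w)\<^sup>2 * (2 * m w)) = 2 * m w"
    by (simp add: algebra_simps)
  ultimately show ?thesis by (simp add: sat_def[abs_def] dsat_def m_def power2_eq_square)
qed

lemma continuous_on_sat [continuous_intros]:
  "continuous_on S f \<Longrightarrow> continuous_on S (\<lambda>x. sat e (f x))"
  unfolding sat_def by (intro continuous_intros) (auto simp: add_pos_nonneg less_imp_neq[symmetric])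

lemma continuous_on_dsat [continuous_intros]:
  "continuous_on S f \<Longrightarrow> continuous_on S (\<lambda>x. dsat e (f x))"
  unfolding dsat_def by (intro continuous_intros) (auto simp: add_pos_nonneg less_imp_neq[symmetric])

text \<open>The flux \<open>A\<close> of the overview for the cut-off \<open>sat e\<close>. It takes
  all functions as arguments so that it can also be evaluated on reflected ones.\<close>

definition sat_flux where
  "sat_flux R u p q v a b e x = integral {-R..R} (\<lambda>y. sat e (u (x, y) - v (x, y)) *
     (flux (p (x, y)) (q (x, y)) - flux (a (x, y)) (b (x, y))))"
  for R :: real and u p q v a b :: "real \<times> real \<Rightarrow> real"

text \<open>Since the flux is nondecreasing (\<open>A_mono\<close>), small values beyond every
  \<open>N\<close> already say that its limit at infinity is at most 0. The matching bound at minus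
  infinity is the same property of the reflected functions.\<close>

definition flux_vanishes where
  "flux_vanishes R u p q v a b e \<longleftrightarrow> (\<forall>k>0. \<forall>N. \<exists>x\<ge>N. sat_flux R u p q v a b e x \<le> k)"
  for R :: real and u p q v a b :: "real \<times> real \<Rightarrow> real"

text \<open>On the sides only an inequality is required, so that a cylinder can also be compared
  with a solution whose boundary values lie above it.\<close>

locale cmc_pair =
  fixes R :: real and u p q v a b :: "real \<times> real \<Rightarrow> real"
  assumes R: "R > 0"
    and gu: "cmc_graph R u p q" and gv: "cmc_graph R v a b"
    and side: "\<And>x. u (x, R) \<le> v (x, R)" "\<And>x. u (x, -R) \<le> v (x, -R)"
begin

definition w where "w z = u z - v z"
definition D1 where "D1 z = flux (p z) (q z) - flux (a z) (b z)"
definition normal_gap where "normal_gap z = slope_mono (p z) (q z) (a z) (b z)"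
abbreviation A where "A \<equiv> sat_flux R u p q v a b"

lemma A_def: "A e x = integral {-R..R} (\<lambda>y. sat e (w (x, y)) * D1 (x, y))"
  by (simp add: sat_flux_def w_def D1_def)

lemma D1_le: "\<bar>D1 z\<bar> \<le> 2"
  unfolding D1_def by (rule flux_diff_abs_le)

lemma normal_gap_nonneg: "0 \<le> normal_gap z"
  unfolding normal_gap_def by (rule slope_mono_nonneg)

lemma D1_sq_le: "(D1 z)\<^sup>2 \<le> normal_gap z"
  unfolding D1_def normal_gap_def by (rule slope_mono_ge_flux_diff1)

lemma cont_w_closed: "continuous_on (UNIV \<times> {-R..R}) w"
  unfolding w_def using gu gv by (intro continuous_intros cmc_graph_continuous)

lemma cont_band:
  "continuous_on (band R) w" "continuous_on (band R) D1" "continuous_on (band R) normal_gap"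
  unfolding w_def D1_def normal_gap_def
  by (intro continuous_intros cmc_graph_continuous[OF gu] cmc_graph_continuous[OF gv])+

lemmas cont_segs = cont_band[THEN cont_seg_band]

text \<open>Solutions are only continuous up to the sides, so their gradients are not controlled
  there. But over a compact window the set \<open>w \<ge> e\<close> is compact and misses the sides,
  where \<open>w \<le> 0\<close>; hence it keeps a distance from them.\<close>

lemma support:
  assumes e: "e > 0" and t0: "0 \<le> t0" "t0 < R"
  obtains t where "t0 \<le> t" "t < R"
    "\<And>x y. x1 \<le> x \<Longrightarrow> x \<le> x2 \<Longrightarrow> t \<le> \<bar>y\<bar> \<Longrightarrow> \<bar>y\<bar> \<le> R \<Longrightarrow> w (x, y) < e"
proof -
  let ?C = "{x1..x2} \<times> {-R..R}"
  have cw: "continuous_on ?C w" by (rule continuous_on_subset[OF cont_w_closed]) auto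
  define K where "K = ?C \<inter> w -` {e..}"
  have "compact K"
  proof -
    have "closed K" unfolding K_def
      by (rule continuous_closed_preimage[OF cw]) (auto intro: closed_Times)
    moreover have "compact ?C" by (intro compact_Times) auto
    moreover have "K = ?C \<inter> K" by (auto simp: K_def)
    ultimately show ?thesis by (metis compact_Int_closed)
  qed
  have lt: "\<bar>y\<bar> < R" if "(x, y) \<in> K" for x y
  proof -
    have "\<bar>y\<bar> \<le> R" "w (x, y) \<ge> e" using that by (auto simp: K_def)
    moreover have "y \<noteq> R" "y \<noteq> -R" using calculation(2) e side[of x] by (auto simp: w_def)
    ultimately show ?thesis by linarith
  qed
  show ?thesis
  proof (cases "K = {}")
    case True
    show ?thesis
    proof (rule that[of t0])
      show "w (x, y) < e" if "x1 \<le> x" "x \<le> x2" "t0 \<le> \<bar>y\<bar>" "\<bar>y\<bar> \<le> R" for x y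
      proof (rule ccontr)
        assume "\<not> ?thesis"
        then have "(x, y) \<in> K" using that by (auto simp: K_def)
        then show False using True by simp
      qed
    qed (use t0 in auto)
  next
    case False
    have "continuous_on K (\<lambda>z. \<bar>snd z\<bar>)" by (intro continuous_intros)
    then obtain z where z: "z \<in> K" "\<And>z'. z' \<in> K \<Longrightarrow> \<bar>snd z'\<bar> \<le> \<bar>snd z\<bar>"
      using continuous_attains_sup[OF \<open>compact K\<close> False] by blast
    \<comment> \<open>At least halfway from the largest \<open>\<bar>y\<bar>\<close> in
      \<open>K\<close> to \<open>R\<close>.\<close>
    define t where "t = max t0 ((\<bar>snd z\<bar> + R) / 2)"
    have t: "\<bar>snd z\<bar> < t" "t < R" "t0 \<le> t"
      using lt[of "fst z" "snd z"] z(1) t0 by (simp_all add: t_def less_max_iff_disj field_simps)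
    show ?thesis
    proof (rule that[of t])
      show "w (x, y) < e" if "x1 \<le> x" "x \<le> x2" "t \<le> \<bar>y\<bar>" "\<bar>y\<bar> \<le> R" for x y
      proof (rule ccontr)
        assume "\<not> ?thesis"
        then have "(x, y) \<in> K" using that by (auto simp: K_def)
        then show False using z(2)[of "(x, y)"] t that by simp
      qed
    qed (use t in auto)
  qed
qed

text \<open>With the \<open>t\<close> of \<open>support\<close> the flux becomes an integral over a
  compact part of the band, where it can be differentiated, and the side terms at
  \<open>\<plusminus>t\<close> vanish with the cut-off. One \<open>t\<close> serves for the whole
  window.\<close>

lemma A_window:
  assumes e: "e > 0" and t0: "0 \<le> t0" "t0 < R"
  obtains t where "t0 \<le> t" "t < R"
    "\<And>x y. x1 \<le> x \<Longrightarrow> x \<le> x2 \<Longrightarrow> t \<le> \<bar>y\<bar> \<Longrightarrow> \<bar>y\<bar> \<le> R \<Longrightarrow> w (x, y) < e"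
    "\<And>x. x1 \<le> x \<Longrightarrow> x \<le> x2 \<Longrightarrow> A e x = integral {-t..t} (\<lambda>y. sat e (w (x, y)) * D1 (x, y))"
    "\<And>x. x1 \<le> x \<Longrightarrow> x \<le> x2 \<Longrightarrow>
      (A e has_real_derivative integral {-t..t} (\<lambda>y. dsat e (w (x, y)) * normal_gap (x, y))) (at x)"
proof -
  \<comment> \<open>The window is widened by 1 so that the formula for \<open>A e\<close> holds in a
    neighbourhood of \<open>x1\<close> and \<open>x2\<close>, as two-sided derivatives
    require.\<close>
  obtain t where t': "t0 \<le> t" "t < R"
    "\<And>x y. x1 - 1 \<le> x \<Longrightarrow> x \<le> x2 + 1 \<Longrightarrow> t \<le> \<bar>y\<bar> \<Longrightarrow> \<bar>y\<bar> \<le> R \<Longrightarrow> w (x, y) < e"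
    using support[OF e t0, of "x1 - 1" "x2 + 1"] by blast
  note t = order_trans[OF t0(1) t'(1)] t'(2,3)
  have eq: "A e x = integral {-t..t} (\<lambda>y. sat e (w (x, y)) * D1 (x, y))"
    if "x1 - 1 \<le> x" "x \<le> x2 + 1" for x
  proof -
    let ?f = "\<lambda>y. sat e (w (x, y)) * D1 (x, y)"
    have "?f integrable_on {-t..t}"
      using t by (intro integrable_continuous_real continuous_intros cont_segs)
    then have "(?f has_integral integral {-t..t} ?f) {-t..t}" by (rule integrable_integral)
    moreover have "{y \<in> {-R..R} - {-t..t}. ?f y \<noteq> 0} = {}"
    proof -
      have "?f y = 0" if "y \<in> {-R..R} - {-t..t}" for y
      proof -
        have "t \<le> \<bar>y\<bar>" "\<bar>y\<bar> \<le> R" using that by auto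
        then have "w (x, y) < e" using t(3) \<open>x1 - 1 \<le> x\<close> \<open>x \<le> x2 + 1\<close> by blast
        then show ?thesis by (simp add: sat_eq_0)
      qed
      then show ?thesis by auto
    qed
    moreover have "{y \<in> {-t..t} - {-R..R}. ?f y \<noteq> 0} = {}" using t(1,2) by auto
    ultimately have "(?f has_integral integral {-t..t} ?f) {-R..R}"
      using has_integral_spike_set_eq[of "{-R..R}" "{-t..t}" ?f] by (simp only: negligible_empty)
    then show ?thesis unfolding A_def by (rule integral_unique)
  qed
  show ?thesis
  proof (rule that[of t])
    fix x assume x: "x1 \<le> x" "x \<le> x2"
    show "A e x = integral {-t..t} (\<lambda>y. sat e (w (x, y)) * D1 (x, y))" using eq x by simp
    have z: "sat e (u (x, t) - v (x, t)) = 0" "sat e (u (x, -t) - v (x, -t)) = 0"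
      using t(3)[of x t, THEN less_imp_le] t(3)[of x "-t", THEN less_imp_le] t(1,2) x
      by (simp_all add: sat_eq_0 w_def)
    have "((\<lambda>x. integral {-t..t} (\<lambda>y. sat e (w (x, y)) * D1 (x, y)))
       has_real_derivative integral {-t..t} (\<lambda>y. dsat e (w (x, y)) * normal_gap (x, y))) (at x)"
      using cmc_graph_pair_flux[OF gu gv t(1,2) DERIV_sat continuous_on_dsat, of e x] cont_band(1) z
      unfolding w_def[abs_def] normal_gap_def D1_def by simp
    then show "(A e has_real_derivative integral {-t..t} (\<lambda>y. dsat e (w (x, y)) * normal_gap (x, y))) (at x)"
      by (rule has_field_derivative_transform_within_open[where S="{x1 - 1<..<x2 + 1}"])
         (use x eq in auto)
  next
    show "w (x, y) < e" if "x1 \<le> x" "x \<le> x2" "t \<le> \<bar>y\<bar>" "\<bar>y\<bar> \<le> R" for x y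
      using that by (intro t(3)) auto
  qed (fact t'(1,2))+
qed

lemma A_mono:
  assumes e: "e > 0" and "x1 \<le> x2"
  shows "A e x1 \<le> A e x2"
proof -
  obtain t where t: "0 \<le> t" "t < R"
    "\<And>x. x1 \<le> x \<Longrightarrow> x \<le> x2 \<Longrightarrow>
      (A e has_real_derivative integral {-t..t} (\<lambda>y. dsat e (w (x, y)) * normal_gap (x, y))) (at x)"
    by (rule A_window[OF e order_refl R, of x1 x2]) (erule that)
  show ?thesis
  proof (rule DERIV_nonneg_imp_nondecreasing[OF assms(2)])
    fix x assume "x1 \<le> x" "x \<le> x2"
    moreover have "0 \<le> integral {-t..t} (\<lambda>y. dsat e (w (x, y)) * normal_gap (x, y))"
      using t by (intro integral_nonneg integrable_continuous_real continuous_intros cont_segs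
        mult_nonneg_nonneg dsat_nonneg normal_gap_nonneg)
    ultimately show "\<exists>y. (A e has_real_derivative y) (at x) \<and> 0 \<le> y" using t(3) by blast
  qed
qed

end

context cmc_pair
begin

lemma A_abs_le:
  assumes e: "e > 0"
  shows "\<bar>A e x\<bar> \<le> 4 * R"
proof -
  obtain t where t: "0 \<le> t" "t < R"
    and eq: "A e x = integral {-t..t} (\<lambda>y. sat e (w (x, y)) * D1 (x, y))"
    by (rule A_window[OF e order_refl R, of x x]) blast
  have "norm (integral {-t..t} (\<lambda>y. sat e (w (x, y)) * D1 (x, y))) \<le> integral {-t..t} (\<lambda>y. 2)"
  proof (rule integral_norm_bound_integral)
    show "(\<lambda>y. sat e (w (x, y)) * D1 (x, y)) integrable_on {-t..t}"
      using t by (intro integrable_continuous_real continuous_intros cont_segs)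
    show "norm (sat e (w (x, y)) * D1 (x, y)) \<le> 2" for y
      using mult_mono[OF sat_bounds(2)[of e "w (x, y)"] D1_le[of "(x, y)"]] sat_bounds(1)[of e "w (x, y)"]
      by (simp add: abs_mult)
  qed auto
  then show ?thesis using t unfolding eq by simp
qed

text \<open>\<open>A\<close> is bounded by \<open>A_abs_le\<close>, so the derivative
  \<open>I\<close> at the intermediate point is of order \<open>1 / n\<close>.\<close>

lemma A_small_deriv:
  assumes e: "e > 0" and n: "n > 0"
  obtains x I where "N < x" "x < N + n" "(A e has_real_derivative I) (at x)" "n * I = A e (N + n) - A e N"
proof -
  obtain t where t: "\<And>x. N \<le> x \<Longrightarrow> x \<le> N + n \<Longrightarrow>
      (A e has_real_derivative integral {-t..t} (\<lambda>y. dsat e (w (x, y)) * normal_gap (x, y))) (at x)"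
    by (rule A_window[OF e order_refl R, of N "N + n"]) blast
  show ?thesis
    using MVT2[of N "N + n" "A e" "\<lambda>x. integral {-t..t} (\<lambda>y. dsat e (w (x, y)) * normal_gap (x, y))"]
      n t that by auto
qed

text \<open>This is \<open>A\<^sup>2 \<le> C A'\<close> in a form linear in the derivative: Young's
  inequality with parameter \<open>c\<close> is applied pointwise, and the square of
  \<open>D1\<close> is at most \<open>normal_gap\<close>.\<close>

lemma A_le_deriv:
  assumes e: "e > 0" and c: "c > 0" and C: "C \<ge> 0"
    and le: "\<And>y. \<bar>y\<bar> < R \<Longrightarrow> (sat e (w (x, y)))\<^sup>2 \<le> C * dsat e (w (x, y))"
    and D: "(A e has_real_derivative I) (at x)"
  shows "A e x \<le> 2 * R * c + C / (4 * c) * I"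
proof -
  obtain t where t: "0 \<le> t" "t < R"
    and eq: "A e x = integral {-t..t} (\<lambda>y. sat e (w (x, y)) * D1 (x, y))"
    and "(A e has_real_derivative integral {-t..t} (\<lambda>y. dsat e (w (x, y)) * normal_gap (x, y))) (at x)"
    by (rule A_window[OF e order_refl R, of x x]) blast
  then have I: "I = integral {-t..t} (\<lambda>y. dsat e (w (x, y)) * normal_gap (x, y))"
    using DERIV_unique[OF D] by blast
  have "A e x \<le> integral {-t..t} (\<lambda>y. c + C / (4 * c) * (dsat e (w (x, y)) * normal_gap (x, y)))"
    unfolding eq
  proof (rule integral_le)
    fix y assume "y \<in> {-t..t}"
    then have y: "\<bar>y\<bar> < R" using t by auto
    define s where "s = sat e (w (x, y)) * D1 (x, y)"
    have "s\<^sup>2 \<le> C * dsat e (w (x, y)) * normal_gap (x, y)"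
      unfolding s_def power_mult_distrib
      using le[OF y] D1_sq_le C dsat_nonneg normal_gap_nonneg by (intro mult_mono) auto
    moreover have "s \<le> c + s\<^sup>2 / (4 * c)"
    proof -
      have "4 * c * s \<le> 4 * c * c + s\<^sup>2"
        using zero_le_power2[of "s - 2 * c"] by (simp add: power2_eq_square algebra_simps)
      then show ?thesis using c by (simp add: field_simps)
    qed
    ultimately have "s \<le> c + C * dsat e (w (x, y)) * normal_gap (x, y) / (4 * c)"
      using c divide_right_mono[of "s\<^sup>2" "C * dsat e (w (x, y)) * normal_gap (x, y)" "4 * c"] by linarith
    then show "sat e (w (x, y)) * D1 (x, y) \<le> c + C / (4 * c) * (dsat e (w (x, y)) * normal_gap (x, y))"
      by (simp add: s_def)
  qed (use t in \<open>intro integrable_continuous_real continuous_intros cont_segs; simp\<close>)+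
  also have "\<dots> = 2 * t * c + C / (4 * c) * I"
    unfolding I using t
    by (subst integral_add)
       (auto intro!: integrable_continuous_real continuous_intros cont_segs integrable_on_mult_right simp del: times_divide_eq_left)
  also have "\<dots> \<le> 2 * R * c + C / (4 * c) * I" using t c by simp
  finally show ?thesis .
qed

lemma flux_vanishes_if_bounded:
  assumes e: "e > 0" and K: "\<And>x y. x \<ge> N0 \<Longrightarrow> \<bar>y\<bar> < R \<Longrightarrow> w (x, y) \<le> K"
  shows "flux_vanishes R u p q v a b e"
  unfolding flux_vanishes_def
proof (intro allI impI)
  fix k N :: real assume k: "k > 0"
  define N1 where "N1 = max N N0"
  define K1 where "K1 = max 0 (K - e)"
  \<comment> \<open>With \<open>z = max 0 (w - e)\<close> the quotient of
    \<open>(sat e w)\<^sup>2\<close> by \<open>dsat e w\<close> is \<open>z^3 / 2\<close>, and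
    \<open>z \<le> K1\<close>.\<close>
  define C where "C = K1 ^ 3"
  have C0: "C \<ge> 0" by (simp add: C_def K1_def)
  \<comment> \<open>Both terms of \<open>A_le_deriv\<close> are to be at most \<open>k / 2\<close>:
    \<open>c\<close> gives \<open>2 * R * c = k / 2\<close>, and \<open>n\<close> is chosen for
    \<open>I \<le> 8 * R / n\<close>. The summand 1 keeps \<open>n\<close> positive when
    \<open>C = 0\<close>.\<close>
  define c where "c = k / (4 * R)"
  have c: "c > 0" using k R by (simp add: c_def)
  define n where "n = (C / (4 * c) * (8 * R)) / (k / 2) + 1"
  have n: "n > 0" using C0 c R k by (simp add: n_def add_nonneg_pos)
  obtain x I where x: "N1 < x" "(A e has_real_derivative I) (at x)" "n * I = A e (N1 + n) - A e N1"
    using A_small_deriv[OF e n] by blast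
  have "A e x \<le> 2 * R * c + C / (4 * c) * I"
  proof (rule A_le_deriv[OF e c C0 _ x(2)])
    fix y assume "\<bar>y\<bar> < R"
    then have w: "w (x, y) \<le> K" using K[of x y] x(1) by (simp add: N1_def)
    define z where "z = max 0 (w (x, y) - e)"
    have z: "0 \<le> z" "z \<le> K1" using w by (auto simp: z_def K1_def)
    have "z ^ 3 \<le> C" unfolding C_def using z by (intro power_mono) auto
    then have "z * z ^ 3 \<le> z * C" using z by (intro mult_left_mono) auto
    also have "\<dots> \<le> C * (2 * z)" using z C0 by (simp add: mult.commute)
    finally have "z ^ 4 \<le> C * (2 * z)" by (simp add: power_eq_if)
    then have "z ^ 4 / (1 + z\<^sup>2)\<^sup>2 \<le> C * (2 * z) / (1 + z\<^sup>2)\<^sup>2" by (intro divide_right_mono) auto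
    then show "(sat e (w (x, y)))\<^sup>2 \<le> C * dsat e (w (x, y))"
      unfolding sat_def dsat_def z_def[symmetric] by (simp add: power_divide flip: power_mult)
  qed
  moreover have "n * I \<le> 8 * R" using A_abs_le[OF e, of "N1 + n"] A_abs_le[OF e, of N1] x(3) by linarith
  then have "I \<le> 8 * R / n" using n by (simp add: field_simps)
  then have "C / (4 * c) * I \<le> C / (4 * c) * (8 * R / n)" using C0 c by (intro mult_left_mono) auto
  moreover have "C / (4 * c) * (8 * R / n) \<le> k / 2"
  proof -
    have "C / (4 * c) * (8 * R) = (n - 1) * (k / 2)" using k by (simp add: n_def)
    also have "\<dots> \<le> k / 2 * n" using k by (simp add: field_simps)
    finally have "C / (4 * c) * (8 * R) / n \<le> k / 2 * n / n" using n by (intro divide_right_mono) auto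
    then show ?thesis using n by simp
  qed
  ultimately have "A e x \<le> 2 * R * c + k / 2" by linarith
  also have "\<dots> = k" using R by (simp add: c_def)
  finally show "\<exists>x\<ge>N. A e x \<le> k" using x(1) by (intro exI[of _ x]) (auto simp: N1_def)
qed

text \<open>The flux has derivative 0, so the nonnegative integrand vanishes and the gradients agree
  wherever \<open>w > e\<close>. Hence \<open>sat e\<close> of \<open>w\<close> is constant along
  the segment from \<open>(x, y)\<close> to the side, where it is 0.\<close>

lemma le_of_flux_zero:
  assumes e: "e > 0" and z: "\<And>x. A e x = 0" and y: "\<bar>y\<bar> \<le> R"
  shows "w (x, y) \<le> e"
proof -
  obtain t where t: "0 \<le> t" "t < R"
    and out: "\<And>x' y. x \<le> x' \<Longrightarrow> x' \<le> x \<Longrightarrow> t \<le> \<bar>y\<bar> \<Longrightarrow> \<bar>y\<bar> \<le> R \<Longrightarrow> w (x', y) < e"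
    and D: "\<And>x'. x \<le> x' \<Longrightarrow> x' \<le> x \<Longrightarrow> (A e has_real_derivative integral {-t..t} (\<lambda>y. dsat e (w (x', y)) * normal_gap (x', y))) (at x')"
    by (rule A_window[OF e order_refl R, of x x]) blast
  let ?f = "\<lambda>y. dsat e (w (x, y)) * normal_gap (x, y)"
  have cf: "continuous_on {-t..t} ?f" using t by (intro continuous_intros cont_segs)
  have "A e = (\<lambda>x. 0)" using z by auto
  then have "(A e has_real_derivative 0) (at x)" by simp
  then have "integral {-t..t} ?f = 0" using DERIV_unique[OF D[OF order_refl order_refl]] by blast
  then have i0: "(?f has_integral 0) (cbox (-t) t)"
    using integrable_integral[OF integrable_continuous_real[OF cf]] by simp
  have f0: "?f y = 0" if "\<bar>y\<bar> < t" for y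
  proof (rule has_integral_0_cbox_imp_0[OF _ _ i0])
    show "y \<in> cbox (-t) t" "box (-t) t \<noteq> {}" using that by (auto simp: box_real)
    show "0 \<le> ?f y" for y by (intro mult_nonneg_nonneg dsat_nonneg normal_gap_nonneg)
  qed (use cf in simp)
  have dz: "dsat e (w (x, y)) * (q (x, y) - b (x, y)) = 0" if "\<bar>y\<bar> < R" for y
  proof (cases "\<bar>y\<bar> < t")
    case True
    then show ?thesis using f0[OF True] slope_mono_eq_0D(2)[of "p (x, y)" "q (x, y)" "a (x, y)" "b (x, y)"]
      by (auto simp: normal_gap_def)
  next
    case False
    then show ?thesis using out[of x y] that by (simp add: dsat_eq_0)
  qed
  have dw: "((\<lambda>y. w (x, y)) has_real_derivative q (x, y) - b (x, y)) (at y)" if "\<bar>y\<bar> < R" for y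
    unfolding w_def by (intro DERIV_diff cmc_graph_DERIV[OF gu] cmc_graph_DERIV[OF gv] that)
  have "sat e (w (x, y)) = sat e (w (x, R))"
  proof (cases "y < R")
    case True
    have "continuous_on {y..R} (\<lambda>y. sat e (w (x, y)))"
      using y by (intro continuous_intros continuous_on_compose2[OF cont_w_closed]) auto
    moreover have "((\<lambda>y. sat e (w (x, y))) has_real_derivative 0) (at y')" if "y < y'" "y' < R" for y'
    proof -
      have "\<bar>y'\<bar> < R" using that y by linarith
      then show ?thesis using DERIV_chain2[OF DERIV_sat dw, of y' e] dz by simp
    qed
    ultimately show ?thesis using DERIV_isconst_end[OF True, of "\<lambda>y. sat e (w (x, y))"] by simp
  next
    case False
    then have "y = R" using y by linarith
    then show ?thesis by simp
  qed
  moreover have "w (x, R) \<le> e" using side(1)[of x] e by (simp add: w_def)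
  ultimately show ?thesis by (metis sat_eq_0_iff)
qed

end

section \<open>Reflection in the first coordinate\<close>

definition reflect :: "real \<times> real \<Rightarrow> real \<times> real" where
  "reflect z = (- fst z, snd z)"

lemma reflect_Pair [simp]: "reflect (x, y) = (- x, y)"
  by (simp add: reflect_def)

lemma reflect_band: "reflect z \<in> band R \<longleftrightarrow> z \<in> band R"
  by (cases z) (simp add: mem_band)

lemma continuous_on_reflect:
  assumes "continuous_on (UNIV \<times> T) g"
  shows "continuous_on (UNIV \<times> T) (\<lambda>z. g (reflect z))"
  by (rule continuous_on_compose2[OF assms]) (auto simp: reflect_def intro!: continuous_intros)

lemma has_derivative_reflect:
  assumes "(g has_derivative (\<lambda>h. fst h * r + snd h * s)) (at (reflect z))"
  shows "((\<lambda>z. g (reflect z)) has_derivative (\<lambda>h. fst h * (- r) + snd h * s)) (at z)"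
proof -
  have "(reflect has_derivative reflect) (at z)"
    unfolding reflect_def by (auto intro!: derivative_eq_intros)
  from diff_chain_at[OF this assms] show ?thesis by (simp add: o_def reflect_def)
qed

lemma cmc_graph_reflect:
  assumes "cmc_graph R u p q"
  shows "cmc_graph R (\<lambda>z. u (reflect z)) (\<lambda>z. - p (reflect z)) (\<lambda>z. q (reflect z))"
proof -
  from assms obtain px py qx qy where c: "continuous_on (band R) px" "continuous_on (band R) py"
      "continuous_on (band R) qx" "continuous_on (band R) qy"
    and d: "\<And>z. z \<in> band R \<Longrightarrow> (p has_derivative (\<lambda>h. fst h * px z + snd h * py z)) (at z)"
      "\<And>z. z \<in> band R \<Longrightarrow> (q has_derivative (\<lambda>h. fst h * qx z + snd h * qy z)) (at z)"
      "\<And>z. z \<in> band R \<Longrightarrow> (u has_derivative (\<lambda>h. fst h * p z + snd h * q z)) (at z)"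
    and e: "\<And>z. z \<in> band R \<Longrightarrow> (1 + (q z)\<^sup>2) * px z - p z * q z * (py z + qx z) + (1 + (p z)\<^sup>2) * qy z
          = (sqrt (1 + (p z)\<^sup>2 + (q z)\<^sup>2)) ^ 3 / R"
    and u: "continuous_on (UNIV \<times> {-R..R}) u"
    unfolding cmc_graph_def by blast
  note c' = c[unfolded band_def, THEN continuous_on_reflect, folded band_def]
  show ?thesis
    unfolding cmc_graph_def
  proof (intro conjI ballI exI)
    show "continuous_on (UNIV \<times> {-R..R}) (\<lambda>z. u (reflect z))" by (rule continuous_on_reflect[OF u])
    show "continuous_on (band R) (\<lambda>z. px (reflect z))" "continuous_on (band R) (\<lambda>z. - py (reflect z))"
      "continuous_on (band R) (\<lambda>z. - qx (reflect z))" "continuous_on (band R) (\<lambda>z. qy (reflect z))"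
      using c' by (auto intro: continuous_intros)
    fix z assume z: "z \<in> band R"
    then have z': "reflect z \<in> band R" by (simp add: reflect_band)
    show "((\<lambda>z. u (reflect z)) has_derivative (\<lambda>h. fst h * - p (reflect z) + snd h * q (reflect z))) (at z)"
      by (rule has_derivative_reflect[OF d(3)[OF z']])
    show "((\<lambda>z. q (reflect z)) has_derivative (\<lambda>h. fst h * - qx (reflect z) + snd h * qy (reflect z))) (at z)"
      by (rule has_derivative_reflect[OF d(2)[OF z']])
    show "((\<lambda>z. - p (reflect z)) has_derivative (\<lambda>h. fst h * px (reflect z) + snd h * - py (reflect z))) (at z)"
      using has_derivative_minus[OF has_derivative_reflect[OF d(1)[OF z']]] by simp
    show "(1 + (q (reflect z))\<^sup>2) * px (reflect z) - - p (reflect z) * q (reflect z) * (- py (reflect z) + - qx (reflect z))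
        + (1 + (- p (reflect z))\<^sup>2) * qy (reflect z) = sqrt (1 + (- p (reflect z))\<^sup>2 + (q (reflect z))\<^sup>2) ^ 3 / R"
      using e[OF z'] by (simp add: algebra_simps)
  qed
qed

text \<open>Reflection reverses the first flux component, so an upper bound for the limit at
  infinity of the reflected pair is a lower bound for the limit at minus infinity of the given
  one.\<close>

lemma sat_flux_reflect:
  "sat_flux R (\<lambda>z. u (reflect z)) (\<lambda>z. - p (reflect z)) (\<lambda>z. q (reflect z))
     (\<lambda>z. v (reflect z)) (\<lambda>z. - a (reflect z)) (\<lambda>z. b (reflect z)) e x = - sat_flux R u p q v a b e (- x)"
proof -
  have f: "flux (- c) d = - flux c d" for c d by (simp add: flux_def)
  have "sat_flux R u p q v a b e (- x) = integral {-R..R} (\<lambda>y. - (sat e (u (- x, y) - v (- x, y)) *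
      (flux (- p (- x, y)) (q (- x, y)) - flux (- a (- x, y)) (b (- x, y)))))"
    unfolding sat_flux_def by (rule integral_cong) (simp add: f algebra_simps)
  also have "\<dots> = - sat_flux R (\<lambda>z. u (reflect z)) (\<lambda>z. - p (reflect z)) (\<lambda>z. q (reflect z))
     (\<lambda>z. v (reflect z)) (\<lambda>z. - a (reflect z)) (\<lambda>z. b (reflect z)) e x"
    by (simp only: sat_flux_def integral_neg reflect_Pair)
  finally show ?thesis by simp
qed

context cmc_pair
begin

text \<open>A nondecreasing function with limit at most 0 at infinity and at least 0 at minus
  infinity is 0, and \<open>le_of_flux_zero\<close> applies.\<close>

lemma le_eps_of_flux_vanishes:
  assumes e: "e > 0" and v: "flux_vanishes R u p q v a b e"
    and v': "flux_vanishes R (\<lambda>z. u (reflect z)) (\<lambda>z. - p (reflect z)) (\<lambda>z. q (reflect z))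
     (\<lambda>z. v (reflect z)) (\<lambda>z. - a (reflect z)) (\<lambda>z. b (reflect z)) e"
    and y: "\<bar>y\<bar> \<le> R"
  shows "w (x, y) \<le> e"
proof (rule le_of_flux_zero[OF e _ y])
  fix x
  have f: "\<exists>x\<ge>N. A e x \<le> k" if "k > 0" for k N
    using v that by (simp add: flux_vanishes_def)
  have f': "\<exists>x\<ge>N. - A e (- x) \<le> k" if "k > 0" for k N
    using v'[unfolded flux_vanishes_def sat_flux_reflect, rule_format, OF that] .
  have "A e x \<le> 0 + k" if k: "k > 0" for k
  proof -
    obtain x' where "x' \<ge> x" "A e x' \<le> k" using f[OF k] by blast
    then show ?thesis using A_mono[OF e, of x x'] by linarith
  qed
  then have "A e x \<le> 0" by (rule field_le_epsilon)
  moreover have "- A e x \<le> 0 + k" if k: "k > 0" for k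
  proof -
    obtain x' where "x' \<ge> - x" "- A e (- x') \<le> k" using f'[OF k] by blast
    then show ?thesis using A_mono[OF e, of "- x'" x] by linarith
  qed
  then have "- A e x \<le> 0" by (rule field_le_epsilon)
  ultimately show "A e x = 0" by linarith
qed

lemma le_of_flux_vanishes:
  assumes "\<And>e. e > 0 \<Longrightarrow> flux_vanishes R u p q v a b e"
    and "\<And>e. e > 0 \<Longrightarrow> flux_vanishes R (\<lambda>z. u (reflect z)) (\<lambda>z. - p (reflect z)) (\<lambda>z. q (reflect z))
     (\<lambda>z. v (reflect z)) (\<lambda>z. - a (reflect z)) (\<lambda>z. b (reflect z)) e"
    and y: "\<bar>y\<bar> \<le> R"
  shows "u (x, y) \<le> v (x, y)"
proof -
  have "w (x, y) \<le> 0 + e" if "e > 0" for e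
    using le_eps_of_flux_vanishes[OF that assms(1)[OF that] assms(2)[OF that] y] by simp
  then have "w (x, y) \<le> 0" by (rule field_le_epsilon)
  then show ?thesis by (simp add: w_def)
qed

lemma reflect_pair:
  "cmc_pair R (\<lambda>z. u (reflect z)) (\<lambda>z. - p (reflect z)) (\<lambda>z. q (reflect z))
     (\<lambda>z. v (reflect z)) (\<lambda>z. - a (reflect z)) (\<lambda>z. b (reflect z))"
  by unfold_locales (use R side in \<open>auto intro: cmc_graph_reflect gu gv\<close>)

lemma le_of_bounded:
  assumes K: "\<And>x y. \<bar>y\<bar> < R \<Longrightarrow> w (x, y) \<le> K" and y: "\<bar>y\<bar> \<le> R"
  shows "u (x, y) \<le> v (x, y)"
proof (rule le_of_flux_vanishes[OF _ _ y])
  fix e :: real assume e: "e > 0"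
  show "flux_vanishes R u p q v a b e" by (rule flux_vanishes_if_bounded[OF e K])
  interpret r: cmc_pair R "\<lambda>z. u (reflect z)" "\<lambda>z. - p (reflect z)" "\<lambda>z. q (reflect z)"
     "\<lambda>z. v (reflect z)" "\<lambda>z. - a (reflect z)" "\<lambda>z. b (reflect z)"
    by (rule reflect_pair)
  show "flux_vanishes R (\<lambda>z. u (reflect z)) (\<lambda>z. - p (reflect z)) (\<lambda>z. q (reflect z))
     (\<lambda>z. v (reflect z)) (\<lambda>z. - a (reflect z)) (\<lambda>z. b (reflect z)) e"
    by (rule r.flux_vanishes_if_bounded[OF e]) (use K in \<open>simp add: r.w_def w_def\<close>)
qed

end

subsection \<open>Barriers by spheres\<close>

lemma second_derivative_le_0_if_local_max:
  fixes f G :: "real \<Rightarrow> real"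
  assumes d: "\<delta> > 0"
    and D: "\<And>s. \<bar>s\<bar> < \<delta> \<Longrightarrow> (f has_real_derivative G s) (at s)"
    and m: "\<And>s. \<bar>s\<bar> < \<delta> \<Longrightarrow> f s \<le> f 0"
    and D2: "(G has_real_derivative \<kappa>) (at 0)"
  shows "\<kappa> \<le> 0"
proof (rule ccontr)
  assume neg: "\<not> \<kappa> \<le> 0"
  have G0: "G 0 = 0"
    using d m by (intro DERIV_local_max[OF D[of 0] d]) auto
  obtain r where r: "r > 0" "\<And>h. 0 < h \<Longrightarrow> h < r \<Longrightarrow> G 0 < G (0 + h)"
    using DERIV_pos_inc_right[OF D2] neg by auto
  define s where "s = min r \<delta> / 2"
  have s: "0 < s" "s < r" "s < \<delta>" using r d by (auto simp: s_def)
  have "f 0 < f s"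
  proof (rule DERIV_pos_imp_increasing_open[OF s(1)])
    show "\<exists>y. DERIV f x :> y \<and> y > 0" if "0 < x" "x < s" for x
      using D[of x] r(2)[of x] that s G0 by (intro exI[of _ "G x"]) auto
    show "continuous_on {0..s} f"
      using s by (intro continuous_at_imp_continuous_on ballI DERIV_isCont[OF D]) auto
  qed
  then show False using m[of s] s by simp
qed

text \<open>The barrier \<open>b\<close> is the lower hemisphere of radius \<open>\<rho>\<close>
  over the disc, with lowest height \<open>M\<close> and rim at height \<open>M + \<rho>\<close>.
  Its divergence \<open>2 / \<rho>\<close> is below \<open>1 / R\<close>, so \<open>u - b\<close>
  has no interior maximum; it has none at a rim point between the lines \<open>ya\<close> and
  \<open>yb\<close>, where \<open>b\<close> is infinitely steep; and on these lines
  \<open>u \<le> M \<le> b\<close>.\<close>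

lemma cmc_graph_le_sphere:
  assumes g: "cmc_graph R u p q" and R: "R > 0" and \<rho>: "\<rho> > 2 * R"
    and yab: "-R \<le> ya" "yb \<le> R"
    and M: "\<And>x y. y = ya \<or> y = yb \<Longrightarrow> \<bar>y\<bar> \<le> R \<Longrightarrow> (x - x0)\<^sup>2 + (y - y0)\<^sup>2 \<le> \<rho>\<^sup>2 \<Longrightarrow> u (x, y) \<le> M"
    and xy: "ya \<le> y" "y \<le> yb" "(x - x0)\<^sup>2 + (y - y0)\<^sup>2 \<le> \<rho>\<^sup>2"
  shows "u (x, y) \<le> M + \<rho>"
proof -
  from g obtain px py qx qy where
      du: "\<And>z. z \<in> band R \<Longrightarrow> (u has_derivative (\<lambda>h. fst h * p z + snd h * q z)) (at z)"
    and dp: "\<And>z. z \<in> band R \<Longrightarrow> (p has_derivative (\<lambda>h. fst h * px z + snd h * py z)) (at z)"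
    and dq: "\<And>z. z \<in> band R \<Longrightarrow> (q has_derivative (\<lambda>h. fst h * qx z + snd h * qy z)) (at z)"
    and eq: "\<And>z. z \<in> band R \<Longrightarrow> (1 + (q z)\<^sup>2) * px z - p z * q z * (py z + qx z) + (1 + (p z)\<^sup>2) * qy z
          = (sqrt (1 + (p z)\<^sup>2 + (q z)\<^sup>2)) ^ 3 / R"
    and cu: "continuous_on (UNIV \<times> {-R..R}) u"
    unfolding cmc_graph_def by blast
  define r where "r z = (fst z - x0)\<^sup>2 + (snd z - y0)\<^sup>2" for z :: "real \<times> real"
  define b where "b z = M + \<rho> - sqrt (\<rho>\<^sup>2 - r z)" for z
  define K where "K = (UNIV \<times> {ya..yb}) \<inter> {z. r z \<le> \<rho>\<^sup>2}"
  have \<rho>0: "\<rho> > 0" using R \<rho> by linarith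
  have bnd: "\<bar>fst z - x0\<bar> \<le> \<rho>" "M \<le> b z" if "r z \<le> \<rho>\<^sup>2" "0 \<le> r z" for z
  proof -
    have "(fst z - x0)\<^sup>2 \<le> \<rho>\<^sup>2" using that zero_le_power2[of "snd z - y0"] unfolding r_def by linarith
    then show "\<bar>fst z - x0\<bar> \<le> \<rho>" using \<rho>0 by (simp add: abs_le_square_iff[symmetric])
    have "sqrt (\<rho>\<^sup>2 - r z) \<le> sqrt (\<rho>\<^sup>2)" using that by (intro real_sqrt_le_mono) auto
    then show "M \<le> b z" using \<rho>0 by (simp add: b_def)
  qed
  have r0: "0 \<le> r z" for z by (simp add: r_def)
  have cr: "continuous_on S r" for S unfolding r_def by (intro continuous_intros)
  have "compact K"
  proof -
    have "closed K" unfolding K_def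
      using cr by (intro closed_Int closed_Times closed_Collect_le) (auto intro: continuous_intros)
    moreover have "K \<subseteq> cbox (x0 - \<rho>, ya) (x0 + \<rho>, yb)"
      using bnd(1) r0 by (force simp: K_def abs_le_iff)
    ultimately show ?thesis using compact_Int_closed[OF compact_cbox] by (metis inf.absorb2)
  qed
  moreover have xyK: "(x, y) \<in> K" using xy by (simp add: K_def r_def)
  moreover have "continuous_on K (\<lambda>z. u z - b z)"
    unfolding b_def
    using yab cr by (intro continuous_intros continuous_on_subset[OF cu]) (auto simp: K_def)
  ultimately obtain z where z: "z \<in> K" and max: "\<And>z'. z' \<in> K \<Longrightarrow> u z' - b z' \<le> u z - b z"
    using continuous_attains_sup[of K "\<lambda>z. u z - b z"] by blast
  define X where "X = fst z - x0"
  define Y where "Y = snd z - y0"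
  have rz: "r z = X\<^sup>2 + Y\<^sup>2" by (simp add: r_def X_def Y_def)
  have ze: "z = (x0 + X, y0 + Y)" by (cases z) (simp add: X_def Y_def)
  have "u z - b z \<le> 0"
  proof (cases "snd z = ya \<or> snd z = yb")
    case True
    then have "u z \<le> M" using M[of "snd z" "fst z"] z yab by (auto simp: K_def r_def)
    then show ?thesis using bnd(2)[of z] z r0[of z] by (simp add: K_def)
  next
    case False
    then have y: "ya < snd z" "snd z < yb" and rle: "r z \<le> \<rho>\<^sup>2" using z by (auto simp: K_def)
    then have zb: "z \<in> band R" using yab by (auto simp: band_def mem_Times_iff)
    define l where "l h s = (x0 + X + s * fst h, y0 + Y + s * snd h)" for h :: "real \<times> real" and s :: real
    have l0: "l h 0 = z" for h by (simp add: l_def ze)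
    have dl: "(l h has_derivative (\<lambda>t. (t * fst h, t * snd h))) (at s)" for h s
      unfolding l_def by (auto intro!: derivative_eq_intros)
    have dlu: "((\<lambda>s. g' (l h s)) has_real_derivative fst h * c + snd h * d) (at s)"
      if "(g' has_derivative (\<lambda>h. fst h * c + snd h * d)) (at (l h s))" for g' :: "real \<times> real \<Rightarrow> real" and h c d s
    proof -
      have "(g' \<circ> l h has_derivative (\<lambda>t. fst h * t * c + snd h * t * d)) (at s)"
        using diff_chain_at[OF dl that] by (simp add: o_def mult_ac)
      moreover have "(\<lambda>t. fst h * t * c + snd h * t * d) = (*) (fst h * c + snd h * d)"
        by (simp add: fun_eq_iff algebra_simps)
      ultimately show ?thesis by (simp add: has_field_derivative_def o_def)
    qed
    have cl: "isCont (l h) s" for h s by (rule has_derivative_continuous[OF dl])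
    show ?thesis
    proof (cases "r z = \<rho>\<^sup>2")
      case True
      \<comment> \<open>From a rim point one moves towards the centre. There \<open>b\<close> drops
        at least like \<open>\<rho> * sqrt s\<close>, faster than the differentiable
        \<open>u\<close> can, so \<open>u - b\<close> would increase.\<close>
      let ?h = "(- X, - Y)"
      define L where "L = - X * p z + - Y * q z"
      have "((\<lambda>s. u (l ?h s)) has_real_derivative L) (at 0)"
        using dlu[of u "p z" "q z" ?h 0] du[OF zb] by (simp add: l0 L_def)
      then have "((\<lambda>s. (u (l ?h s) - u z) / s) \<longlongrightarrow> L) (at 0)"
        by (simp add: DERIV_def l0)
      then have e1: "\<forall>\<^sub>F s in at 0. L - 1 < (u (l ?h s) - u z) / s"
        by (rule order_tendstoD) simp
      have "open (UNIV \<times> {ya<..<yb} :: (real \<times> real) set)" by (intro open_Times) auto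
      moreover have "l ?h 0 \<in> UNIV \<times> {ya<..<yb}" using y by (simp add: l0 mem_Times_iff)
      ultimately have "\<forall>\<^sub>F s in at 0. l ?h s \<in> UNIV \<times> {ya<..<yb}"
        using cl[of 0 ?h] unfolding isCont_def by (rule topological_tendstoD[rotated])
      with e1 have "\<forall>\<^sub>F s in at_right 0. L - 1 < (u (l ?h s) - u z) / s \<and> l ?h s \<in> UNIV \<times> {ya<..<yb}"
        by (intro eventually_conj) (auto simp: eventually_at_split)
      then obtain d where d: "d > 0"
        "\<And>s. 0 < s \<Longrightarrow> s < d \<Longrightarrow> L - 1 < (u (l ?h s) - u z) / s \<and> l ?h s \<in> UNIV \<times> {ya<..<yb}"
        unfolding eventually_at_right_field by auto
      \<comment> \<open>\<open>s \<le> 1\<close> gives \<open>2 * s - s\<^sup>2 \<ge> s\<close>. The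
        last bound makes the quotient at most \<open>- (\<bar>L\<bar> + 1)\<close>, hence at most
        \<open>L - 1\<close>, against the choice of \<open>d\<close>.\<close>
      define s where "s = min (d / 2) (min 1 ((\<rho> / (\<bar>L\<bar> + 1))\<^sup>2))"
      have s: "0 < s" "s < d" "s \<le> 1" "s \<le> (\<rho> / (\<bar>L\<bar> + 1))\<^sup>2"
        using d(1) \<rho>0 by (auto simp: s_def intro!: divide_pos_pos)
      have rl: "r (l ?h s) = (1 - s)\<^sup>2 * \<rho>\<^sup>2"
        unfolding True[symmetric] rz by (simp add: r_def l_def power2_eq_square algebra_simps)
      have "(1 - s)\<^sup>2 \<le> 1" using s by (simp add: power_le_one)
      then have "r (l ?h s) \<le> \<rho>\<^sup>2" unfolding rl by (simp add: mult_left_le_one_le)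
      moreover have "l ?h s \<in> UNIV \<times> {ya<..<yb}" using d(2)[of s] s by blast
      ultimately have "l ?h s \<in> K" by (auto simp: K_def)
      then have "u (l ?h s) - u z \<le> b (l ?h s) - b z" using max by fastforce
      also have "\<dots> = - (\<rho> * sqrt (2 * s - s\<^sup>2))"
      proof -
        have "\<rho>\<^sup>2 - r (l ?h s) = \<rho>\<^sup>2 * (2 * s - s\<^sup>2)"
          unfolding rl by (simp add: power2_eq_square algebra_simps)
        then show ?thesis using \<rho>0 True by (simp add: b_def real_sqrt_mult)
      qed
      also have "\<dots> \<le> - (\<rho> * sqrt s)"
        using s \<rho>0 by (simp add: power2_eq_square mult_left_le)
      finally have "u (l ?h s) - u z \<le> - (\<rho> * sqrt s)" .
      then have "(u (l ?h s) - u z) / s \<le> - (\<rho> * sqrt s) / s" using s by (intro divide_right_mono) auto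
      also have "\<dots> = - (\<rho> / sqrt s)" using s by (simp add: field_simps)
      also have "\<dots> \<le> - (\<bar>L\<bar> + 1)"
      proof -
        have "sqrt s \<le> \<rho> / (\<bar>L\<bar> + 1)" using s \<rho>0 by (intro real_le_lsqrt) auto
        then show ?thesis using s by (simp add: field_simps)
      qed
      finally show ?thesis using d(2)[of s] s by force
    next
      case False
      then have rlt: "r z < \<rho>\<^sup>2" using rle by simp
      define S where "S z = sqrt (\<rho>\<^sup>2 - r z)" for z
      have Sz: "S z > 0" using rlt by (simp add: S_def)
      define U where "U = {z. r z < \<rho>\<^sup>2} \<inter> (UNIV \<times> {ya<..<yb})"
      have U: "open U" unfolding U_def
        using cr by (intro open_Int open_Times open_Collect_less) (auto intro: continuous_intros)
      have zU: "z \<in> U" using rlt y by (simp add: U_def mem_Times_iff)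
      have UK: "U \<subseteq> K" "U \<subseteq> band R" using yab by (auto simp: U_def K_def band_def)
      \<comment> \<open>At an interior maximum the gradients of \<open>u\<close> and
        \<open>b\<close> agree, and the second derivative of \<open>u\<close> in each direction
        \<open>h\<close> is at most that of \<open>b\<close>. Both facts are read off on the line
        \<open>l h\<close> through \<open>z\<close>.\<close>
      have test: "(fst h * fst h * px z + fst h * snd h * (py z + qx z) + snd h * snd h * qy z)
          \<le> ((fst h)\<^sup>2 + (snd h)\<^sup>2) / S z + (X * fst h + Y * snd h)\<^sup>2 / S z ^ 3"
        and grad: "fst h * p z + snd h * q z = (X * fst h + Y * snd h) / S z" for h
      proof -
        have "\<forall>\<^sub>F s in at 0. l h s \<in> U"
          using cl[of 0 h] U zU unfolding isCont_def l0 by (rule topological_tendstoD)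
        then have "\<forall>\<^sub>F s in nhds 0. l h s \<in> U"
          using zU by (simp add: eventually_nhds_conv_at l0)
        then obtain \<delta> where \<delta>: "\<delta> > 0" "\<And>s. \<bar>s\<bar> < \<delta> \<Longrightarrow> l h s \<in> U"
          unfolding eventually_nhds_metric by (auto simp: dist_real_def)
        define N where "N s = (X + s * fst h) * fst h + (Y + s * snd h) * snd h" for s
        have drl: "((\<lambda>s. r (l h s)) has_real_derivative 2 * N s) (at s)" for s
          unfolding r_def l_def N_def by (auto intro!: derivative_eq_intros)
        have SU: "S (l h s) > 0" if "\<bar>s\<bar> < \<delta>" for s
          using \<delta>(2)[OF that] by (simp add: S_def U_def)
        have dS: "((\<lambda>s. S (l h s)) has_real_derivative - N s / S (l h s)) (at s)" if "\<bar>s\<bar> < \<delta>" for s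
          unfolding S_def using SU[OF that]
          by (auto intro!: derivative_eq_intros drl simp: S_def field_simps)
        define G where "G s = (fst h * p (l h s) + snd h * q (l h s)) - N s / S (l h s)" for s
        have D: "((\<lambda>s. u (l h s) - b (l h s)) has_real_derivative G s) (at s)" if "\<bar>s\<bar> < \<delta>" for s
        proof -
          have "((\<lambda>s. u (l h s) - (M + \<rho> - S (l h s))) has_real_derivative
              (fst h * p (l h s) + snd h * q (l h s)) - (0 - (- N s / S (l h s)))) (at s)"
            using \<delta>(2)[OF that] UK by (intro DERIV_diff dlu du DERIV_const dS that) auto
          then show ?thesis by (simp add: b_def S_def G_def)
        qed
        have m: "u (l h s) - b (l h s) \<le> u (l h 0) - b (l h 0)" if "\<bar>s\<bar> < \<delta>" for s
          unfolding l0 by (rule max) (use \<delta>(2)[OF that] UK in blast)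
        have "G 0 = 0"
          using m \<delta>(1) by (intro DERIV_local_max[OF D[of 0] \<delta>(1)]) auto
        then show "fst h * p z + snd h * q z = (X * fst h + Y * snd h) / S z"
          by (simp add: G_def N_def l0)
        have dN: "(N has_real_derivative (fst h)\<^sup>2 + (snd h)\<^sup>2) (at 0)"
          unfolding N_def by (auto intro!: derivative_eq_intros simp: power2_eq_square)
        have "(G has_real_derivative (fst h * (fst h * px z + snd h * py z) + snd h * (fst h * qx z + snd h * qy z))
            - ((((fst h)\<^sup>2 + (snd h)\<^sup>2) * S (l h 0) - N 0 * (- N 0 / S (l h 0))) / (S (l h 0) * S (l h 0)))) (at 0)"
          unfolding G_def
          using SU[of 0] \<delta>(1) dp[OF zb] dq[OF zb]
          by (intro DERIV_diff DERIV_add DERIV_cmult dlu DERIV_divide dN dS) (auto simp: l0)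
        from second_derivative_le_0_if_local_max[OF \<delta>(1) D m this]
        have "(fst h * (fst h * px z + snd h * py z) + snd h * (fst h * qx z + snd h * qy z))
            \<le> (((fst h)\<^sup>2 + (snd h)\<^sup>2) * S z - N 0 * (- N 0 / S z)) / (S z * S z)"
          by (simp add: l0)
        also have "\<dots> = ((fst h)\<^sup>2 + (snd h)\<^sup>2) / S z + (N 0)\<^sup>2 / S z ^ 3"
          using Sz by (simp add: field_simps power2_eq_square power3_eq_cube)
        finally show "(fst h * fst h * px z + fst h * snd h * (py z + qx z) + snd h * snd h * qy z)
          \<le> ((fst h)\<^sup>2 + (snd h)\<^sup>2) / S z + (X * fst h + Y * snd h)\<^sup>2 / S z ^ 3"
          by (simp add: N_def algebra_simps)
      qed
      have pq: "p z = X / S z" "q z = Y / S z" using grad[of "(1, 0)"] grad[of "(0, 1)"] by simp_all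
      define W where "W = sqrt (1 + (p z)\<^sup>2 + (q z)\<^sup>2)"
      have SS: "(S z)\<^sup>2 + X\<^sup>2 + Y\<^sup>2 = \<rho>\<^sup>2" using rlt by (simp add: S_def rz)
      have "1 + (p z)\<^sup>2 + (q z)\<^sup>2 = ((S z)\<^sup>2 + X\<^sup>2 + Y\<^sup>2) / (S z)\<^sup>2"
        unfolding pq using Sz by (simp add: field_simps power_divide)
      also have "\<dots> = (\<rho> / S z)\<^sup>2" unfolding SS by (simp add: power_divide)
      finally have W2: "1 + (p z)\<^sup>2 + (q z)\<^sup>2 = (\<rho> / S z)\<^sup>2" .
      then have W: "W = \<rho> / S z" unfolding W_def using \<rho>0 Sz by simp
      have "W ^ 3 / R = (1 + (q z)\<^sup>2) * px z - p z * q z * (py z + qx z) + (1 + (p z)\<^sup>2) * qy z"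
        unfolding W_def by (rule eq[OF zb, symmetric])
      \<comment> \<open>The operator in the equation is the sum of the second derivatives along
        \<open>(1, 0)\<close>, \<open>(0, 1)\<close> and \<open>(- q z, p z)\<close>, the last
        orthogonal to the gradient. So three instances of \<open>test\<close> suffice.\<close>
      also have "\<dots> = (1 * 1 * px z + 1 * 0 * (py z + qx z) + 0 * 0 * qy z)
          + (0 * 0 * px z + 0 * 1 * (py z + qx z) + 1 * 1 * qy z)
          + ((- q z) * (- q z) * px z + (- q z) * p z * (py z + qx z) + p z * p z * qy z)"
        by (simp add: algebra_simps power2_eq_square)
      also have "\<dots> \<le> ((1\<^sup>2 + 0\<^sup>2) / S z + (X * 1 + Y * 0)\<^sup>2 / S z ^ 3)
          + ((0\<^sup>2 + 1\<^sup>2) / S z + (X * 0 + Y * 1)\<^sup>2 / S z ^ 3)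
          + (((- q z)\<^sup>2 + (p z)\<^sup>2) / S z + (X * (- q z) + Y * p z)\<^sup>2 / S z ^ 3)"
        using add_mono[OF add_mono[OF test[of "(1, 0)"] test[of "(0, 1)"]] test[of "(- q z, p z)"]]
        unfolding fst_conv snd_conv .
      also have "\<dots> = 2 * (1 + (p z)\<^sup>2 + (q z)\<^sup>2) / S z"
        unfolding pq using Sz by (simp add: field_simps power2_eq_square power3_eq_cube)
      also have "\<dots> = 2 * W ^ 3 / \<rho>"
        unfolding W2 W using Sz \<rho>0 by (simp add: field_simps power2_eq_square power3_eq_cube)
      finally have "W ^ 3 / R \<le> W ^ 3 * 2 / \<rho>" by (simp add: mult.commute)
      moreover have "W ^ 3 > 0" unfolding W using Sz \<rho>0 by simp
      ultimately have "\<rho> \<le> 2 * R" using R \<rho>0 by (simp add: field_simps)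
      then show ?thesis using \<rho> by simp
    qed
  qed
  then have "u (x, y) \<le> b (x, y)" using max[OF xyK] by linarith
  also have "\<dots> \<le> M + \<rho>" using xy by (simp add: b_def r_def)
  finally show ?thesis .
qed

section \<open>Smallness of the flux by way of chords\<close>

lemma abs_le_integral_abs_deriv:
  fixes g g' :: "real \<Rightarrow> real"
  assumes d: "\<And>x. x \<in> {A..B} \<Longrightarrow> (g has_real_derivative g' x) (at x)"
    and c: "continuous_on {A..B} g'"
    and x: "x1 \<in> {A..B}" "x2 \<in> {A..B}" and z: "g x1 = 0"
  shows "\<bar>g x2\<bar> \<le> integral {A..B} (\<lambda>x. \<bar>g' x\<bar>)"
proof -
  have "\<bar>g t - g s\<bar> \<le> integral {A..B} (\<lambda>x. \<bar>g' x\<bar>)"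
    if st: "s \<le> t" "s \<in> {A..B}" "t \<in> {A..B}" for s t
  proof -
    have sub: "{s..t} \<subseteq> {A..B}" using st by auto
    have cs: "continuous_on {s..t} g'" by (rule continuous_on_subset[OF c sub])
    have "(g' has_integral g t - g s) {s..t}"
      using st(1) d sub by (intro fundamental_theorem_of_calculus)
        (auto simp: has_real_derivative_iff_has_vector_derivative[symmetric] intro: has_field_derivative_at_within)
    then have "\<bar>g t - g s\<bar> = norm (integral {s..t} g')" by (simp add: integral_unique)
    also have "\<dots> \<le> integral {s..t} (\<lambda>x. \<bar>g' x\<bar>)"
      using cs by (intro integral_norm_bound_integral integrable_continuous_real continuous_intros) auto
    also have "\<dots> \<le> integral {A..B} (\<lambda>x. \<bar>g' x\<bar>)"
      using sub c cs by (intro integral_subset_le integrable_continuous_real continuous_intros) auto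
    finally show ?thesis .
  qed
  from this[of x1 x2] this[of x2 x1] show ?thesis using x z by (cases "x1 \<le> x2") auto
qed

lemma slope_mono_commute: "slope_mono p q a b = slope_mono a b p q"
  by (simp add: slope_mono_def algebra_simps)

context cmc_pair
begin

text \<open>Otherwise \<open>A\<close> would gain more than \<open>\<kappa>\<close> on each of the
  consecutive windows of length \<open>L\<close> beyond \<open>N\<close>, although it is
  bounded.\<close>

lemma A_small_increment:
  assumes e: "e > 0" and L: "L > 0" and \<kappa>: "\<kappa> > 0"
  obtains x where "x \<ge> N" "A e (x + L) - A e x \<le> \<kappa>"
proof (rule ccontr)
  assume "\<not> thesis"
  then have gt: "A e (x + L) - A e x > \<kappa>" if "x \<ge> N" for x
    using that \<open>\<And>x. N \<le> x \<Longrightarrow> A e (x + L) - A e x \<le> \<kappa> \<Longrightarrow> thesis\<close> by force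
  have "A e (N + real n * L) - A e N \<ge> real n * \<kappa>" for n
  proof (induction n)
    case (Suc n)
    have "A e (N + real n * L + L) - A e (N + real n * L) > \<kappa>" using L by (intro gt) auto
    then show ?case using Suc by (simp add: algebra_simps)
  qed simp
  moreover obtain n where "8 * R < real n * \<kappa>" using \<kappa> reals_Archimedean3 by blast
  ultimately have "8 * R < A e (N + real n * L) - A e N" by (meson less_le_trans)
  then show False using A_abs_le[OF e, of "N + real n * L"] A_abs_le[OF e, of N] by linarith
qed

text \<open>Every chord of half-length \<open>\<rho>\<close> contains a point where the cut-off
  vanishes, so the cut-off at the midpoint is at most the integral of its absolute
  \<open>x\<close>-derivative. By \<open>slope_diff_le\<close> that derivative is at most a small
  constant plus a multiple of the integrand of \<open>A'\<close>, whose integral over the window is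
  the increment of \<open>A\<close>. Near the sides, where gradients of \<open>u\<close> may be
  unbounded, the cut-off is at most 1 on a short piece.\<close>

lemma flux_vanishes_if_chords:
  assumes C0: "C0 > 0" and \<rho>: "\<rho> > 0"
    and chord: "\<And>x0 y. \<bar>y\<bar> < R \<Longrightarrow> \<exists>x. \<bar>x - x0\<bar> \<le> \<rho> \<and> w (x, y) \<le> C0"
    and grad: "\<And>t. 0 \<le> t \<Longrightarrow> t < R \<Longrightarrow> \<exists>G\<ge>0. \<forall>x y. \<bar>y\<bar> \<le> t \<longrightarrow> sqrt (1 + (p (x, y))\<^sup>2 + (q (x, y))\<^sup>2) \<le> G"
  shows "flux_vanishes R u p q v a b C0"
  unfolding flux_vanishes_def
proof (intro allI impI)
  fix k N :: real assume k: "k > 0"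
  \<comment> \<open>The parts of the cross-section beyond \<open>t0\<close> contribute at most
    \<open>4 * (R - t0) \<le> k / 4\<close>.\<close>
  define t0 where "t0 = max 0 (R - k / 16)"
  have t0: "0 \<le> t0" "t0 < R" "R - t0 \<le> k / 16" using k R by (auto simp: t0_def max_def)
  obtain G where G: "G \<ge> 0" "\<And>x y. \<bar>y\<bar> \<le> t0 \<Longrightarrow> sqrt (1 + (p (x, y))\<^sup>2 + (q (x, y))\<^sup>2) \<le> G"
    using grad[OF t0(1,2)] by blast
  \<comment> \<open>Over the window of length \<open>2 * \<rho>\<close> the constant part adds up to
    \<open>2 * R * \<tau> * (2 * \<rho>) = k / 8\<close>.\<close>
  define \<tau> where "\<tau> = k / (32 * R * \<rho>)"
  have \<tau>: "\<tau> > 0" using k R \<rho> by (simp add: \<tau>_def)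
  define C where "C = 4 * G ^ 3 / \<tau> + 4 * G\<^sup>2"
  have C: "C \<ge> 0" using G \<tau> by (simp add: C_def)
  define \<kappa> where "\<kappa> = k / (8 * (C + 1))"
  have \<kappa>: "\<kappa> > 0" "C * \<kappa> \<le> k / 8"
  proof -
    show "\<kappa> > 0" using k C by (simp add: \<kappa>_def)
    have "C * \<kappa> \<le> (C + 1) * \<kappa>" using \<open>\<kappa> > 0\<close> by (intro mult_right_mono) auto
    also have "\<dots> = k / 8" using C by (simp add: \<kappa>_def divide_simps)
    finally show "C * \<kappa> \<le> k / 8" .
  qed
  \<comment> \<open>The window has midpoint \<open>x0\<close>, so it contains every point of a chord
    within \<open>\<rho>\<close> of \<open>x0\<close>.\<close>
  obtain x1 where x1: "x1 \<ge> N" "A C0 (x1 + 2 * \<rho>) - A C0 x1 \<le> \<kappa>"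
    using A_small_increment[OF C0, of "2 * \<rho>" \<kappa> N] \<rho> \<kappa> by auto
  define x2 where "x2 = x1 + 2 * \<rho>"
  define x0 where "x0 = x1 + \<rho>"
  have x12: "x1 \<le> x2" "x0 \<in> {x1..x2}" using \<rho> by (auto simp: x2_def x0_def)
  obtain t where t0t: "t0 \<le> t" and tR: "t < R"
    and Aeq: "\<And>x. x1 \<le> x \<Longrightarrow> x \<le> x2 \<Longrightarrow> A C0 x = integral {-t..t} (\<lambda>y. sat C0 (w (x, y)) * D1 (x, y))"
    and DA: "\<And>x. x1 \<le> x \<Longrightarrow> x \<le> x2 \<Longrightarrow>
      (A C0 has_real_derivative integral {-t..t} (\<lambda>y. dsat C0 (w (x, y)) * normal_gap (x, y))) (at x)"
    by (rule A_window[OF C0 t0(1,2), of x1 x2]) blast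
  define F where "F z = dsat C0 (w z) * (p z - a z)" for z
  define I where "I x = integral {-t..t} (\<lambda>y. dsat C0 (w (x, y)) * normal_gap (x, y))" for x
  have cF: "continuous_on (band R) F"
    unfolding F_def
    by (intro continuous_intros cont_band cmc_graph_continuous[OF gu] cmc_graph_continuous[OF gv])
  have cFabs: "continuous_on (band R) (\<lambda>z. \<bar>F z\<bar>)" by (intro continuous_intros cF)
  note segF = cont_seg_band[OF cFabs t0(2)]
  have sat_le: "sat C0 (w (x0, y)) \<le> integral {x1..x2} (\<lambda>x. \<bar>F (x, y)\<bar>)" if y: "\<bar>y\<bar> \<le> t0" for y
  proof -
    have yR: "\<bar>y\<bar> < R" using y t0 by simp
    obtain xy where xy: "\<bar>xy - x0\<bar> \<le> \<rho>" "w (xy, y) \<le> C0" using chord[OF yR] by blast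
    have "\<bar>sat C0 (w (x0, y))\<bar> \<le> integral {x1..x2} (\<lambda>x. \<bar>F (x, y)\<bar>)"
    proof (rule abs_le_integral_abs_deriv[where g = "\<lambda>x. sat C0 (w (x, y))" and ?x1.0 = xy])
      show "((\<lambda>x. sat C0 (w (x, y))) has_real_derivative F (x, y)) (at x)" for x
        unfolding F_def
        by (rule DERIV_chain2[OF DERIV_sat])
           (auto simp: w_def intro!: DERIV_diff cmc_graph_DERIV[OF gu yR] cmc_graph_DERIV[OF gv yR])
      show "continuous_on {x1..x2} (\<lambda>x. F (x, y))"
        using yR by (intro continuous_on_compose2[OF cF]) (auto simp: mem_band intro!: continuous_intros)
      show "xy \<in> {x1..x2}" using xy by (auto simp: x0_def x2_def)
      show "sat C0 (w (xy, y)) = 0" using xy by (simp add: sat_eq_0)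
    qed (fact x12(2))
    then show ?thesis by simp
  qed
  have inner: "integral {-t0..t0} (\<lambda>y. \<bar>F (x, y)\<bar>) \<le> 2 * R * \<tau> + C * I x" if x: "x \<in> {x1..x2}" for x
  proof -
    have "integral {-t0..t0} (\<lambda>y. \<bar>F (x, y)\<bar>)
        \<le> integral {-t0..t0} (\<lambda>y. \<tau> + C * (dsat C0 (w (x, y)) * normal_gap (x, y)))"
    proof (rule integral_le)
      fix y assume y: "y \<in> {-t0..t0}"
      \<comment> \<open>The arguments are exchanged because \<open>slope_diff_le\<close> wants the
        bounded slope in second place, and here it is that of \<open>u\<close>.\<close>
      have "\<bar>a (x, y) - p (x, y)\<bar> \<le> \<tau> + C * normal_gap (x, y)"
        unfolding C_def normal_gap_def slope_mono_commute[of "p (x, y)"]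
        by (rule slope_diff_le[OF G(2) \<tau>]) (use y in auto)
      then have "dsat C0 (w (x, y)) * \<bar>p (x, y) - a (x, y)\<bar> \<le> dsat C0 (w (x, y)) * (\<tau> + C * normal_gap (x, y))"
        by (intro mult_left_mono dsat_nonneg) (simp add: abs_minus_commute)
      also have "\<dots> = dsat C0 (w (x, y)) * \<tau> + C * (dsat C0 (w (x, y)) * normal_gap (x, y))"
        by (simp add: algebra_simps)
      also have "dsat C0 (w (x, y)) * \<tau> \<le> \<tau>"
        using mult_right_mono[OF dsat_le1[of C0 "w (x, y)"], of \<tau>] \<tau> by simp
      finally show "\<bar>F (x, y)\<bar> \<le> \<tau> + C * (dsat C0 (w (x, y)) * normal_gap (x, y))"
        using dsat_nonneg by (simp add: F_def abs_mult)
    qed (use t0 in \<open>intro integrable_continuous_real continuous_intros cont_segs segF; simp\<close>)+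
    also have "\<dots> \<le> integral {-t..t} (\<lambda>y. \<tau> + C * (dsat C0 (w (x, y)) * normal_gap (x, y)))"
      using t0 t0t tR \<tau> C dsat_nonneg normal_gap_nonneg
      by (intro integral_subset_le integrable_continuous_real continuous_intros cont_segs)
         (auto intro!: add_nonneg_nonneg mult_nonneg_nonneg)
    also have "\<dots> = 2 * t * \<tau> + C * I x"
      unfolding I_def using t0 t0t tR
      by (subst integral_add)
         (auto intro!: integrable_continuous_real continuous_intros cont_segs integrable_on_mult_right)
    also have "\<dots> \<le> 2 * R * \<tau> + C * I x" using tR \<tau> by simp
    finally show ?thesis .
  qed
  have HI: "((\<lambda>x. 2 * R * \<tau> + C * I x) has_integral (2 * R * \<tau>) * (x2 - x1) + C * (A C0 x2 - A C0 x1)) {x1..x2}"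
  proof -
    have "(I has_integral A C0 x2 - A C0 x1) {x1..x2}"
      using x12(1) DA unfolding I_def by (intro fundamental_theorem_of_calculus)
        (auto simp: has_real_derivative_iff_has_vector_derivative[symmetric] intro: has_field_derivative_at_within)
    from has_integral_add[OF has_integral_const_real[of "2 * R * \<tau>" x1 x2] has_integral_mult_right[OF this, of C]]
    show ?thesis using x12(1) by (simp add: mult.commute)
  qed
  have "integral {-t0..t0} (\<lambda>y. sat C0 (w (x0, y))) \<le> integral {-t0..t0} (\<lambda>y. integral {x1..x2} (\<lambda>x. \<bar>F (x, y)\<bar>))"
  proof (rule integral_le)
    show "(\<lambda>y. sat C0 (w (x0, y))) integrable_on {-t0..t0}"
      using t0 by (intro integrable_continuous_real continuous_intros cont_segs)
    have "continuous_on (cbox (-t0) t0) (\<lambda>y. integral (cbox x1 x2) (\<lambda>x. \<bar>F (x, y)\<bar>))"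
      using t0 by (intro integral_continuous_on_param)
        (auto simp: case_prod_unfold mem_band intro!: continuous_on_compose2[OF cF] continuous_intros)
    then show "(\<lambda>y. integral {x1..x2} (\<lambda>x. \<bar>F (x, y)\<bar>)) integrable_on {-t0..t0}"
      by (intro integrable_continuous_real) simp
  qed (use sat_le in auto)
  \<comment> \<open>Exchanging the integrals makes the inner one comparable with \<open>I\<close>,
    the derivative of \<open>A\<close>.\<close>
  also have "\<dots> = integral {x1..x2} (\<lambda>x. integral {-t0..t0} (\<lambda>y. \<bar>F (x, y)\<bar>))"
  proof -
    have "continuous_on (cbox (-t0, x1) (t0, x2)) (\<lambda>(y, x). \<bar>F (x, y)\<bar>)"
      using t0 by (auto simp: case_prod_unfold mem_band intro!: continuous_on_compose2[OF cF] continuous_intros)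
    from integral_swap_continuous[OF this] show ?thesis by simp
  qed
  also have "\<dots> \<le> integral {x1..x2} (\<lambda>x. 2 * R * \<tau> + C * I x)"
  proof (rule integral_le)
    have "continuous_on (cbox x1 x2) (\<lambda>x. integral (cbox (-t0) t0) (\<lambda>y. \<bar>F (x, y)\<bar>))"
      using t0 by (intro integral_continuous_on_param)
        (auto simp: case_prod_unfold mem_band intro!: continuous_on_compose2[OF cF] continuous_intros)
    then show "(\<lambda>x. integral {-t0..t0} (\<lambda>y. \<bar>F (x, y)\<bar>)) integrable_on {x1..x2}"
      by (intro integrable_continuous_real) simp
    show "(\<lambda>x. 2 * R * \<tau> + C * I x) integrable_on {x1..x2}"
      using HI by (rule has_integral_integrable)
  qed (use inner in auto)
  also have "\<dots> = (2 * R * \<tau>) * (x2 - x1) + C * (A C0 x2 - A C0 x1)"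
    using HI by (rule integral_unique)
  also have "\<dots> \<le> k / 8 + C * \<kappa>"
  proof (rule add_mono)
    show "2 * R * \<tau> * (x2 - x1) \<le> k / 8" using R \<rho> by (simp add: \<tau>_def x2_def field_simps)
    show "C * (A C0 x2 - A C0 x1) \<le> C * \<kappa>" using x1(2) C by (intro mult_left_mono) (auto simp: x2_def)
  qed
  also have "\<dots> \<le> k / 4" using \<kappa> by simp
  finally have small: "integral {-t0..t0} (\<lambda>y. sat C0 (w (x0, y))) \<le> k / 4" .
  let ?s = "\<lambda>y. sat C0 (w (x0, y))"
  have cs: "continuous_on {-t..t} ?s" using tR by (intro continuous_intros cont_segs)
  have si: "?s integrable_on {l..r}" if "-t \<le> l" "r \<le> t" for l r
    by (rule integrable_continuous_real, rule continuous_on_subset[OF cs]) (use that in auto)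
  have "A C0 x0 \<le> integral {-t..t} (\<lambda>y. 2 * ?s y)"
    unfolding Aeq[OF x12(2)[unfolded atLeastAtMost_iff, THEN conjunct1] x12(2)[unfolded atLeastAtMost_iff, THEN conjunct2]]
  proof (rule integral_le)
    show "sat C0 (w (x0, y)) * D1 (x0, y) \<le> 2 * ?s y" for y
      using mult_left_mono[of "D1 (x0, y)" 2 "?s y"] D1_le[of "(x0, y)"] sat_bounds(1)[of C0 "w (x0, y)"]
      by (simp add: mult.commute)
  qed (use tR in \<open>intro integrable_continuous_real continuous_intros cont_segs; simp\<close>)+
  also have "\<dots> = 2 * integral {-t..t} ?s" by simp
  also have "integral {-t..t} ?s = integral {-t..-t0} ?s + integral {-t0..t0} ?s + integral {t0..t} ?s"
  proof -
    have "integral {-t..t} ?s = integral {-t..t0} ?s + integral {t0..t} ?s"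
      using t0 t0t si by (intro Henstock_Kurzweil_Integration.integral_combine[symmetric]) auto
    also have "integral {-t..t0} ?s = integral {-t..-t0} ?s + integral {-t0..t0} ?s"
      using t0 t0t si by (intro Henstock_Kurzweil_Integration.integral_combine[symmetric]) auto
    finally show ?thesis .
  qed
  also have "integral {-t..-t0} ?s \<le> integral {-t..-t0} (\<lambda>y. 1)"
    using t0 t0t by (intro integral_le si sat_bounds) auto
  also have "integral {t0..t} ?s \<le> integral {t0..t} (\<lambda>y. 1)"
    using t0 t0t by (intro integral_le si sat_bounds) auto
  finally have "A C0 x0 \<le> 2 * ((t - t0) + integral {-t0..t0} ?s + (t - t0))"
    using t0t by simp
  also have "\<dots> \<le> k" using small t0 tR by simp
  finally show "\<exists>x\<ge>N. A C0 x \<le> k" using x1 \<rho> by (intro exI[of _ x0]) (auto simp: x0_def)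
qed

end

subsection \<open>Tilted cylinders\<close>

text \<open>The part below its axis of the round cylinder \<open>y\<^sup>2 + (z - m x - k)\<^sup>2 /
  (1 + m\<^sup>2) = R\<^sup>2\<close> of radius \<open>R\<close>. On the sides it has the value
  \<open>m x + k\<close>.\<close>

definition cyl :: "real \<Rightarrow> real \<Rightarrow> real \<Rightarrow> real \<times> real \<Rightarrow> real" where
  "cyl R m k z = m * fst z + k - sqrt (1 + m\<^sup>2) * sqrt (R\<^sup>2 - (snd z)\<^sup>2)"

definition cyl_y :: "real \<Rightarrow> real \<Rightarrow> real \<times> real \<Rightarrow> real" where
  "cyl_y R m z = sqrt (1 + m\<^sup>2) * snd z / sqrt (R\<^sup>2 - (snd z)\<^sup>2)"

lemma band_root_pos:
  assumes "z \<in> band R"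
  shows "0 < R\<^sup>2 - (snd z)\<^sup>2"
proof -
  have "\<bar>snd z\<bar> < \<bar>R\<bar>" using assms by (auto simp: band_def)
  then have "(snd z)\<^sup>2 < R\<^sup>2" using power_strict_mono[of "\<bar>snd z\<bar>" "\<bar>R\<bar>" 2] by simp
  then show ?thesis by simp
qed

lemma cyl_slope:
  assumes "z \<in> band R" "R > 0"
  shows "sqrt (1 + m\<^sup>2 + (cyl_y R m z)\<^sup>2) = sqrt (1 + m\<^sup>2) * R / sqrt (R\<^sup>2 - (snd z)\<^sup>2)"
proof -
  define s where "s = R\<^sup>2 - (snd z)\<^sup>2"
  have s: "s > 0" unfolding s_def by (rule band_root_pos[OF assms(1)])
  have m: "1 + m\<^sup>2 > 0" by (simp add: add_pos_nonneg)
  have "1 + m\<^sup>2 + (cyl_y R m z)\<^sup>2 = (1 + m\<^sup>2) * R\<^sup>2 / s"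
    using s m by (simp add: cyl_y_def s_def[symmetric] power_mult_distrib power_divide field_simps)
       (simp add: s_def algebra_simps)
  then show ?thesis using s m assms(2) by (simp add: real_sqrt_mult real_sqrt_divide s_def)
qed

lemma cmc_graph_cyl:
  assumes R: "R > 0"
  shows "cmc_graph R (cyl R m k) (\<lambda>z. m) (cyl_y R m)"
  unfolding cmc_graph_def
proof (intro conjI ballI exI)
  define M where "M = sqrt (1 + m\<^sup>2)"
  have M: "M > 0" "M\<^sup>2 = 1 + m\<^sup>2" by (simp_all add: M_def add_pos_nonneg)
  show "continuous_on (UNIV \<times> {-R..R}) (cyl R m k)"
    unfolding cyl_def[abs_def] by (intro continuous_intros)
  show "continuous_on (band R) (\<lambda>z. 0::real)" "continuous_on (band R) (\<lambda>z. 0::real)"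
    "continuous_on (band R) (\<lambda>z. 0::real)" by simp_all
  show "continuous_on (band R) (\<lambda>z. M * R\<^sup>2 / sqrt (R\<^sup>2 - (snd z)\<^sup>2) ^ 3)"
    using band_root_pos by (intro continuous_intros) force
  fix z assume z: "z \<in> band R"
  define s where "s = sqrt (R\<^sup>2 - (snd z)\<^sup>2)"
  have s: "s > 0" "s\<^sup>2 = R\<^sup>2 - (snd z)\<^sup>2" using band_root_pos[OF z] by (simp_all add: s_def)
  have ds: "((\<lambda>z. sqrt (R\<^sup>2 - (snd z)\<^sup>2)) has_derivative (\<lambda>h. - snd z * snd h / s)) (at z)"
    using band_root_pos[OF z] unfolding s_def
    by (auto intro!: derivative_eq_intros simp: field_simps)
  show "(cyl R m k has_derivative (\<lambda>h. fst h * m + snd h * cyl_y R m z)) (at z)"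
    unfolding cyl_def[abs_def]
    by (rule derivative_eq_intros ds refl)+
       (simp add: cyl_y_def s_def[symmetric] field_simps)
  show "((\<lambda>z. m) has_derivative (\<lambda>h. fst h * 0 + snd h * 0)) (at z)" by simp
  have "((\<lambda>z. M * snd z / sqrt (R\<^sup>2 - (snd z)\<^sup>2)) has_derivative
      (\<lambda>h. - (M * snd z) * (inverse s * (- snd z * snd h / s) * inverse s) + M * snd h / s)) (at z)"
    unfolding s_def
    by (rule has_derivative_divide[OF _ ds[unfolded s_def]])
       (use s in \<open>auto intro!: derivative_eq_intros simp: s_def\<close>)
  also have "(\<lambda>h. - (M * snd z) * (inverse s * (- snd z * snd h / s) * inverse s) + M * snd h / s)
      = (\<lambda>h. fst h * 0 + snd h * (M * R\<^sup>2 / s ^ 3))"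
  proof
    fix h
    have R2: "R\<^sup>2 = s\<^sup>2 + (snd z)\<^sup>2" using s by simp
    show "- (M * snd z) * (inverse s * (- snd z * snd h / s) * inverse s) + M * snd h / s
      = fst h * 0 + snd h * (M * R\<^sup>2 / s ^ 3)"
      unfolding R2 using s(1) by (simp add: field_simps power2_eq_square power3_eq_cube)
  qed
  finally show "(cyl_y R m has_derivative (\<lambda>h. fst h * 0 + snd h * (M * R\<^sup>2 / sqrt (R\<^sup>2 - (snd z)\<^sup>2) ^ 3))) (at z)"
    unfolding cyl_y_def[abs_def] M_def s_def .
  have e: "sqrt (1 + m\<^sup>2 + (cyl_y R m z)\<^sup>2) = M * R / s"
    unfolding M_def s_def by (rule cyl_slope[OF z R])
  show "(1 + (cyl_y R m z)\<^sup>2) * 0 - m * cyl_y R m z * (0 + 0) + (1 + m\<^sup>2) * (M * R\<^sup>2 / sqrt (R\<^sup>2 - (snd z)\<^sup>2) ^ 3)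
      = sqrt (1 + m\<^sup>2 + (cyl_y R m z)\<^sup>2) ^ 3 / R"
    unfolding e unfolding M(2)[symmetric] s_def[symmetric] using R s(1)
    by (simp add: field_simps power2_eq_square power3_eq_cube)
qed

text \<open>As \<open>m\<close> grows, the fluxes tend to the field \<open>X\<close> used below. The
  second component does not depend on \<open>m\<close> and approaches the extreme values
  \<open>\<plusminus>1\<close> at the sides, which no other flux can exceed.\<close>

lemma flux_cyl:
  assumes "z \<in> band R" "R > 0"
  shows "flux m (cyl_y R m z) = m / sqrt (1 + m\<^sup>2) * (sqrt (R\<^sup>2 - (snd z)\<^sup>2) / R)"
    and "flux (cyl_y R m z) m = snd z / R"
proof -
  have s: "sqrt (R\<^sup>2 - (snd z)\<^sup>2) > 0" using band_root_pos[OF assms(1)] by simp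
  have m: "sqrt (1 + m\<^sup>2) > 0" by (simp add: add_pos_nonneg)
  show "flux m (cyl_y R m z) = m / sqrt (1 + m\<^sup>2) * (sqrt (R\<^sup>2 - (snd z)\<^sup>2) / R)"
    unfolding flux_def cyl_slope[OF assms] by simp
  have "sqrt (1 + (cyl_y R m z)\<^sup>2 + m\<^sup>2) = sqrt (1 + m\<^sup>2) * R / sqrt (R\<^sup>2 - (snd z)\<^sup>2)"
    using cyl_slope[OF assms, of m] by (simp add: add_ac)
  then show "flux (cyl_y R m z) m = snd z / R"
    unfolding flux_def using s m by (simp add: cyl_y_def)
qed

text \<open>A disc of radius \<open>\<rho> > 2 R\<close> that touches the side from inside shows that a solution
  cannot stay far below its boundary value along a whole chord.\<close>

lemma cmc_graph_chord:
  assumes g: "cmc_graph R v a b" and R: "R > 0" and y: "\<bar>y\<bar> < R" and \<rho>: "\<rho> > 2 * R"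
  shows "\<exists>x. \<bar>x - x0\<bar> \<le> \<rho> \<and> v (x0, R) - \<rho> \<le> v (x, y)"
proof -
  note cv = cmc_graph_continuous(1)[OF g]
  have "continuous_on {x0 - \<rho>..x0 + \<rho>} (\<lambda>x. v (x, y))"
    using y by (intro continuous_on_compose2[OF cv]) (auto intro!: continuous_intros)
  then obtain xm where xm: "xm \<in> {x0 - \<rho>..x0 + \<rho>}"
      "\<And>x. x \<in> {x0 - \<rho>..x0 + \<rho>} \<Longrightarrow> v (x, y) \<le> v (xm, y)"
    using continuous_attains_sup[of "{x0 - \<rho>..x0 + \<rho>}" "\<lambda>x. v (x, y)"] R \<rho> by force
  define M where "M = v (xm, y)"
  \<comment> \<open>The disc of radius \<open>\<rho>\<close> about \<open>(x0, t - \<rho>)\<close>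
    has \<open>(x0, t)\<close> as its top point. As \<open>t < R\<close> it misses the side, so in
    the strip from \<open>y\<close> to \<open>R\<close> only the chord at height \<open>y\<close>
    supplies boundary values. The side itself is reached in the limit.\<close>
  have le: "v (x0, t) \<le> M + \<rho>" if t: "y < t" "t < R" for t
  proof (rule cmc_graph_le_sphere[OF g R \<rho>, where ya = y and yb = R and ?x0.0 = x0 and ?y0.0 = "t - \<rho>"])
    fix x y' assume y': "y' = y \<or> y' = R" and c: "(x - x0)\<^sup>2 + (y' - (t - \<rho>))\<^sup>2 \<le> \<rho>\<^sup>2"
    have "y' \<noteq> R"
    proof
      assume "y' = R"
      then have "(x - x0)\<^sup>2 + (R - (t - \<rho>))\<^sup>2 \<le> \<rho>\<^sup>2" using c by simp
      moreover have "\<rho>\<^sup>2 < (R - (t - \<rho>))\<^sup>2" using t \<rho> R by (intro power_strict_mono) auto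
      ultimately show False using zero_le_power2[of "x - x0"] by linarith
    qed
    moreover have "(x - x0)\<^sup>2 \<le> \<rho>\<^sup>2" using c zero_le_power2[of "y' - (t - \<rho>)"] by linarith
    then have "\<bar>x - x0\<bar> \<le> \<rho>" using \<rho> R by (simp add: abs_le_square_iff[symmetric])
    ultimately show "v (x, y') \<le> M" using y' xm(2)[of x] by (auto simp: M_def abs_le_iff)
  qed (use y t in auto)
  have "((\<lambda>t. v (x0, t)) \<longlongrightarrow> v (x0, R)) (at R within {-R..R})"
  proof -
    have "continuous_on {-R..R} (\<lambda>t. v (x0, t))"
      by (intro continuous_on_compose2[OF cv]) (auto intro!: continuous_intros)
    then show ?thesis using R by (auto simp: continuous_on)
  qed
  then have "((\<lambda>t. v (x0, t)) \<longlongrightarrow> v (x0, R)) (at_left R)"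
    using R at_within_Icc_at_left[of "-R" R] by simp
  moreover have "\<forall>\<^sub>F t in at_left R. v (x0, t) \<le> M + \<rho>"
    by (rule eventually_mono[OF eventually_at_left_real[of y R]]) (use le y in auto)
  ultimately have "v (x0, R) \<le> M + \<rho>"
    by (rule tendsto_upperbound) simp
  then show ?thesis using xm(1) by (intro exI[of _ xm]) (auto simp: M_def abs_le_iff)
qed

text \<open>The cylinder takes the part of \<open>u\<close>: its slope is explicit and bounded away
  from the sides. The threshold collects the loss \<open>3 * R\<close> of \<open>v\<close> on a
  chord of half-length \<open>3 * R\<close> and the change \<open>\<bar>m\<bar> * (3 * R)\<close> of
  the affine function along it.\<close>

lemma cyl_flux_vanishes:
  assumes g: "cmc_graph R v a b" and R: "R > 0"
    and bd: "\<And>x. m * x + k \<le> v (x, R)" "\<And>x. m * x + k \<le> v (x, -R)"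
  shows "flux_vanishes R (cyl R m k) (\<lambda>z. m) (cyl_y R m) v a b ((\<bar>m\<bar> + 1) * (3 * R))"
proof -
  interpret cmc_pair R "cyl R m k" "\<lambda>z. m" "cyl_y R m" v a b
    by unfold_locales (use R g bd cmc_graph_cyl in \<open>auto simp: cyl_def\<close>)
  show ?thesis
  proof (rule flux_vanishes_if_chords[where \<rho> = "3 * R"])
    fix x0 y :: real assume y: "\<bar>y\<bar> < R"
    obtain x where x: "\<bar>x - x0\<bar> \<le> 3 * R" "v (x0, R) - 3 * R \<le> v (x, y)"
      using cmc_graph_chord[OF g R y, of "3 * R" x0] R by auto
    have "cyl R m k (x, y) \<le> m * x + k"
      using band_root_pos[of "(x, y)" R] y by (simp add: cyl_def mem_band)
    moreover have "m * (x - x0) \<le> \<bar>m\<bar> * (3 * R)"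
      using x(1) by (metis abs_ge_zero abs_le_D1 abs_mult mult_left_mono)
    ultimately have "w (x, y) \<le> (\<bar>m\<bar> + 1) * (3 * R)"
      using x(2) bd(1)[of x0] by (simp add: w_def algebra_simps)
    then show "\<exists>x. \<bar>x - x0\<bar> \<le> 3 * R \<and> w (x, y) \<le> (\<bar>m\<bar> + 1) * (3 * R)" using x(1) by blast
  next
    fix t assume t: "0 \<le> t" "t < R"
    define G where "G = sqrt (1 + m\<^sup>2) * R / sqrt (R\<^sup>2 - t\<^sup>2)"
    have t2: "t\<^sup>2 < R\<^sup>2" using t by (intro power_strict_mono) auto
    show "\<exists>G\<ge>0. \<forall>x y. \<bar>y\<bar> \<le> t \<longrightarrow> sqrt (1 + m\<^sup>2 + (cyl_y R m (x, y))\<^sup>2) \<le> G"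
    proof (intro exI[of _ G] conjI allI impI)
      show "0 \<le> G" using R t2 by (simp add: G_def)
      fix x y :: real assume y: "\<bar>y\<bar> \<le> t"
      have b: "(x, y) \<in> band R" using y t by (simp add: mem_band)
      have "y\<^sup>2 \<le> t\<^sup>2" using y t by (simp add: abs_le_square_iff[symmetric])
      then have "sqrt (R\<^sup>2 - t\<^sup>2) \<le> sqrt (R\<^sup>2 - y\<^sup>2)" by simp
      then show "sqrt (1 + m\<^sup>2 + (cyl_y R m (x, y))\<^sup>2) \<le> G"
        unfolding cyl_slope[OF b R] G_def snd_conv using R t2 by (intro divide_left_mono) auto
    qed
  qed (use R in auto)
qed

text \<open>Two rounds: the vanishing flux at both ends for the large threshold bounds
  \<open>w\<close> from above, and once \<open>w\<close> is bounded, \<open>le_of_bounded\<close>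
  improves the bound to 0.\<close>

lemma cyl_le:
  assumes g: "cmc_graph R v a b" and R: "R > 0"
    and bd: "\<And>x. m * x + k \<le> v (x, R)" "\<And>x. m * x + k \<le> v (x, -R)"
    and y: "\<bar>y\<bar> \<le> R"
  shows "cyl R m k (x, y) \<le> v (x, y)"
proof -
  interpret cmc_pair R "cyl R m k" "\<lambda>z. m" "cyl_y R m" v a b
    by unfold_locales (use R g bd cmc_graph_cyl in \<open>auto simp: cyl_def\<close>)
  have bd': "- m * x + k \<le> v (reflect (x, R))" "- m * x + k \<le> v (reflect (x, - R))" for x
    using bd(1)[of "- x"] bd(2)[of "- x"] by simp_all
  have r: "(\<lambda>z. cyl R m k (reflect z)) = cyl R (- m) k" "(\<lambda>z. cyl_y R m (reflect z)) = cyl_y R (- m)"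
    by (auto simp: fun_eq_iff cyl_def cyl_y_def)
  show ?thesis
  proof (rule le_of_bounded[OF _ y])
    fix x y assume "\<bar>y\<bar> < R"
    then show "w (x, y) \<le> (\<bar>m\<bar> + 1) * (3 * R)"
      using cyl_flux_vanishes[OF g R bd] cyl_flux_vanishes[OF cmc_graph_reflect[OF g] R bd'] R
      by (intro le_eps_of_flux_vanishes) (simp_all add: r)
  qed
qed

subsection \<open>Steep boundary values\<close>

text \<open>Nothing is known about slopes on the sides, so fluxes are continuous only on the open
  interval; their boundedness is all that is left at its ends.\<close>

lemma bounded_continuous_integrable:
  fixes h :: "real \<Rightarrow> real"
  assumes c: "continuous_on {-R<..<R} h" and B: "\<And>y. \<bar>y\<bar> \<le> R \<Longrightarrow> \<bar>h y\<bar> \<le> B"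
  shows "h integrable_on {-R..R}"
proof -
  have "h integrable_on {-R<..<R}"
  proof (rule measurable_bounded_by_integrable_imp_integrable)
    show "h \<in> borel_measurable (lebesgue_on {-R<..<R})"
      using c by (intro continuous_imp_measurable_on_sets_lebesgue) auto
    show "(\<lambda>_. B) integrable_on {-R<..<R}" 
      unfolding integrable_on_Icc_iff_Ioo[symmetric] by (intro integrable_continuous_real continuous_intros)
  qed (use B in \<open>auto simp: abs_le_iff\<close>)
  then show ?thesis by (simp add: integrable_on_Icc_iff_Ioo)
qed

lemma integral_core_diff_le:
  fixes h :: "real \<Rightarrow> real"
  assumes c: "continuous_on {-R<..<R} h" and B: "\<And>y. \<bar>y\<bar> \<le> R \<Longrightarrow> \<bar>h y\<bar> \<le> B" and t: "0 \<le> t" "t \<le> R"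
  shows "\<bar>integral {-R..R} h - integral {-t..t} h\<bar> \<le> 2 * B * (R - t)"
proof -
  have i: "h integrable_on {l..r}" if "-R \<le> l" "r \<le> R" for l r
    by (rule integrable_on_subinterval[OF bounded_continuous_integrable[OF c B]]) (use that in auto)
  have "integral {-R..R} h = integral {-R..t} h + integral {t..R} h"
    using t i by (intro Henstock_Kurzweil_Integration.integral_combine[symmetric]) auto
  also have "integral {-R..t} h = integral {-R..-t} h + integral {-t..t} h"
    using t i by (intro Henstock_Kurzweil_Integration.integral_combine[symmetric]) auto
  finally have "integral {-R..R} h - integral {-t..t} h = integral {-R..-t} h + integral {t..R} h" by simp
  moreover have "norm (integral {-R..-t} h) \<le> integral {-R..-t} (\<lambda>_. B)"
    using t i B by (intro integral_norm_bound_integral) (auto simp: abs_le_iff)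
  moreover have "norm (integral {t..R} h) \<le> integral {t..R} (\<lambda>_. B)"
    using t i B by (intro integral_norm_bound_integral) (auto simp: abs_le_iff)
  ultimately show ?thesis using t by (simp add: algebra_simps)
qed

lemma integral_abs_le_bound:
  fixes h :: "real \<Rightarrow> real"
  assumes "continuous_on {-t..t} h" "\<And>y. \<bar>y\<bar> \<le> t \<Longrightarrow> \<bar>h y\<bar> \<le> B" "0 \<le> t"
  shows "\<bar>integral {-t..t} h\<bar> \<le> 2 * t * B"
proof -
  have "norm (integral {-t..t} h) \<le> integral {-t..t} (\<lambda>_. B)"
    using assms by (intro integral_norm_bound_integral integrable_continuous_real) (auto simp: abs_le_iff)
  then show ?thesis using assms by simp
qed

lemma cont_open_band:
  assumes "continuous_on (band R) g"
  shows "continuous_on {-R<..<R} (\<lambda>y. g (x, y))"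
  by (intro continuous_on_compose2[OF assms]) (auto intro!: continuous_intros simp: band_def)

text \<open>The cut-off \<open>\<phi> s = s / (l + s)\<close> is chosen for \<open>(1 - \<phi>)\<^sup>2 = l * \<phi>'\<close>: this bounds
  the flux missed by the cut-off by the derivative of the monotone bounded flux \<open>A\<close>.\<close>

lemma flux_le_of_le_cyl:
  assumes g: "cmc_graph R v a b" and R: "R > 0" and \<kappa>: "\<kappa> > 0"
    and le: "\<And>x y. \<bar>y\<bar> \<le> R \<Longrightarrow> cyl R m k (x, y) \<le> v (x, y)"
  shows "\<exists>x\<ge>N. integral {-R..R} (\<lambda>y. flux m (cyl_y R m (x, y)) - flux (a (x, y)) (b (x, y))) \<le> \<kappa>"
proof (rule ccontr)
  assume "\<not> ?thesis"
  then have gt: "integral {-R..R} (\<lambda>y. flux m (cyl_y R m (x, y)) - flux (a (x, y)) (b (x, y))) > \<kappa>"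
    if "x \<ge> N" for x using that by force
  have gc: "cmc_graph R (cyl R m k) (\<lambda>z. m) (cyl_y R m)" by (rule cmc_graph_cyl[OF R])
  define w where "w z = v z - cyl R m k z" for z
  define D1 where "D1 z = flux (a z) (b z) - flux m (cyl_y R m z)" for z
  define D2 where "D2 z = flux (b z) (a z) - flux (cyl_y R m z) m" for z
  define mo where "mo z = slope_mono (a z) (b z) m (cyl_y R m z)" for z
  have w0: "w z \<ge> 0" if "z \<in> UNIV \<times> {-R..R}" for z
    using le[of "snd z" "fst z"] that by (auto simp: w_def abs_le_iff mem_Times_iff)
  have w0b: "w z \<ge> 0" if "z \<in> band R" for z using that by (intro w0) (auto simp: band_def)
  note cont = cmc_graph_continuous(2-4)[OF g] cmc_graph_continuous(2-4)[OF gc]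
  have cw: "continuous_on (band R) w" unfolding w_def by (intro continuous_intros cont)
  have cD1: "continuous_on (band R) D1" unfolding D1_def by (intro continuous_intros cont)
  have cmo: "continuous_on (band R) mo" unfolding mo_def by (intro continuous_intros cont)
  have D1b: "\<bar>D1 z\<bar> \<le> 2" for z unfolding D1_def by (rule flux_diff_abs_le)
  have mo: "(D1 z)\<^sup>2 \<le> mo z" "0 \<le> mo z" for z
    unfolding D1_def mo_def by (rule slope_mono_ge_flux_diff1, rule slope_mono_nonneg)
  obtain Wm where Wm: "Wm \<ge> 0" "\<And>y. \<bar>y\<bar> \<le> R \<Longrightarrow> w (N, y) \<le> Wm"
  proof -
    have "continuous_on {-R..R} (\<lambda>y. w (N, y))" unfolding w_def
      by (intro continuous_intros continuous_on_compose2[OF cmc_graph_continuous(1)[OF g]]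
          continuous_on_compose2[OF cmc_graph_continuous(1)[OF gc]]) auto
    then obtain ym where "ym \<in> {-R..R}" "\<And>y. y \<in> {-R..R} \<Longrightarrow> w (N, y) \<le> w (N, ym)"
      using continuous_attains_sup[of "{-R..R}" "\<lambda>y. w (N, y)"] R by force
    then show ?thesis using that[of "w (N, ym)"] w0[of "(N, ym)"] by (auto simp: abs_le_iff)
  qed
  \<comment> \<open>Large enough that at \<open>x = N\<close> the cut-off, which is at most
    \<open>Wm / l\<close>, gives \<open>\<bar>A N\<bar> \<le> \<kappa> / 8\<close>.\<close>
  define l where "l = 32 * R * (Wm + 1) / \<kappa>"
  have l: "l > 0" using R \<kappa> Wm by (simp add: l_def)
  define \<phi> where "\<phi> s = s / (l + s)" for s
  define \<phi>' where "\<phi>' s = l / (l + s)\<^sup>2" for s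
  have \<phi>b: "0 \<le> \<phi> s" "\<phi> s \<le> 1" "\<phi> s \<le> s / l" "(1 - \<phi> s)\<^sup>2 = l * \<phi>' s" "0 \<le> \<phi>' s" if "s \<ge> 0" for s
  proof -
    show "0 \<le> \<phi> s" "\<phi> s \<le> 1" "0 \<le> \<phi>' s" using that l by (auto simp: \<phi>_def \<phi>'_def)
    show "\<phi> s \<le> s / l" unfolding \<phi>_def using that l by (intro divide_left_mono) auto
    have "1 - \<phi> s = l / (l + s)" using that l by (simp add: \<phi>_def field_simps)
    then show "(1 - \<phi> s)\<^sup>2 = l * \<phi>' s" by (simp add: \<phi>'_def power_divide power2_eq_square)
  qed
  have d\<phi>: "(\<phi> has_real_derivative \<phi>' s) (at s)" if "s \<ge> 0" for s
    unfolding \<phi>_def \<phi>'_def using that l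
    by (auto intro!: derivative_eq_intros simp: power2_eq_square)
  have c\<phi>: "continuous_on (band R) (\<lambda>z. \<phi> (w z))" "continuous_on (band R) (\<lambda>z. \<phi>' (w z))"
    unfolding \<phi>_def \<phi>'_def using l w0b by (auto intro!: continuous_intros cw simp: add_pos_nonneg less_imp_neq[symmetric])
  \<comment> \<open>\<open>\<beta>\<close> will bound \<open>I\<close> from below on a window of
    length \<open>n\<close>. Half of it survives the side terms, and
    \<open>n * (\<beta> / 2)\<close> exceeds \<open>8 * R\<close>, the largest possible change of
    \<open>A\<close>.\<close>
  define \<beta> where "\<beta> = \<kappa>\<^sup>2 / (8 * R * l)"
  have \<beta>: "\<beta> > 0" using \<kappa> R l by (simp add: \<beta>_def)
  define n where "n = 16 * R / \<beta> + 1"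
  have n: "n > 0" using R \<beta> by (simp add: n_def add_pos_pos)
  \<comment> \<open>In this order the entries give \<open>t \<ge> 0\<close>, an error of at most
    \<open>\<kappa> / 4\<close> from beyond \<open>t\<close>, a loss of at most
    \<open>\<kappa> / 8\<close> through the sides over the window, and side terms of at most
    \<open>\<beta> / 2\<close>.\<close>
  define \<delta> where "\<delta> = Min {1 / 2, \<kappa> / (16 * R), \<kappa> / (16 * n), \<beta> / 4}"
  have \<delta>0: "\<delta> > 0" using \<kappa> R n \<beta> by (simp add: \<delta>_def)
  have \<delta>: "\<delta> \<le> 1 / 2" "\<delta> \<le> \<kappa> / (16 * R)" "\<delta> \<le> \<kappa> / (16 * n)" "\<delta> \<le> \<beta> / 4"
    unfolding \<delta>_def by (rule Min_le; simp)+
  define t where "t = R * (1 - \<delta>)"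
  have t: "0 \<le> t" "t < R" "t / R = 1 - \<delta>" "4 * (R - t) \<le> \<kappa> / 4"
    using R \<delta>0 \<delta>(1,2) by (auto simp: t_def field_simps)
  define I where "I x = integral {-t..t} (\<lambda>y. \<phi>' (w (x, y)) * mo (x, y))" for x
  define A where "A x = integral {-t..t} (\<lambda>y. \<phi> (w (x, y)) * D1 (x, y))" for x
  define E where "E x = \<phi> (w (x, t)) * D2 (x, t) - \<phi> (w (x, -t)) * D2 (x, -t)" for x
  note seg = cont_seg_band[OF _ t(2)]
  have wp: "w (x, y) \<ge> 0" if "\<bar>y\<bar> \<le> t" for x y using w0b[of "(x, y)"] that t by (simp add: mem_band)
  have DA: "(A has_real_derivative I x - E x) (at x)" for x
    unfolding A_def I_def E_def D1_def D2_def mo_def w_def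
  proof (rule cmc_graph_pair_flux[OF g gc t(1,2)])
    show "(\<phi> has_real_derivative \<phi>' (v z - cyl R m k z)) (at (v z - cyl R m k z))" if "z \<in> band R" for z
      using d\<phi>[OF w0b[OF that]] by (simp add: w_def)
    show "continuous_on (band R) (\<lambda>z. \<phi>' (v z - cyl R m k z))" using c\<phi>(2) by (simp add: w_def)
  qed
  \<comment> \<open>At \<open>y = \<plusminus>t\<close> the second flux component of the cylinder is
    \<open>1 - \<delta>\<close> in outward direction, and that of \<open>v\<close> is at most 1, so
    the excess is at most \<open>\<delta>\<close> on each side. Here it matters that cylinder and
    strip have the same width.\<close>
  have E: "E x \<le> 2 * \<delta>" for x
  proof -
    have b: "(x, t) \<in> band R" "(x, -t) \<in> band R" using t by (auto simp: mem_band)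
    have "D2 (x, t) \<le> \<delta>" "- \<delta> \<le> D2 (x, -t)"
      unfolding D2_def flux_cyl(2)[OF b(1) R] flux_cyl(2)[OF b(2) R]
      using flux_abs_le[of "b (x, t)" "a (x, t)"] flux_abs_le[of "b (x, -t)" "a (x, -t)"] t(3) by auto
    moreover have "\<phi> (w (x, t)) * D2 (x, t) \<le> \<delta>" if "D2 (x, t) \<le> \<delta>"
      using mult_mono[of "\<phi> (w (x, t))" 1 "max 0 (D2 (x, t))" \<delta>] that \<delta>0 \<phi>b(1,2)[OF wp[of t x]] t(1)
        mult_left_mono[of "D2 (x, t)" "max 0 (D2 (x, t))" "\<phi> (w (x, t))"] by fastforce
    moreover have "\<phi> (w (x, -t)) * (- D2 (x, -t)) \<le> \<delta>" if "- D2 (x, -t) \<le> \<delta>"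
      using mult_mono[of "\<phi> (w (x, -t))" 1 "max 0 (- D2 (x, -t))" \<delta>] that \<delta>0 \<phi>b(1,2)[OF wp[of "-t" x]] t(1)
        mult_left_mono[of "- D2 (x, -t)" "max 0 (- D2 (x, -t))" "\<phi> (w (x, -t))"] by fastforce
    ultimately show ?thesis by (simp add: E_def)
  qed
  have I0: "I x \<ge> 0" for x
    unfolding I_def using t wp \<phi>b(5) mo(2)
    by (intro integral_nonneg integrable_continuous_real continuous_intros seg c\<phi> cmo)
       (auto intro!: mult_nonneg_nonneg)
  have Aabs: "\<bar>A x\<bar> \<le> 4 * R" for x
  proof -
    have "\<bar>A x\<bar> \<le> 2 * t * 2" unfolding A_def
    proof (rule integral_abs_le_bound)
      show "\<bar>\<phi> (w (x, y)) * D1 (x, y)\<bar> \<le> 2" if "\<bar>y\<bar> \<le> t" for y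
        using mult_mono[of "\<phi> (w (x, y))" 1 "\<bar>D1 (x, y)\<bar>" 2] \<phi>b(1,2)[OF wp[OF that, of x]] D1b[of "(x, y)"]
        by (simp add: abs_mult)
    qed (intro continuous_intros seg c\<phi> cD1 t)+
    then show ?thesis using t by linarith
  qed
  have AN: "A N \<ge> - \<kappa> / 8"
  proof -
    have "\<bar>A N\<bar> \<le> 2 * t * (Wm / l * 2)" unfolding A_def
    proof (rule integral_abs_le_bound)
      show "\<bar>\<phi> (w (N, y)) * D1 (N, y)\<bar> \<le> Wm / l * 2" if y: "\<bar>y\<bar> \<le> t" for y
      proof -
        have "\<phi> (w (N, y)) \<le> w (N, y) / l" by (rule \<phi>b(3)[OF wp[OF y]])
        also have "\<dots> \<le> Wm / l" using l Wm(2)[of y] y t by (intro divide_right_mono) auto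
        finally show ?thesis using mult_mono[of "\<phi> (w (N, y))" "Wm / l" "\<bar>D1 (N, y)\<bar>" 2]
          \<phi>b(1)[OF wp[OF y, of N]] D1b[of "(N, y)"] Wm(1) l by (simp add: abs_mult)
      qed
    qed (intro continuous_intros seg c\<phi> cD1 t)+
    also have "\<dots> \<le> 2 * R * (Wm / l * 2)" using t Wm(1) l by (intro mult_right_mono) auto
    also have "\<dots> \<le> \<kappa> / 8" using R \<kappa> Wm(1) by (simp add: l_def divide_simps)
    finally show ?thesis by linarith
  qed
  \<comment> \<open>As \<open>I\<close> is nonnegative, \<open>A\<close> can fall only through the
    side terms.\<close>
  have low: "A x \<ge> - \<kappa> / 4" if x: "N \<le> x" "x \<le> N + n" for x
  proof (cases "x = N")
    case False
    then obtain z where "A x - A N = (x - N) * (I z - E z)"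
      using MVT2[of N x A "\<lambda>x. I x - E x"] DA x by auto
    moreover have "(x - N) * (I z - E z) \<ge> (x - N) * (- (2 * \<delta>))"
      using x I0[of z] E[of z] by (intro mult_left_mono) auto
    moreover have "(x - N) * (2 * \<delta>) \<le> n * (2 * (\<kappa> / (16 * n)))"
      using x \<delta>(3) \<delta>0 n by (intro mult_mono) auto
    moreover have "n * (2 * (\<kappa> / (16 * n))) = \<kappa> / 8" using n by simp
    ultimately show ?thesis using AN by simp
  qed (use AN \<kappa> in simp)
  \<comment> \<open>Under the contrary assumption the flux missing on \<open>{-t..t}\<close> is at
    least \<open>3 * \<kappa> / 4\<close>. The cut-off accounts for at most
    \<open>\<kappa> / 4\<close> of it, so weighted by \<open>1 - \<phi>\<close> it is still
    \<open>\<kappa> / 2\<close>, and Young's inequality turns this into a lower bound for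
    \<open>I\<close>.\<close>
  have large: "I x \<ge> \<beta>" if x: "N \<le> x" "x \<le> N + n" for x
  proof -
    define c where "c = \<kappa> / (8 * R)"
    have c: "c > 0" using \<kappa> R by (simp add: c_def)
    have "\<bar>integral {-R..R} (\<lambda>y. - D1 (x, y)) - integral {-t..t} (\<lambda>y. - D1 (x, y))\<bar> \<le> 2 * 2 * (R - t)"
      using t D1b by (intro integral_core_diff_le continuous_intros cont_open_band cD1) auto
    moreover have "integral {-R..R} (\<lambda>y. - D1 (x, y)) > \<kappa>" using gt[OF x(1)] by (simp add: D1_def)
    ultimately have S: "integral {-t..t} (\<lambda>y. - D1 (x, y)) \<ge> 3 * \<kappa> / 4" using t(4) by linarith
    have "integral {-t..t} (\<lambda>y. - D1 (x, y)) + A x = integral {-t..t} (\<lambda>y. - D1 (x, y) + \<phi> (w (x, y)) * D1 (x, y))"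
      unfolding A_def by (intro integral_add[symmetric] integrable_continuous_real continuous_intros seg c\<phi> cD1)
    also have "\<dots> \<le> integral {-t..t} (\<lambda>y. c + l / (4 * c) * (\<phi>' (w (x, y)) * mo (x, y)))"
    proof (rule integral_le)
      fix y assume "y \<in> {-t..t}"
      then have y: "\<bar>y\<bar> \<le> t" by auto
      define s where "s = (1 - \<phi> (w (x, y))) * (- D1 (x, y))"
      have "s\<^sup>2 \<le> l * \<phi>' (w (x, y)) * mo (x, y)"
        unfolding s_def power_mult_distrib \<phi>b(4)[OF wp[OF y]]
        using l \<phi>b(5)[OF wp[OF y]] mo by (intro mult_left_mono) auto
      moreover have "s \<le> c + s\<^sup>2 / (4 * c)"
      proof -
        have "4 * c * s \<le> 4 * c * c + s\<^sup>2"
          using zero_le_power2[of "s - 2 * c"] by (simp add: power2_eq_square algebra_simps)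
        then show ?thesis using c by (simp add: field_simps)
      qed
      ultimately have "s \<le> c + l * \<phi>' (w (x, y)) * mo (x, y) / (4 * c)"
        using c divide_right_mono[of "s\<^sup>2" "l * \<phi>' (w (x, y)) * mo (x, y)" "4 * c"] by linarith
      then show "- D1 (x, y) + \<phi> (w (x, y)) * D1 (x, y) \<le> c + l / (4 * c) * (\<phi>' (w (x, y)) * mo (x, y))"
        by (simp add: s_def algebra_simps)
    qed (intro integrable_continuous_real continuous_intros seg c\<phi> cD1 cmo)+
    also have "\<dots> = 2 * t * c + l / (4 * c) * I x"
      unfolding I_def using t
      by (subst integral_add)
         (auto intro!: integrable_continuous_real continuous_intros seg c\<phi> cmo integrable_on_mult_right simp del: times_divide_eq_left)
    also have "2 * t * c \<le> 2 * R * c" using t c by simp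
    also have "2 * R * c = \<kappa> / 4" using R by (simp add: c_def)
    finally have "\<kappa> / 4 \<le> l / (4 * c) * I x" using S low[OF x] by linarith
    then have "\<kappa> / 4 * (4 * c / l) \<le> I x" using c l by (simp add: field_simps)
    also have "\<kappa> / 4 * (4 * c / l) = \<beta>" by (simp add: c_def \<beta>_def power2_eq_square)
    finally show ?thesis .
  qed
  obtain z where z: "N < z" "z < N + n" "A (N + n) - A N = (N + n - N) * (I z - E z)"
    using MVT2[of N "N + n" A "\<lambda>x. I x - E x"] DA n by auto
  have "\<beta> / 2 \<le> I z - E z" using large[of z] z E[of z] \<delta>(4) by simp
  then have "n * (\<beta> / 2) \<le> A (N + n) - A N" using z(3) n by simp
  moreover have "n * (\<beta> / 2) > 8 * R" using \<beta> by (simp add: n_def field_simps)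
  ultimately show False using Aabs[of "N + n"] Aabs[of N] by linarith
qed

text \<open>The field \<open>X = (sqrt (R\<^sup>2 - y\<^sup>2) / R, y / R)\<close> is the limit of the fluxes of the cylinders as
  their slope tends to infinity. It has unit length and divergence \<open>1 / R\<close>.\<close>

definition deficit where
  "deficit R p q x = integral {-R..R} (\<lambda>y. sqrt (R\<^sup>2 - y\<^sup>2) / R - flux (p (x, y)) (q (x, y)))"
  for R :: real and p q :: "real \<times> real \<Rightarrow> real"

lemma root_over_bounds:
  fixes R y :: real
  assumes "R > 0" "\<bar>y\<bar> \<le> R"
  shows "0 \<le> sqrt (R\<^sup>2 - y\<^sup>2)" "sqrt (R\<^sup>2 - y\<^sup>2) \<le> R"
    "0 \<le> sqrt (R\<^sup>2 - y\<^sup>2) / R" "sqrt (R\<^sup>2 - y\<^sup>2) / R \<le> 1"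
    "(sqrt (R\<^sup>2 - y\<^sup>2) / R)\<^sup>2 + (y / R)\<^sup>2 = 1"
proof -
  have le: "y\<^sup>2 \<le> R\<^sup>2" using assms by (simp add: abs_le_square_iff[symmetric])
  then show "0 \<le> sqrt (R\<^sup>2 - y\<^sup>2)" by simp
  show "sqrt (R\<^sup>2 - y\<^sup>2) \<le> R" using assms by (intro real_le_lsqrt) auto
  then show "sqrt (R\<^sup>2 - y\<^sup>2) / R \<le> 1" "0 \<le> sqrt (R\<^sup>2 - y\<^sup>2) / R" using assms le by auto
  show "(sqrt (R\<^sup>2 - y\<^sup>2) / R)\<^sup>2 + (y / R)\<^sup>2 = 1"
    using assms le by (simp add: power_divide add_divide_distrib[symmetric])
qed

lemma continuous_deficit:
  assumes "cmc_graph R u p q"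
  shows "continuous_on (band R) (\<lambda>z. sqrt (R\<^sup>2 - (snd z)\<^sup>2) / R - flux (p z) (q z))"
proof (cases "R = 0")
  case False
  then show ?thesis using cmc_graph_continuous[OF assms] by (intro continuous_intros) auto
qed (simp add: band_def)

lemma deficit_core_diff:
  assumes g: "cmc_graph R u p q" and R: "R > 0" and t: "0 \<le> t" "t < R"
  shows "\<bar>deficit R p q x - integral {-t..t} (\<lambda>y. sqrt (R\<^sup>2 - y\<^sup>2) / R - flux (p (x, y)) (q (x, y)))\<bar> \<le> 4 * (R - t)"
proof -
  have "\<bar>deficit R p q x - integral {-t..t} (\<lambda>y. sqrt (R\<^sup>2 - y\<^sup>2) / R - flux (p (x, y)) (q (x, y)))\<bar>
      \<le> 2 * 2 * (R - t)"
    unfolding deficit_def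
  proof (rule integral_core_diff_le)
    show "continuous_on {-R<..<R} (\<lambda>y. sqrt (R\<^sup>2 - y\<^sup>2) / R - flux (p (x, y)) (q (x, y)))"
      using cont_open_band[OF continuous_deficit[OF g], of x] by simp
    show "\<bar>sqrt (R\<^sup>2 - y\<^sup>2) / R - flux (p (x, y)) (q (x, y))\<bar> \<le> 2" if "\<bar>y\<bar> \<le> R" for y
      using root_over_bounds(3,4)[OF R that] flux_abs_le[of "p (x, y)" "q (x, y)"] by linarith
  qed (use t in auto)
  then show ?thesis by simp
qed

text \<open>\<open>X\<close> and \<open>T u\<close> both have divergence \<open>1 / R\<close>, so
  without a weight only the side terms remain. The weight
  \<open>sqrt (R\<^sup>2 - y\<^sup>2)\<close> contributes its own derivative times the second
  component of \<open>X - T u\<close>.\<close>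

lemma deficit_core_deriv:
  assumes g: "cmc_graph R u p q" and R: "R > 0" and t: "0 \<le> t" "t < R"
  shows "((\<lambda>x. integral {-t..t} (\<lambda>y. sqrt (R\<^sup>2 - y\<^sup>2) / R - flux (p (x, y)) (q (x, y)))) has_real_derivative
    - ((t / R - flux (q (x, t)) (p (x, t))) - (- t / R - flux (q (x, -t)) (p (x, -t))))) (at x)"
    and "((\<lambda>x. integral {-t..t} (\<lambda>y. sqrt (R\<^sup>2 - y\<^sup>2) * (sqrt (R\<^sup>2 - y\<^sup>2) / R - flux (p (x, y)) (q (x, y))))) has_real_derivative
    integral {-t..t} (\<lambda>y. - (y / sqrt (R\<^sup>2 - y\<^sup>2)) * (y / R - flux (q (x, y)) (p (x, y))))
    - sqrt (R\<^sup>2 - t\<^sup>2) * ((t / R - flux (q (x, t)) (p (x, t))) - (- t / R - flux (q (x, -t)) (p (x, -t))))) (at x)"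
proof -
  obtain Fx Gy where F: "continuous_on (band R) Fx" "continuous_on (band R) Gy"
    "\<And>x y. \<bar>y\<bar> < R \<Longrightarrow> ((\<lambda>x. flux (p (x, y)) (q (x, y))) has_real_derivative Fx (x, y)) (at x)"
    "\<And>x y. \<bar>y\<bar> < R \<Longrightarrow> ((\<lambda>y. flux (q (x, y)) (p (x, y))) has_real_derivative Gy (x, y)) (at y)"
    "\<And>z. z \<in> band R \<Longrightarrow> Fx z + Gy z = 1 / R"
    using cmc_graph_flux[OF g] by blast
  have sub: "UNIV \<times> {-t..t} \<subseteq> band R" using t by (auto simp: band_def)
  note cF = continuous_on_subset[OF F(1) sub] continuous_on_subset[OF F(2) sub]
  note pq = cmc_graph_continuous(3,4)[OF g, THEN continuous_on_subset, OF sub]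
  have cd: "continuous_on {-t..t} (\<lambda>y. sqrt (R\<^sup>2 - y\<^sup>2) / R - flux (p (x, y)) (q (x, y)))" for x
    using cont_seg_band[OF continuous_deficit[OF g] t(2), of x] by simp
  have y: "\<bar>y\<bar> < R" if "\<bar>y\<bar> \<le> t" for y using that t by simp
  have rp: "R\<^sup>2 - y\<^sup>2 > 0" if "\<bar>y\<bar> \<le> t" for y
    using band_root_pos[of "(0, y)" R] y[OF that] by (simp add: mem_band)
  have eq: "Gy (x, y) = 1 / R - Fx (x, y)" if "y \<in> {-t..t}" for x y
    using F(5)[of "(x, y)"] that sub by force
  have "((\<lambda>x. integral {-t..t} (\<lambda>y. sqrt (R\<^sup>2 - y\<^sup>2) / R - flux (p (x, y)) (q (x, y)))) has_real_derivative
    integral {-t..t} (\<lambda>y. (0 - Fx (x, y)) + (1 / R - Gy (x, y)))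
    - ((t / R - flux (q (x, t)) (p (x, t))) - (- t / R - flux (q (x, -t)) (p (x, -t))))) (at x)"
  proof (rule div_strip[OF t(1) _ _ cd])
    show "((\<lambda>x. sqrt (R\<^sup>2 - y\<^sup>2) / R - flux (p (x, y)) (q (x, y))) has_real_derivative 0 - Fx (x, y)) (at x)"
      if "\<bar>y\<bar> \<le> t" for x y
      by (intro DERIV_diff DERIV_const F(3) y that)
    show "((\<lambda>y. y / R - flux (q (x, y)) (p (x, y))) has_real_derivative 1 / R - Gy (x, y)) (at y)"
      if "\<bar>y\<bar> \<le> t" for x y
      by (intro DERIV_diff F(4) y that) (use R in \<open>auto intro!: derivative_eq_intros\<close>)
  qed (use cF in \<open>auto simp: case_prod_unfold intro!: continuous_intros\<close>)
  also have "integral {-t..t} (\<lambda>y. (0 - Fx (x, y)) + (1 / R - Gy (x, y))) = integral {-t..t} (\<lambda>y. 0)"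
    by (rule integral_cong) (simp add: eq)
  finally show "((\<lambda>x. integral {-t..t} (\<lambda>y. sqrt (R\<^sup>2 - y\<^sup>2) / R - flux (p (x, y)) (q (x, y)))) has_real_derivative
    - ((t / R - flux (q (x, t)) (p (x, t))) - (- t / R - flux (q (x, -t)) (p (x, -t))))) (at x)" by simp
  define s where "s y = sqrt (R\<^sup>2 - y\<^sup>2)" for y
  have ds: "(s has_real_derivative - (y / s y)) (at y)" if "\<bar>y\<bar> \<le> t" for y
    unfolding s_def using rp[OF that] by (auto intro!: derivative_eq_intros simp: field_simps)
  have cs: "continuous_on S s" for S unfolding s_def by (intro continuous_intros)
  define Gd where "Gd x y = - (y / s y) * (y / R - flux (q (x, y)) (p (x, y))) + s y * (1 / R - Gy (x, y))" for x y
  have "((\<lambda>x. integral {-t..t} (\<lambda>y. s y * (s y / R - flux (p (x, y)) (q (x, y))))) has_real_derivative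
    integral {-t..t} (\<lambda>y. s y * (0 - Fx (x, y)) + Gd x y)
    - (s t * (t / R - flux (q (x, t)) (p (x, t))) - s (-t) * (- t / R - flux (q (x, -t)) (p (x, -t))))) (at x)"
  proof (rule div_strip[OF t(1)])
    show "((\<lambda>x. s y * (s y / R - flux (p (x, y)) (q (x, y)))) has_real_derivative s y * (0 - Fx (x, y))) (at x)"
      if "\<bar>y\<bar> \<le> t" for x y
      by (intro DERIV_cmult DERIV_diff DERIV_const F(3) y that)
    have dy: "((\<lambda>y. y / R - flux (q (x, y)) (p (x, y))) has_real_derivative 1 / R - Gy (x, y)) (at y)"
      if "\<bar>y\<bar> \<le> t" for x y
      by (intro DERIV_diff F(4) y that) (use R in \<open>auto intro!: derivative_eq_intros\<close>)
    show "((\<lambda>y. s y * (y / R - flux (q (x, y)) (p (x, y)))) has_real_derivative Gd x y) (at y)"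
      if "\<bar>y\<bar> \<le> t" for x y
      using DERIV_mult[OF ds[OF that] dy[OF that, of x]] by (simp add: Gd_def algebra_simps)
    show "continuous_on {-t..t} (\<lambda>y. s y * (s y / R - flux (p (x, y)) (q (x, y))))" for x
      using continuous_on_mult[OF cs[of "{-t..t}"] cd[of x]] by (simp add: s_def)
    show "continuous_on (UNIV \<times> {- t..t}) (\<lambda>(x, y). s y * (0 - Fx (x, y)))"
      using cF by (auto simp: case_prod_unfold s_def intro!: continuous_intros)
    show "continuous_on (UNIV \<times> {- t..t}) (\<lambda>(x, y). Gd x y)"
      using cF pq R rp by (auto simp: case_prod_unfold Gd_def s_def abs_le_iff intro!: continuous_intros) force
  qed
  also have "integral {-t..t} (\<lambda>y. s y * (0 - Fx (x, y)) + Gd x y)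
      = integral {-t..t} (\<lambda>y. - (y / s y) * (y / R - flux (q (x, y)) (p (x, y))))"
    by (rule integral_cong) (simp add: eq Gd_def algebra_simps)
  also have "s t * (t / R - flux (q (x, t)) (p (x, t))) - s (-t) * (- t / R - flux (q (x, -t)) (p (x, -t)))
      = s t * ((t / R - flux (q (x, t)) (p (x, t))) - (- t / R - flux (q (x, -t)) (p (x, -t))))"
    by (simp add: s_def algebra_simps)
  finally show "((\<lambda>x. integral {-t..t} (\<lambda>y. sqrt (R\<^sup>2 - y\<^sup>2) * (sqrt (R\<^sup>2 - y\<^sup>2) / R - flux (p (x, y)) (q (x, y))))) has_real_derivative
    integral {-t..t} (\<lambda>y. - (y / sqrt (R\<^sup>2 - y\<^sup>2)) * (y / R - flux (q (x, y)) (p (x, y))))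
    - sqrt (R\<^sup>2 - t\<^sup>2) * ((t / R - flux (q (x, t)) (p (x, t))) - (- t / R - flux (q (x, -t)) (p (x, -t))))) (at x)"
    unfolding s_def .
qed

text \<open>On the sides \<open>X\<close> is the outward unit normal, which no flux can exceed, so
  \<open>X - T u\<close> only leaves the strip there. The integrals over \<open>{-t..t}\<close> show
  this up to an error that vanishes as \<open>t\<close> tends to \<open>R\<close>.\<close>

lemma deficit_antimono:
  assumes g: "cmc_graph R u p q" and R: "R > 0" and x: "x1 \<le> x2"
  shows "deficit R p q x2 \<le> deficit R p q x1"
proof (rule field_le_epsilon)
  fix e :: real assume e: "e > 0"
  \<comment> \<open>The error is \<open>2 * \<delta>\<close> per unit length through the sides and
    \<open>4 * R * \<delta>\<close> for each of two truncated integrals.\<close>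
  define C where "C = 2 * (x2 - x1) + 8 * R"
  have C: "C > 0" using x R by (simp add: C_def add_nonneg_pos)
  define \<delta> where "\<delta> = min 1 (e / C)"
  have \<delta>: "0 < \<delta>" "\<delta> \<le> 1" "C * \<delta> \<le> e" using C e by (auto simp: \<delta>_def min_def field_simps)
  define t where "t = R * (1 - \<delta>)"
  have t: "0 \<le> t" "t < R" "t / R = 1 - \<delta>" "R - t = R * \<delta>"
  proof -
    show "t / R = 1 - \<delta>" "0 \<le> t" using \<delta> R by (simp_all add: t_def)
    show "R - t = R * \<delta>" by (simp add: t_def algebra_simps)
    then show "t < R" using \<delta> R by (metis diff_gt_0_iff_gt mult_pos_pos)
  qed
  define S where "S x = integral {-t..t} (\<lambda>y. sqrt (R\<^sup>2 - y\<^sup>2) / R - flux (p (x, y)) (q (x, y)))" for x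
  have "S x2 - S x1 \<le> 2 * \<delta> * (x2 - x1)"
  proof (cases "x1 = x2")
    case False
    define S' where "S' x = - ((t / R - flux (q (x, t)) (p (x, t))) - (- t / R - flux (q (x, -t)) (p (x, -t))))" for x
    have "S' x \<le> 2 * \<delta>" for x
      using flux_abs_le[of "q (x, t)" "p (x, t)"] flux_abs_le[of "q (x, -t)" "p (x, -t)"] t(3)
      by (simp add: S'_def)
    moreover obtain z where "S x2 - S x1 = (x2 - x1) * S' z"
      using MVT2[of x1 x2 S S'] deficit_core_deriv(1)[OF g R t(1,2)] x False by (auto simp: S_def[abs_def] S'_def)
    ultimately show ?thesis using x mult_left_mono[of "S' z" "2 * \<delta>" "x2 - x1"] by (simp add: mult.commute)
  qed simp
  moreover have "\<bar>deficit R p q x - S x\<bar> \<le> 4 * (R * \<delta>)" for x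
    using deficit_core_diff[OF g R t(1,2), of x] t(4) by (simp add: S_def)
  from this[of x1] this[of x2] have "deficit R p q x2 - S x2 \<le> 4 * (R * \<delta>)" "S x1 - deficit R p q x1 \<le> 4 * (R * \<delta>)"
    by linarith+
  moreover have "C * \<delta> = 2 * \<delta> * (x2 - x1) + 8 * (R * \<delta>)" by (simp add: C_def algebra_simps)
  ultimately show "deficit R p q x2 \<le> deficit R p q x1 + e" using \<delta>(3) by linarith
qed

context cmc_pair
begin

text \<open>Testing \<open>X - T\<close> with the weight \<open>sqrt (R\<^sup>2 - y\<^sup>2)\<close>, which vanishes on the sides, bounds the
  mean of \<open>1 - T \<bullet> X\<close> by the deficit, and \<open>\<bar>T - X\<bar>\<^sup>2 \<le> 2 * (1 - T \<bullet> X)\<close>.\<close>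

lemma flux_vanishes_if_deficits_vanish:
  assumes e: "e > 0"
    and du: "\<And>\<kappa>. \<kappa> > 0 \<Longrightarrow> \<exists>N. \<forall>x\<ge>N. deficit R p q x \<le> \<kappa>"
    and dv: "\<And>\<kappa>. \<kappa> > 0 \<Longrightarrow> \<exists>N. \<forall>x\<ge>N. deficit R a b x \<le> \<kappa>"
  shows "flux_vanishes R u p q v a b e"
  unfolding flux_vanishes_def
proof (intro allI impI)
  fix k N :: real assume k: "k > 0"
  \<comment> \<open>The final estimate will be \<open>4 * R * c + Q / (2 * c)\<close>, and these
    choices make both terms \<open>k / 2\<close>.\<close>
  define c where "c = k / (8 * R)"
  have c: "c > 0" using k R by (simp add: c_def)
  define Q where "Q = k * c"
  have Q: "Q > 0" using k c by (simp add: Q_def)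
  obtain N1 N2 where N12: "\<And>x. x \<ge> N1 \<Longrightarrow> deficit R p q x \<le> Q / 8" "\<And>x. x \<ge> N2 \<Longrightarrow> deficit R a b x \<le> Q / 8"
    using du[of "Q / 8"] dv[of "Q / 8"] Q by auto
  define N0 where "N0 = max N (max N1 N2)"
  \<comment> \<open>The two weighted fluxes \<open>B\<close> together change by at most
    \<open>16 * R\<^sup>2\<close>, which is \<open>n * (Q / 4)\<close>.\<close>
  define n where "n = 64 * R\<^sup>2 / Q"
  have n: "n > 0" using R Q by (simp add: n_def)
  obtain t1 where t1: "0 \<le> t1" "t1 < R"
    and out: "\<And>x y. N0 \<le> x \<Longrightarrow> x \<le> N0 + n \<Longrightarrow> t1 \<le> \<bar>y\<bar> \<Longrightarrow> \<bar>y\<bar> \<le> R \<Longrightarrow> w (x, y) < e"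
    by (rule support[OF e order_refl R, of N0 "N0 + n"]) blast
  \<comment> \<open>The entry \<open>Q / 64\<close> limits the truncation errors; the last one gives
    \<open>s t \<le> Q / 32\<close> for the weight on the lines
    \<open>\<plusminus>t\<close>.\<close>
  define \<delta> where "\<delta> = Min {R - t1, R, Q / 64, Q\<^sup>2 / (2 * R * 32\<^sup>2)}"
  have \<delta>0: "\<delta> > 0" using t1 R Q by (simp add: \<delta>_def)
  have \<delta>: "\<delta> \<le> R - t1" "\<delta> \<le> R" "\<delta> \<le> Q / 64" "\<delta> \<le> Q\<^sup>2 / (2 * R * 32\<^sup>2)"
    unfolding \<delta>_def by (rule Min_le; simp)+
  obtain t where tt: "R - \<delta> \<le> t" "t < R"
    and Aeq: "\<And>x. N0 \<le> x \<Longrightarrow> x \<le> N0 + n \<Longrightarrow> A e x = integral {-t..t} (\<lambda>y. sat e (w (x, y)) * D1 (x, y))"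
    by (rule A_window[OF e _ _, of "R - \<delta>" N0 "N0 + n"]) (use \<delta>0 \<delta>(2) in auto)
  have t: "0 \<le> t" "R - t \<le> \<delta>" using tt \<delta>(2) by auto
  have tR: "\<bar>t\<bar> \<le> R" using t tt by simp
  define s where "s y = sqrt (R\<^sup>2 - y\<^sup>2)" for y
  have rb: "0 \<le> s y" "s y \<le> R" "0 \<le> s y / R" "s y / R \<le> 1" "(s y / R)\<^sup>2 + (y / R)\<^sup>2 = 1" if "\<bar>y\<bar> \<le> R" for y
    unfolding s_def using root_over_bounds[OF R that] by blast+
  have spos: "s y > 0" if "\<bar>y\<bar> \<le> t" for y
    using band_root_pos[of "(0, y)" R] that tt by (simp add: mem_band s_def)
  have st: "8 * s t \<le> Q / 4"
  proof -
    have "R\<^sup>2 - t\<^sup>2 = (R + t) * (R - t)" by (simp add: power2_eq_square algebra_simps)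
    also have "\<dots> \<le> (2 * R) * \<delta>" using t tt R by (intro mult_mono) auto
    also have "\<dots> \<le> (2 * R) * (Q\<^sup>2 / (2 * R * 32\<^sup>2))" using \<delta>(4) R by (intro mult_left_mono) auto
    also have "\<dots> = (Q / 32)\<^sup>2" using R by (simp add: power_divide)
    finally have "s t \<le> Q / 32" unfolding s_def using Q by (intro real_le_lsqrt) auto
    then show ?thesis by simp
  qed
  define X1 where "X1 y = s y / R" for y
  define X2 where "X2 y = y / R" for y
  define T1 where "T1 = (\<lambda>f g (z::real \<times> real). flux (f z :: real) (g z))"
  \<comment> \<open>This is \<open>(R / s) * (1 - T \<bullet> X)\<close>, which dominates
    \<open>1 - T \<bullet> X\<close> as \<open>s \<le> R\<close>. In the form given, the first
    summand integrates to the truncated deficit and the second to the interior part of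
    \<open>- B'\<close>.\<close>
  define E where "E f g z = (X1 (snd z) - T1 f g z) + (snd z / s (snd z)) * (X2 (snd z) - T1 g f z)" for f g z
  have E_ge: "(X1 y - T1 f g (x, y))\<^sup>2 \<le> 2 * E f g (x, y)" if y: "\<bar>y\<bar> \<le> t" for f g x y
  proof -
    let ?a = "T1 f g (x, y)" and ?b = "T1 g f (x, y)"
    have yR: "\<bar>y\<bar> \<le> R" using y tt by simp
    have s: "s y > 0" "s y \<le> R" using spos[OF y] rb(2)[OF yR] by auto
    have one: "(X1 y)\<^sup>2 + (X2 y)\<^sup>2 = 1" using rb(5)[OF yR] by (simp add: X1_def X2_def)
    have "?a\<^sup>2 + ?b\<^sup>2 \<le> 1" unfolding T1_def by (rule flux_norm_le)
    then have half: "(X1 y - ?a)\<^sup>2 + (X2 y - ?b)\<^sup>2 \<le> 2 * (1 - (X1 y * ?a + X2 y * ?b))"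
      using one by (simp add: power2_diff)
    have "0 \<le> 2 * (1 - (X1 y * ?a + X2 y * ?b))" by (rule order_trans[OF _ half]) simp
    then have pos: "0 \<le> 1 - (X1 y * ?a + X2 y * ?b)" by (simp only: zero_le_mult_iff) simp
    have "E f g (x, y) = R / s y * (X1 y * (X1 y - ?a) + X2 y * (X2 y - ?b))"
      using s R by (simp add: E_def X1_def X2_def field_simps)
    also have "X1 y * (X1 y - ?a) + X2 y * (X2 y - ?b) = 1 - (X1 y * ?a + X2 y * ?b)"
      using one by (simp add: power2_eq_square algebra_simps)
    finally have "E f g (x, y) = R / s y * (1 - (X1 y * ?a + X2 y * ?b))" .
    moreover have "1 * (1 - (X1 y * ?a + X2 y * ?b)) \<le> R / s y * (1 - (X1 y * ?a + X2 y * ?b))"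
      using s pos by (intro mult_right_mono) auto
    ultimately have "1 - (X1 y * ?a + X2 y * ?b) \<le> E f g (x, y)" by simp
    then have "2 * (1 - (X1 y * ?a + X2 y * ?b)) \<le> 2 * E f g (x, y)" by simp
    with half have "(X1 y - ?a)\<^sup>2 + (X2 y - ?b)\<^sup>2 \<le> 2 * E f g (x, y)" by (rule order_trans)
    then show ?thesis using zero_le_power2[of "X2 y - ?b"] by linarith
  qed
  define B where "B f g x = integral {-t..t} (\<lambda>y. s y * (X1 y - T1 f g (x, y)))" for f g x
  define B' where "B' f g x = integral {-t..t} (\<lambda>y. - (y / s y) * (X2 y - T1 g f (x, y)))
    - s t * ((t / R - T1 g f (x, t)) - (- t / R - T1 g f (x, -t)))" for f g x
  have DB: "(B f g has_real_derivative B' f g x) (at x)" if "cmc_graph R h f g" for h f g x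
    using deficit_core_deriv(2)[OF that R t(1) tt(2), of x]
    unfolding B_def B'_def s_def X1_def X2_def T1_def .
  have contE: "continuous_on {-t..t} (\<lambda>y. X1 y - T1 f g (x, y))"
      "continuous_on {-t..t} (\<lambda>y. (y / s y) * (X2 y - T1 g f (x, y)))" if h: "cmc_graph R h f g" for h f g x
  proof -
    show "continuous_on {-t..t} (\<lambda>y. X1 y - T1 f g (x, y))"
      using cont_seg_band[OF continuous_deficit[OF h] tt(2), of x] by (simp add: X1_def s_def T1_def)
    have c1: "continuous_on {-t..t} (\<lambda>y. T1 g f (x, y))"
      unfolding T1_def using cmc_graph_continuous(3,4)[OF h]
      by (intro continuous_intros cont_seg_band[OF _ tt(2)])
    have c2: "continuous_on {-t..t} (\<lambda>y. y / s y)"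
      using spos unfolding s_def by (intro continuous_intros) (force simp: abs_le_iff)
    have c3: "continuous_on {-t..t} X2" unfolding X2_def using R by (intro continuous_intros) auto
    show "continuous_on {-t..t} (\<lambda>y. (y / s y) * (X2 y - T1 g f (x, y)))"
      by (rule continuous_on_mult[OF c2 continuous_on_diff[OF c3 c1]])
  qed
  have Babs: "\<bar>B f g x\<bar> \<le> 4 * R\<^sup>2" if h: "cmc_graph R h f g" for h f g x
  proof -
    have "\<bar>B f g x\<bar> \<le> 2 * t * (R * 2)" unfolding B_def
    proof (rule integral_abs_le_bound[OF _ _ t(1)])
      show "continuous_on {-t..t} (\<lambda>y. s y * (X1 y - T1 f g (x, y)))"
        by (intro continuous_on_mult contE(1)[OF h]) (auto simp: s_def intro!: continuous_intros)
      fix y assume "\<bar>y\<bar> \<le> t"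
      then have y: "\<bar>y\<bar> \<le> R" using tt by simp
      have "\<bar>X1 y - T1 f g (x, y)\<bar> \<le> 2"
        using rb(3,4)[OF y] flux_abs_le[of "f (x, y)" "g (x, y)"] unfolding X1_def T1_def by linarith
      then show "\<bar>s y * (X1 y - T1 f g (x, y))\<bar> \<le> R * 2"
        unfolding abs_mult using rb(1,2)[OF y] by (intro mult_mono) auto
    qed
    also have "\<dots> \<le> 2 * R * (R * 2)" using tt R by (intro mult_right_mono) auto
    finally show ?thesis by (simp add: power2_eq_square)
  qed
  have intE: "integral {-t..t} (\<lambda>y. E f g (x, y)) \<le> Q / 8 + 4 * \<delta> - B' f g x + 4 * s t"
    if h: "cmc_graph R h f g" and d: "deficit R f g x \<le> Q / 8" for h f g x
  proof -
    define J where "J = (t / R - T1 g f (x, t)) - (- t / R - T1 g f (x, -t))"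
    have "integral {-t..t} (\<lambda>y. E f g (x, y)) = integral {-t..t} (\<lambda>y. X1 y - T1 f g (x, y))
        + integral {-t..t} (\<lambda>y. (y / s y) * (X2 y - T1 g f (x, y)))"
      unfolding E_def snd_conv by (intro integral_add integrable_continuous_real contE[OF h])
    moreover have "integral {-t..t} (\<lambda>y. X1 y - T1 f g (x, y)) \<le> deficit R f g x + 4 * (R - t)"
      using deficit_core_diff[OF h R t(1) tt(2), of x] unfolding X1_def s_def T1_def by linarith
    moreover have "integral {-t..t} (\<lambda>y. (y / s y) * (X2 y - T1 g f (x, y))) = - B' f g x - s t * J"
      unfolding B'_def J_def[symmetric] by simp
    moreover have "s t * (- J) \<le> s t * 4"
    proof (rule mult_left_mono[OF _ rb(1)[OF tR]])
      have "t / R \<ge> 0" "- t / R = - (t / R)" using t R by simp_all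
      then show "- J \<le> 4"
        using flux_abs_le[of "g (x, t)" "f (x, t)"] flux_abs_le[of "g (x, -t)" "f (x, -t)"]
        unfolding J_def T1_def by linarith
    qed
    ultimately show ?thesis using d t(2) by simp
  qed
  \<comment> \<open>The mean value theorem is applied to the sum so that one \<open>x\<close> serves
    for both solutions.\<close>
  obtain x where x: "N0 < x" "x < N0 + n"
    "(B p q (N0 + n) + B a b (N0 + n)) - (B p q N0 + B a b N0) = (N0 + n - N0) * (B' p q x + B' a b x)"
    using MVT2[of N0 "N0 + n" "\<lambda>x. B p q x + B a b x" "\<lambda>x. B' p q x + B' a b x"] n
      DERIV_add[OF DB[OF gu] DB[OF gv]] by auto
  have "n * (B' p q x + B' a b x) \<ge> - (16 * R\<^sup>2)"
    using x(3) Babs[OF gu, of "N0 + n"] Babs[OF gu, of N0] Babs[OF gv, of "N0 + n"] Babs[OF gv, of N0] by simp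
  moreover have "16 * R\<^sup>2 = n * (Q / 4)" using Q R by (simp add: n_def)
  ultimately have "n * (- (Q / 4)) \<le> n * (B' p q x + B' a b x)" by simp
  then have Bx: "- (Q / 4) \<le> B' p q x + B' a b x" using n by (subst (asm) mult_le_cancel_left_pos)
  have Esum: "integral {-t..t} (\<lambda>y. E p q (x, y)) + integral {-t..t} (\<lambda>y. E a b (x, y)) \<le> Q"
    using intE[OF gu N12(1), of x] intE[OF gv N12(2), of x] x(1,2) Bx st \<delta>(3) Q by (simp add: N0_def)
  have iE: "(\<lambda>y. E f g (x, y)) integrable_on {-t..t}" if h: "cmc_graph R h f g" for h f g
    unfolding E_def snd_conv by (intro integrable_add integrable_continuous_real contE[OF h])
  have "A e x = integral {-t..t} (\<lambda>y. sat e (w (x, y)) * D1 (x, y))" using Aeq x by simp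
  also have "\<dots> \<le> integral {-t..t} (\<lambda>y. 2 * c + (1 / (2 * c) * E p q (x, y) + 1 / (2 * c) * E a b (x, y)))"
  proof (rule integral_le)
    fix y assume "y \<in> {-t..t}"
    then have y: "\<bar>y\<bar> \<le> t" by auto
    have am: "\<bar>r\<bar> \<le> c + r\<^sup>2 / (4 * c)" for r :: real
    proof -
      have "4 * c * \<bar>r\<bar> \<le> 4 * c * c + r\<^sup>2"
        using zero_le_power2[of "\<bar>r\<bar> - 2 * c"] by (simp add: power2_eq_square algebra_simps)
      then show ?thesis using c by (simp add: field_simps)
    qed
    have "sat e (w (x, y)) * D1 (x, y) \<le> \<bar>D1 (x, y)\<bar>"
      using mult_mono[OF sat_bounds(2)[of e "w (x, y)"] order_refl[of "\<bar>D1 (x, y)\<bar>"]]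
        mult_left_mono[OF abs_ge_self[of "D1 (x, y)"] sat_bounds(1)[of e "w (x, y)"]] by simp
    also have "\<dots> \<le> \<bar>X1 y - T1 p q (x, y)\<bar> + \<bar>X1 y - T1 a b (x, y)\<bar>" by (simp add: D1_def T1_def)
    also have "\<dots> \<le> (c + (X1 y - T1 p q (x, y))\<^sup>2 / (4 * c)) + (c + (X1 y - T1 a b (x, y))\<^sup>2 / (4 * c))"
      by (intro add_mono am)
    also have "\<dots> \<le> (c + 2 * E p q (x, y) / (4 * c)) + (c + 2 * E a b (x, y) / (4 * c))"
      using c by (intro add_mono divide_right_mono E_ge[OF y]) auto
    finally show "sat e (w (x, y)) * D1 (x, y) \<le> 2 * c + (1 / (2 * c) * E p q (x, y) + 1 / (2 * c) * E a b (x, y))"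
      by simp
  next
    show "(\<lambda>y. sat e (w (x, y)) * D1 (x, y)) integrable_on {-t..t}"
      using tt by (intro integrable_continuous_real continuous_intros cont_segs)
    show "(\<lambda>y. 2 * c + (1 / (2 * c) * E p q (x, y) + 1 / (2 * c) * E a b (x, y))) integrable_on {-t..t}"
      by (intro integrable_add integrable_on_mult_right integrable_const_ivl iE[OF gu] iE[OF gv])
  qed
  also have "\<dots> = 2 * t * (2 * c) + 1 / (2 * c) * (integral {-t..t} (\<lambda>y. E p q (x, y)) + integral {-t..t} (\<lambda>y. E a b (x, y)))"
  proof -
    have i: "(\<lambda>y. 1 / (2 * c) * E p q (x, y)) integrable_on {-t..t}" "(\<lambda>y. 1 / (2 * c) * E a b (x, y)) integrable_on {-t..t}"
      by (intro integrable_on_mult_right iE[OF gu] iE[OF gv])+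
    have "integral {-t..t} (\<lambda>y. 2 * c + (1 / (2 * c) * E p q (x, y) + 1 / (2 * c) * E a b (x, y)))
      = integral {-t..t} (\<lambda>y. 2 * c) + (integral {-t..t} (\<lambda>y. 1 / (2 * c) * E p q (x, y)) + integral {-t..t} (\<lambda>y. 1 / (2 * c) * E a b (x, y)))"
      using integral_add[OF i] integral_add[OF _ integrable_add[OF i], of "\<lambda>y. 2 * c"]
      by (simp only: integrable_const_ivl)
    also have "\<dots> = 2 * t * (2 * c) + 1 / (2 * c) * (integral {-t..t} (\<lambda>y. E p q (x, y)) + integral {-t..t} (\<lambda>y. E a b (x, y)))"
      unfolding integral_mult_right using t by (simp add: algebra_simps)
    finally show ?thesis .
  qed
  also have "\<dots> \<le> 2 * R * (2 * c) + 1 / (2 * c) * Q"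
    using Esum tt c by (intro add_mono mult_right_mono mult_left_mono) auto
  also have "\<dots> = k" using c R k by (simp add: Q_def) (simp add: c_def)
  finally show "\<exists>x\<ge>N. A e x \<le> k" using x(1) by (intro exI[of _ x]) (auto simp: N0_def)
qed

end

subsection \<open>Uniqueness\<close>

text \<open>The first component of \<open>X\<close> exceeds the flux of a cylinder of slope
  \<open>m\<close> by at most \<open>1 / m\<close>, and \<open>flux_le_of_le_cyl\<close> bounds the
  rest of the deficit at one cross-section. As the deficit is nonincreasing, one cross-section is
  enough.\<close>

lemma deficit_vanishes_if_steep:
  assumes g: "cmc_graph R v a b" and R: "R > 0" and \<kappa>: "\<kappa> > 0"
    and steep: "\<And>M. \<exists>m\<ge>M. \<exists>k. \<forall>x y. \<bar>y\<bar> \<le> R \<longrightarrow> cyl R m k (x, y) \<le> v (x, y)"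
  shows "\<exists>N. \<forall>x\<ge>N. deficit R a b x \<le> \<kappa>"
proof -
  \<comment> \<open>This slope makes the integral of \<open>1 / m\<close> over a cross-section at
    most \<open>\<kappa> / 2\<close>.\<close>
  obtain m k where m: "m \<ge> 4 * R / \<kappa> + 1" and le: "\<And>x y. \<bar>y\<bar> \<le> R \<Longrightarrow> cyl R m k (x, y) \<le> v (x, y)"
    using steep by blast
  have "4 * R / \<kappa> > 0" using R \<kappa> by simp
  then have m1: "m \<ge> 1" "4 * R / \<kappa> \<le> m" using m by linarith+
  have gc: "cmc_graph R (cyl R m k) (\<lambda>z. m) (cyl_y R m)" by (rule cmc_graph_cyl[OF R])
  obtain x1 where x1: "integral {-R..R} (\<lambda>y. flux m (cyl_y R m (x1, y)) - flux (a (x1, y)) (b (x1, y))) \<le> \<kappa> / 2"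
    using flux_le_of_le_cyl[OF g R _ le, of "\<kappa> / 2" 0] \<kappa> by auto
  let ?c = "\<lambda>y. sqrt (R\<^sup>2 - y\<^sup>2) / R - flux m (cyl_y R m (x1, y))"
  let ?d = "\<lambda>y. flux m (cyl_y R m (x1, y)) - flux (a (x1, y)) (b (x1, y))"
  have ic: "?c integrable_on {-R..R}"
  proof (rule bounded_continuous_integrable)
    show "continuous_on {-R<..<R} ?c"
      using cont_open_band[OF continuous_deficit[OF gc], of x1] by simp
    show "\<bar>?c y\<bar> \<le> 2" if "\<bar>y\<bar> \<le> R" for y
      using root_over_bounds(3,4)[OF R that] flux_abs_le[of m "cyl_y R m (x1, y)"] by linarith
  qed
  have id: "?d integrable_on {-R..R}"
    by (rule bounded_continuous_integrable[OF _ flux_diff_abs_le])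
      (intro continuous_intros cont_open_band cmc_graph_continuous(3,4)[OF g] cmc_graph_continuous(4)[OF gc])
  have "deficit R a b x1 = integral {-R..R} ?c + integral {-R..R} ?d"
    unfolding deficit_def by (subst integral_add[OF ic id, symmetric]) simp
  also have "integral {-R..R} ?c \<le> integral {-R..R} (\<lambda>y. 1 / m)"
  proof (rule integral_le[OF ic])
    fix y assume y: "y \<in> {-R..R}"
    show "?c y \<le> 1 / m"
    proof (cases "\<bar>y\<bar> < R")
      case True
      define M where "M = sqrt (1 + m\<^sup>2)"
      have "m \<le> M" unfolding M_def using m1 by (intro real_le_rsqrt) simp
      have "M \<le> m + 1" unfolding M_def using m1 by (intro real_le_lsqrt) (auto simp: power2_eq_square algebra_simps)
      have "flux m (cyl_y R m (x1, y)) = m / M * (sqrt (R\<^sup>2 - y\<^sup>2) / R)"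
        using flux_cyl(1)[of "(x1, y)" R m] True R by (simp add: mem_band M_def)
      then have "?c y = (1 - m / M) * (sqrt (R\<^sup>2 - y\<^sup>2) / R)" by (simp only: left_diff_distrib mult_1_left)
      also have "\<dots> \<le> (1 - m / M) * 1"
        using root_over_bounds(4)[OF R, of y] True \<open>m \<le> M\<close> m1 by (intro mult_left_mono) auto
      also have "\<dots> = (M - m) / M" using \<open>m \<le> M\<close> m1 by (simp add: field_simps)
      also have "\<dots> \<le> 1 / m" using \<open>m \<le> M\<close> \<open>M \<le> m + 1\<close> m1 by (intro frac_le) auto
      finally show ?thesis .
    next
      case False
      then have "y\<^sup>2 = R\<^sup>2" using y by (auto simp: abs_if power2_eq_iff split: if_splits)
      \<comment> \<open>At the end points \<open>cyl_y\<close> is only a default value of division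
        by 0, but the sign of \<open>flux\<close> depends on \<open>m\<close> alone.\<close>
      then have "?c y = - flux m (cyl_y R m (x1, y))" by simp
      also have "\<dots> \<le> 0" using m1 by (simp add: flux_def)
      also have "0 \<le> 1 / m" using m1 by simp
      finally show ?thesis .
    qed
  qed (rule integrable_const_ivl)
  also have "integral {-R..R} (\<lambda>y. 1 / m) \<le> \<kappa> / 2"
    using m1 \<kappa> R by (simp add: field_simps)
  finally have d: "deficit R a b x1 \<le> \<kappa>" using x1 by simp
  show ?thesis
    using deficit_antimono[OF g R] d by (intro exI[of _ x1]) (auto intro: order_trans)
qed

text \<open>The slopes of supporting lines of \<open>f\<close> are nondecreasing, so on the positive
  half-line they are either bounded, which bounds \<open>w\<close>, or arbitrarily large, which
  makes both deficits vanish.\<close>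

lemma flux_vanishes_if_convex:
  assumes gu: "cmc_graph R u p q" and gv: "cmc_graph R v a b" and R: "R > 0"
    and f: "convex_on UNIV f"
    and bu: "\<And>x. u (x, R) = f x" "\<And>x. u (x, -R) = f x"
    and bv: "\<And>x. v (x, R) = f x" "\<And>x. v (x, -R) = f x"
    and e: "e > 0"
  shows "flux_vanishes R u p q v a b e"
proof -
  interpret cmc_pair R u p q v a b
    by unfold_locales (use R gu gv bu bv in auto)
  \<comment> \<open>The right derivative of \<open>f\<close>, as an infimum of difference quotients;
    it is the slope of a supporting line at \<open>x\<close>.\<close>
  define m where "m x = Inf ((\<lambda>t. (f x - f t) / (x - t)) ` ({x<..} \<inter> UNIV))" for x
  have m: "f x + m x * (y - x) \<le> f y" for x y
    using convex_le_Inf_differential[OF f, of x y] by (simp add: m_def)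
  have cu: "cyl R (m x0) (f x0 - m x0 * x0) (x, y) \<le> u (x, y)"
    and cv: "cyl R (m x0) (f x0 - m x0 * x0) (x, y) \<le> v (x, y)" if "\<bar>y\<bar> \<le> R" for x0 x y
    using that m[of x0] by (auto intro!: cyl_le[OF gu R] cyl_le[OF gv R] simp: bu bv algebra_simps)
  show ?thesis
  proof (cases "\<exists>K. \<forall>x\<ge>0. m x \<le> K")
    case True
    then obtain K where K: "\<And>x. x \<ge> 0 \<Longrightarrow> m x \<le> K" by blast
    \<comment> \<open>\<open>K\<close> bounds the slopes from above, and by monotonicity
      \<open>m 0\<close> bounds them from below.\<close>
    define L where "L = max \<bar>K\<bar> \<bar>m 0\<bar>"
    have mL: "\<bar>m x\<bar> \<le> L" if "x \<ge> 0" for x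
    proof -
      have "(m x - m 0) * x \<ge> 0" using m[of x 0] m[of 0 x] by (simp add: algebra_simps)
      then have "m 0 \<le> m x \<or> x = 0" using that by (auto simp: zero_le_mult_iff)
      then show ?thesis using K[OF that] by (auto simp: L_def)
    qed
    have lip: "f x' \<le> f x + L * \<bar>x' - x\<bar>" if "x' \<ge> 0" for x x'
    proof -
      have "- (m x' * (x - x')) \<le> \<bar>m x'\<bar> * \<bar>x' - x\<bar>"
        by (metis abs_ge_minus_self abs_minus_commute abs_mult)
      also have "\<dots> \<le> L * \<bar>x' - x\<bar>" using mL[OF that] by (rule mult_right_mono) simp
      finally show ?thesis using m[of x' x] by linarith
    qed
    show ?thesis
    proof (rule flux_vanishes_if_bounded[OF e])
      \<comment> \<open>\<open>x \<ge> 3 * R\<close> keeps the disc of radius \<open>3 * R\<close>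
        over the half-line where \<open>lip\<close> holds. The sphere bounds \<open>u\<close> above
        and the supporting cylinder at \<open>x\<close> bounds \<open>v\<close> below, both relative
        to \<open>f x\<close>, which cancels in \<open>w\<close>.\<close>
      fix x y :: real assume x: "x \<ge> 3 * R" and y: "\<bar>y\<bar> < R"
      have "u (x, y) \<le> (f x + L * (3 * R)) + 3 * R"
      proof (rule cmc_graph_le_sphere[OF gu R, where ya = "-R" and yb = R and ?x0.0 = x and ?y0.0 = 0])
        fix x' y' assume y': "y' = - R \<or> y' = R" and c: "(x' - x)\<^sup>2 + (y' - 0)\<^sup>2 \<le> (3 * R)\<^sup>2"
        have "(x' - x)\<^sup>2 \<le> (3 * R)\<^sup>2" using c zero_le_power2[of "y' - 0"] by linarith
        then have "\<bar>x' - x\<bar> \<le> \<bar>3 * R\<bar>" by (simp only: abs_le_square_iff)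
        then have d: "\<bar>x' - x\<bar> \<le> 3 * R" using R by simp
        have "f x' \<le> f x + L * \<bar>x' - x\<bar>" using d x by (intro lip) linarith
        also have "L * \<bar>x' - x\<bar> \<le> L * (3 * R)" using d by (intro mult_left_mono) (auto simp: L_def)
        finally show "u (x', y') \<le> f x + L * (3 * R)" using y' bu by auto
      next
        have "y\<^sup>2 \<le> (3 * R)\<^sup>2" using y R by (intro power2_le_iff_abs_le[THEN iffD2]) auto
        then show "(x - x)\<^sup>2 + (y - 0)\<^sup>2 \<le> (3 * R)\<^sup>2" by simp
      qed (use R y in auto)
      moreover have "f x - sqrt (1 + L\<^sup>2) * R \<le> v (x, y)"
      proof -
        have "(m x)\<^sup>2 \<le> L\<^sup>2" using mL[of x] x R by (intro power2_le_iff_abs_le[THEN iffD2]) auto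
        then have "sqrt (1 + (m x)\<^sup>2) * sqrt (R\<^sup>2 - y\<^sup>2) \<le> sqrt (1 + L\<^sup>2) * R"
          using root_over_bounds(1,2)[OF R, of y] y by (intro mult_mono) auto
        then show ?thesis using cv[of y x x] y by (simp add: cyl_def algebra_simps)
      qed
      ultimately show "w (x, y) \<le> L * (3 * R) + 3 * R + sqrt (1 + L\<^sup>2) * R" by (simp add: w_def)
    qed
  next
    case False
    have "\<exists>N. \<forall>x\<ge>N. deficit R p q x \<le> \<kappa>" if "\<kappa> > 0" for \<kappa>
      using False cu by (intro deficit_vanishes_if_steep[OF gu R that]) (meson linear)
    moreover have "\<exists>N. \<forall>x\<ge>N. deficit R a b x \<le> \<kappa>" if "\<kappa> > 0" for \<kappa>
      using False cv by (intro deficit_vanishes_if_steep[OF gv R that]) (meson linear)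
    ultimately show ?thesis by (rule flux_vanishes_if_deficits_vanish[OF e])
  qed
qed

text \<open>The end at minus infinity becomes the end at infinity for the reflected solutions, whose
  boundary values \<open>f (- x)\<close> are again convex.\<close>

lemma cmc_graph_le:
  assumes gu: "cmc_graph R u p q" and gv: "cmc_graph R v a b" and R: "R > 0"
    and f: "convex_on UNIV f"
    and bu: "\<And>x. u (x, R) = f x" "\<And>x. u (x, -R) = f x"
    and bv: "\<And>x. v (x, R) = f x" "\<And>x. v (x, -R) = f x"
    and y: "\<bar>y\<bar> \<le> R"
  shows "u (x, y) \<le> v (x, y)"
proof -
  interpret cmc_pair R u p q v a b
    by unfold_locales (use R gu gv bu bv in auto)
  have f': "convex_on UNIV (\<lambda>x. f (- x))"
  proof (rule convex_onI)
    fix t x y :: real assume "0 < t" "t < 1"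
    then show "f (- ((1 - t) *\<^sub>R x + t *\<^sub>R y)) \<le> (1 - t) * f (- x) + t * f (- y)"
      using convex_onD[OF f, of t "- x" "- y"] by simp
  qed simp
  show ?thesis
  proof (rule le_of_flux_vanishes[OF _ _ y])
    fix e :: real assume e: "e > 0"
    show "flux_vanishes R u p q v a b e"
      by (rule flux_vanishes_if_convex[OF gu gv R f bu bv e])
    show "flux_vanishes R (\<lambda>z. u (reflect z)) (\<lambda>z. - p (reflect z)) (\<lambda>z. q (reflect z))
     (\<lambda>z. v (reflect z)) (\<lambda>z. - a (reflect z)) (\<lambda>z. b (reflect z)) e"
      by (rule flux_vanishes_if_convex[OF cmc_graph_reflect[OF gu] cmc_graph_reflect[OF gv] R f' _ _ _ _ e])
         (simp_all add: bu bv)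
  qed
qed

section \<open>From the definitions of the statement to \<open>cmc_graph\<close>\<close>

lemma Basis_plane: "(Basis :: (real \<times> real) set) = {(1, 0), (0, 1)}"
  by (auto simp: Basis_prod_def)

lemma linear_plane:
  assumes "linear (F :: real \<times> real \<Rightarrow> 'a::real_vector)"
  shows "F h = fst h *\<^sub>R F (1, 0) + snd h *\<^sub>R F (0, 1)"
proof -
  have "F h = F (fst h *\<^sub>R (1, 0) + snd h *\<^sub>R (0, 1))" by simp
  then show ?thesis by (simp only: linear_add[OF assms] linear_scale[OF assms])
qed

text \<open>The diagonal entries of the derivative of \<open>T\<close> are computed along the
  coordinate lines with \<open>DERIV_flux\<close>. Their sum is \<open>2 * H = 1 / R\<close>, and
  multiplication by \<open>W^3\<close> gives the equation in \<open>cmc_graph\<close>.\<close>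

lemma cmc_solution_imp_cmc_graph:
  assumes H: "H > 0" and s: "cmc_solution H (strip H) \<phi> u"
  obtains p q where "cmc_graph (1 / (2 * H)) u p q"
proof -
  define R where "R = 1 / (2 * H)"
  have R: "R > 0" "1 / R = 2 * H" using H by (simp_all add: R_def)
  have st: "strip H = band R" by (simp add: strip_def band_def R_def)
  have cl: "closure (strip H) = UNIV \<times> {-R..R}" by (simp add: closure_strip[OF H] R_def)
  define g where "g = gradient u"
  define p where "p z = fst (g z)" for z
  define q where "q z = snd (g z)" for z
  define g' where "g' z = frechet_derivative g (at z)" for z
  have cu: "continuous_on (UNIV \<times> {-R..R}) u"
    and C2: "C2_on (band R) u"
    and eq: "\<And>z. z \<in> band R \<Longrightarrow> divergence (\<lambda>q. g q /\<^sub>R sqrt (1 + (norm (g q))\<^sup>2)) z = 1 / R"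
    using s unfolding cmc_solution_def g_def R(2) st[symmetric] cl[symmetric] by blast+
  have du: "(u has_derivative (\<lambda>h. fst h * p z + snd h * q z)) (at z)" if "z \<in> band R" for z
  proof -
    have "GDERIV u z :> g z" using C2 that unfolding g_def C2_on_def by (intro gderiv_gradient) auto
    then show ?thesis by (simp add: gderiv_def inner_prod_def p_def q_def)
  qed
  have dg: "(g has_derivative g' z) (at z)" if "z \<in> band R" for z
    using C2 that unfolding g'_def g_def C2_on_def by (simp add: frechet_derivative_works)
  have g': "g' z h = fst h *\<^sub>R g' z (1, 0) + snd h *\<^sub>R g' z (0, 1)" if "z \<in> band R" for z h
    using has_derivative_linear[OF dg[OF that]] by (rule linear_plane)
  define px where "px z = fst (g' z (1, 0))" for z
  define py where "py z = fst (g' z (0, 1))" for z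
  define qx where "qx z = snd (g' z (1, 0))" for z
  define qy where "qy z = snd (g' z (0, 1))" for z
  have dp: "(p has_derivative (\<lambda>h. fst h * px z + snd h * py z)) (at z)"
    and dq: "(q has_derivative (\<lambda>h. fst h * qx z + snd h * qy z)) (at z)" if z: "z \<in> band R" for z
  proof -
    have e: "fst (g' z h) = fst h * px z + snd h * py z" "snd (g' z h) = fst h * qx z + snd h * qy z" for h
      using arg_cong[OF g'[OF z, of h], of fst] arg_cong[OF g'[OF z, of h], of snd]
      by (simp_all add: px_def py_def qx_def qy_def)
    have "((\<lambda>z. fst (g z)) has_derivative (\<lambda>h. fst h * px z + snd h * py z)) (at z)"
      by (rule has_derivative_eq_rhs[OF has_derivative_fst[OF dg[OF z]]]) (rule ext, rule e)
    then show "(p has_derivative (\<lambda>h. fst h * px z + snd h * py z)) (at z)"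
      by (simp add: p_def[abs_def])
    have "((\<lambda>z. snd (g z)) has_derivative (\<lambda>h. fst h * qx z + snd h * qy z)) (at z)"
      by (rule has_derivative_eq_rhs[OF has_derivative_snd[OF dg[OF z]]]) (rule ext, rule e)
    then show "(q has_derivative (\<lambda>h. fst h * qx z + snd h * qy z)) (at z)"
      by (simp add: q_def[abs_def])
  qed
  have cont: "continuous_on (band R) (\<lambda>z. g' z (1, 0))" "continuous_on (band R) (\<lambda>z. g' z (0, 1))"
    using C2 unfolding C2_on_def g'_def g_def Basis_plane by auto
  have "cmc_graph R u p q"
    unfolding cmc_graph_def
  proof (intro conjI ballI exI)
    show "continuous_on (band R) px" "continuous_on (band R) py"
      "continuous_on (band R) qx" "continuous_on (band R) qy"
      unfolding px_def py_def qx_def qy_def by (intro continuous_intros cont)+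
    fix z assume z: "z \<in> band R"
    obtain x y where xy: "z = (x, y)" by (cases z)
    define T where "T z = g z /\<^sub>R sqrt (1 + (norm (g z))\<^sup>2)" for z
    have n: "(norm (g z))\<^sup>2 = (p z)\<^sup>2 + (q z)\<^sup>2" for z
      by (cases "g z") (simp add: p_def q_def norm_Pair)
    have T: "T z = (flux (p z) (q z), flux (q z) (p z))" for z
      unfolding T_def n flux_def by (cases "g z") (simp add: p_def q_def divide_inverse_commute add_ac)
    \<comment> \<open>\<open>divergence\<close> refers to \<open>frechet_derivative\<close>, which
      carries information only once differentiability is known.\<close>
    have "T differentiable (at z)"
    proof -
      have pos: "1 + (norm (g z))\<^sup>2 > 0" by (simp add: add_pos_nonneg)
      have "(\<lambda>z. 1 + (norm (g z))\<^sup>2) differentiable (at z)"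
        unfolding n using dp[OF z] dq[OF z] by (auto intro!: derivative_intros intro: differentiableI)
      then obtain n' where "((\<lambda>z. 1 + (norm (g z))\<^sup>2) has_derivative n') (at z)" by (auto simp: differentiable_def)
      from Deriv.has_derivative_inverse[OF _ has_derivative_real_sqrt[OF pos this]] pos
      have "(\<lambda>z. inverse (sqrt (1 + (norm (g z))\<^sup>2))) differentiable (at z)"
        by (auto simp: differentiable_def)
      then show ?thesis unfolding T_def
        using dg[OF z] by (intro differentiable_scaleR) (auto intro: differentiableI)
    qed
    then have dT: "(T has_derivative frechet_derivative T (at z)) (at z)"
      by (simp add: frechet_derivative_works)
    define T' where "T' = frechet_derivative T (at z)"
    have lin: "T' h = fst h *\<^sub>R T' (1, 0) + snd h *\<^sub>R T' (0, 1)" for h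
      using has_derivative_linear[OF dT] unfolding T'_def by (rule linear_plane)
    have lin': "fst (T' h) = fst h * fst (T' (1, 0)) + snd h * fst (T' (0, 1))"
      "snd (T' h) = fst h * snd (T' (1, 0)) + snd h * snd (T' (0, 1))" for h
      using arg_cong[OF lin[of h], of fst] arg_cong[OF lin[of h], of snd] by simp_all
    note dT' = dT[folded T'_def]
    have dT1: "((\<lambda>z. flux (p z) (q z)) has_derivative (\<lambda>h. fst (T' h))) (at z)"
      using has_derivative_fst[OF dT'] unfolding T fst_conv .
    have dT2: "((\<lambda>z. flux (q z) (p z)) has_derivative (\<lambda>h. snd (T' h))) (at z)"
      using has_derivative_snd[OF dT'] unfolding T snd_conv .
    have "((\<lambda>z. flux (p z) (q z)) has_derivative (\<lambda>h. fst h * fst (T' (1, 0)) + snd h * fst (T' (0, 1)))) (at (x, y))"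
      unfolding xy[symmetric] by (rule has_derivative_eq_rhs[OF dT1]) (rule ext, rule lin'(1))
    from DERIV_partial(1)[OF this]
    have 1: "fst (T' (1, 0)) = ((1 + (q z)\<^sup>2) * px z - p z * q z * qx z) / (sqrt (1 + (p z)\<^sup>2 + (q z)\<^sup>2)) ^ 3"
      using DERIV_flux[OF DERIV_partial(1)[OF dp[OF z, unfolded xy]] DERIV_partial(1)[OF dq[OF z, unfolded xy]]]
      unfolding xy by (rule DERIV_unique)
    have "((\<lambda>z. flux (q z) (p z)) has_derivative (\<lambda>h. fst h * snd (T' (1, 0)) + snd h * snd (T' (0, 1)))) (at (x, y))"
      unfolding xy[symmetric] by (rule has_derivative_eq_rhs[OF dT2]) (rule ext, rule lin'(2))
    from DERIV_partial(2)[OF this]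
    have 2: "snd (T' (0, 1)) = ((1 + (p z)\<^sup>2) * qy z - q z * p z * py z) / (sqrt (1 + (q z)\<^sup>2 + (p z)\<^sup>2)) ^ 3"
      using DERIV_flux[OF DERIV_partial(2)[OF dq[OF z, unfolded xy]] DERIV_partial(2)[OF dp[OF z, unfolded xy]]]
      unfolding xy by (rule DERIV_unique)
    have "1 / R = fst (T' (1, 0)) + snd (T' (0, 1))"
      using eq[OF z] unfolding divergence_def Basis_plane T_def[symmetric] T'_def by (simp add: inner_prod_def)
    also have "\<dots> = ((1 + (q z)\<^sup>2) * px z - p z * q z * (py z + qx z) + (1 + (p z)\<^sup>2) * qy z) / (sqrt (1 + (p z)\<^sup>2 + (q z)\<^sup>2)) ^ 3"
      unfolding 1 2 add.assoc add.commute[of "(q z)\<^sup>2"] by (simp add: add_divide_distrib[symmetric] algebra_simps)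
    finally show "(1 + (q z)\<^sup>2) * px z - p z * q z * (py z + qx z) + (1 + (p z)\<^sup>2) * qy z
        = sqrt (1 + (p z)\<^sup>2 + (q z)\<^sup>2) ^ 3 / R"
      using slope_pos[of "p z" "q z"] by (simp add: field_simps)
  qed (use cu du dp dq in auto)
  then show ?thesis using that unfolding R_def by blast
qed

theorem theorem10:
  fixes H :: real and f :: "real \<Rightarrow> real" and u v :: "real \<times> real \<Rightarrow> real"
  assumes "H > 0"
    and "convex_on UNIV f"
    and "cmc_solution H (strip H) (strip_data f) u"
    and "cmc_solution H (strip H) (strip_data f) v"
  shows "\<forall>p\<in>closure (strip H). u p = v p"
proof -
  define R where "R = 1 / (2 * H)"
  have R: "R > 0" using assms(1) by (simp add: R_def)
  have bd: "w (x, R) = f x" "w (x, -R) = f x" if "cmc_solution H (strip H) (strip_data f) w" for w x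
    using that unfolding cmc_solution_def frontier_strip[OF assms(1)] by (auto simp: strip_data_def R_def)
  obtain p q where gu: "cmc_graph R u p q"
    using cmc_solution_imp_cmc_graph[OF assms(1,3)] unfolding R_def .
  obtain a b where gv: "cmc_graph R v a b"
    using cmc_solution_imp_cmc_graph[OF assms(1,4)] unfolding R_def .
  show ?thesis
  proof
    fix z assume "z \<in> closure (strip H)"
    then obtain x y where z: "z = (x, y)" "\<bar>y\<bar> \<le> R"
      by (cases z) (auto simp: closure_strip[OF assms(1)] R_def abs_le_iff)
    show "u z = v z"
      unfolding z(1)
      by (intro antisym cmc_graph_le[OF gu gv R assms(2) bd[OF assms(3)] bd[OF assms(4)] z(2)]
          cmc_graph_le[OF gv gu R assms(2) bd[OF assms(4)] bd[OF assms(3)] z(2)])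
  qed
qed

end
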